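(* Let $\mathbb{F}\in\{\mathbb{R},\mathbb{C},\mathbb{H}\}$ with $d=\dim_{\mathbb{R}}\mathbb{F}$, let $q\in\mathbb{N}$ and $\rho:=d(q-\tfrac12)+1$. Let $\nu$ be a probability measure on $\Pi_q$ with finite fourth moment $\int_{\Pi_q}\|x\|^4\,d\nu(x)<\infty$, and put $\sigma^2:=\int_{\Pi_q}s^2\,d\nu(s)\in\Pi_q$. Let $(\mu_n)_{n\ge1}$ be a sequence of real numbers $\mu_n>\rho$ with $n^2/\mu_n\to0$ for $n\to\infty$. For $\mu>\rho$ let $(S_n^\mu)_{n\ge0}$ be the Bessel random walk on $\Pi_q$ of index $\mu$ with law $\nu$. Then $$\frac{(S_n^{\mu_n})^2-n\sigma^2}{\sqrt n}$$ converges in distribution for $n\to\infty$ to the normal distribution $N(0,\Sigma^2)$ on the vector space $H_q$ of Hermitian $q\times q$ matrices over $\mathbb{F}$, where $\Sigma^2$ is the covariance matrix of the image measure $Q(\nu)$ of $\nu$ under the square mapping $Q(x):=x^2$ on $\Pi_q$, regarded as a probability measure on $H_q$.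
   Context: $M_q$ is the space of $q\times q$ matrices over $\mathbb{F}$, $x^*:=\overline{x}^t$, $H_q=\{x\in M_q:x=x^*\}$, both Euclidean with scalar product $\langle x,y\rangle=\mathrm{Re}\,\mathrm{tr}(x^*y)$ and norm $\|x\|=\langle x,x\rangle^{1/2}$. $\Pi_q\subset H_q$ is the cone of positive semidefinite matrices; $\sqrt{\cdot}$ is the positive semidefinite square root. $\Delta$ denotes the determinant on $H_q$ (the product of the $q$ real eigenvalues, also for $\mathbb{F}=\mathbb{H}$). Let $D_q:=\{v\in M_q:v^*v<I\}$ (i.e. $I-v^*v$ positive definite) and, for $\mu>\rho-1$, $\kappa_\mu:=\int_{D_q}\Delta(I-v^*v)^{\mu-\rho}\,dv$. The Bessel convolution $*_\mu$ of index $\mu>\rho-1$ of point measures on $\Pi_q$ is the probability measure $\delta_r*_\mu\delta_s$ given by $$(\delta_r*_\mu\delta_s)(f):=\frac1{\kappa_\mu}\int_{D_q}f\left(\sqrt{r^2+s^2+svr+rv^*s}\right)\Delta(I-vv^* )^{\mu-\rho}\,dv,\qquad f\in C(\Pi_q),$$ and it is extended to probability measures by $\nu_1*_\mu\nu_2:=\int\int\delta_r*_\mu\delta_s\,d\nu_1(r)\,d\nu_2(s)$ (a commutative, associative operation). A Bessel random walk $(S_n^\mu)_{n\ge0}$ on $\Pi_q$ of index $\mu$ with law $\nu$ is a time-homogeneous Markov chain on $\Pi_q$ with $S_0^\mu=0$ and transition probability $P(S_{n+1}^\mu\in A\mid S_n^\mu=x)=(\delta_x*_\mu\nu)(A)$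 for $x\in\Pi_q$ and Borel sets $A\subset\Pi_q$. Normal distributions may be degenerate. *)

theory Defs
  imports "HOL-Probability.Probability"
begin

section \<open>The real, complex and quaternion scalars\<close>

text \<open>
  A finite-dimensional associative real division algebra whose norm is multiplicative and comes
  from an inner product is isomorphic to the reals, the complex numbers or the quaternions
  (Frobenius), and the axiom \<open>hconj_mult_self\<close> leaves no choice for the
  conjugation. So quantifying over the types of this class is quantifying over
  these three algebras; each of them is made an instance below.
\<close>

class rch_algebra = real_normed_div_algebra + euclidean_space +
  fixes hconj :: "'a \<Rightarrow> 'a"
  assumes hconj_add: "hconj (x + y) = hconj x + hconj y"
    and hconj_scaleR: "hconj (r *\<^sub>R x) = r *\<^sub>R hconj x"
    and hconj_mult: "hconj (x * y) = hconj y * hconj x"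
    and hconj_hconj: "hconj (hconj x) = x"
    and hconj_mult_self: "hconj x * x = (norm x)\<^sup>2 *\<^sub>R 1"

instantiation real :: rch_algebra
begin

definition hconj_real :: "real \<Rightarrow> real" where "hconj_real x = x"

instance
  by standard (simp_all add: hconj_real_def power2_eq_square)

end

instantiation complex :: rch_algebra
begin

definition hconj_complex :: "complex \<Rightarrow> complex" where "hconj_complex = cnj"

instance
proof
  fix x :: complex
  show "hconj x * x = (norm x)\<^sup>2 *\<^sub>R 1"
    by (simp add: hconj_complex_def complex_eq_iff cmod_power2) (simp add: power2_eq_square)
qed (simp_all add: hconj_complex_def)

end

datatype quat = Quat (qre: real) (qi: real) (qj: real) (qk: real)

lemma quat_eq_iff: "x = y \<longleftrightarrow> qre x = qre y \<and> qi x = qi y \<and> qj x = qj y \<and> qk x = qk y"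
  by (cases x; cases y) auto

instantiation quat :: ring_1
begin

definition zero_quat :: quat where "0 = Quat 0 0 0 0"

definition one_quat :: quat where "1 = Quat 1 0 0 0"

definition plus_quat :: "quat \<Rightarrow> quat \<Rightarrow> quat" where
  "x + y = Quat (qre x + qre y) (qi x + qi y) (qj x + qj y) (qk x + qk y)"

definition uminus_quat :: "quat \<Rightarrow> quat" where
  "- x = Quat (- qre x) (- qi x) (- qj x) (- qk x)"

definition minus_quat :: "quat \<Rightarrow> quat \<Rightarrow> quat" where
  "x - y = Quat (qre x - qre y) (qi x - qi y) (qj x - qj y) (qk x - qk y)"

definition times_quat :: "quat \<Rightarrow> quat \<Rightarrow> quat" where
  "x * y = Quat
     (qre x * qre y - qi x * qi y - qj x * qj y - qk x * qk y)
     (qre x * qi y + qi x * qre y + qj x * qk y - qk x * qj y)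
     (qre x * qj y - qi x * qk y + qj x * qre y + qk x * qi y)
     (qre x * qk y + qi x * qj y - qj x * qi y + qk x * qre y)"

instance
  by standard
    (simp_all add: quat_eq_iff zero_quat_def one_quat_def plus_quat_def uminus_quat_def
      minus_quat_def times_quat_def algebra_simps)

end

lemmas quat_ring_defs = zero_quat_def one_quat_def plus_quat_def uminus_quat_def
  minus_quat_def times_quat_def

instantiation quat :: real_vector
begin

definition scaleR_quat :: "real \<Rightarrow> quat \<Rightarrow> quat" where
  "r *\<^sub>R x = Quat (r * qre x) (r * qi x) (r * qj x) (r * qk x)"

instance
  by standard (simp_all add: quat_eq_iff plus_quat_def scaleR_quat_def algebra_simps)

end

instantiation quat :: real_normed_vector
begin

definition norm_quat :: "quat \<Rightarrow> real" where
  "norm x = sqrt ((qre x)\<^sup>2 + (qi x)\<^sup>2 + (qj x)\<^sup>2 + (qk x)\<^sup>2)"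

definition sgn_quat :: "quat \<Rightarrow> quat" where
  "sgn x = inverse (norm x) *\<^sub>R x" for x :: quat

definition dist_quat :: "quat \<Rightarrow> quat \<Rightarrow> real" where
  "dist x y = norm (x - y)" for x y :: quat

definition uniformity_quat :: "(quat \<times> quat) filter" where
  "uniformity = (INF e\<in>{0<..}. principal {(x::quat, y). dist x y < e})"

definition open_quat :: "quat set \<Rightarrow> bool" where
  "open U \<longleftrightarrow> (\<forall>x\<in>U. eventually (\<lambda>(x', y). x' = x \<longrightarrow> y \<in> U) uniformity)"
  for U :: "quat set"

instance
proof
  fix x y :: quat and r s :: real and U :: "quat set"
  show "norm x = 0 \<longleftrightarrow> x = 0"
    by (cases x) (simp add: norm_quat_def zero_quat_def add_nonneg_eq_0_iff)
  show "norm (x + y) \<le> norm x + norm y"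
  proof -
    define c :: "quat \<Rightarrow> complex \<times> complex"
      where "c z = (Complex (qre z) (qi z), Complex (qj z) (qk z))" for z
    have "norm z = norm (c z)" for z
      by (simp add: norm_quat_def c_def norm_prod_def cmod_def algebra_simps)
    moreover have "c (x + y) = c x + c y"
      by (simp add: c_def plus_quat_def complex_eq_iff)
    ultimately show ?thesis
      by (simp add: norm_triangle_ineq)
  qed
  have "(norm (r *\<^sub>R x))\<^sup>2 = (\<bar>r\<bar> * norm x)\<^sup>2"
    by (simp add: norm_quat_def scaleR_quat_def power_mult_distrib algebra_simps)
  then show "norm (r *\<^sub>R x) = \<bar>r\<bar> * norm x"
    by (rule power2_eq_imp_eq) (simp_all add: norm_quat_def)
qed (simp_all add: quat_eq_iff quat_ring_defs scaleR_quat_def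
      sgn_quat_def dist_quat_def uniformity_quat_def open_quat_def algebra_simps)

end

instantiation quat :: real_inner
begin

definition inner_quat :: "quat \<Rightarrow> quat \<Rightarrow> real" where
  "x \<bullet> y = qre x * qre y + qi x * qi y + qj x * qj y + qk x * qk y"

instance
proof
  fix x :: quat
  show "x \<bullet> x = 0 \<longleftrightarrow> x = 0"
    by (cases x) (simp add: inner_quat_def zero_quat_def add_nonneg_eq_0_iff)
qed (simp_all add: plus_quat_def scaleR_quat_def inner_quat_def norm_quat_def
      power2_eq_square algebra_simps)

end

instantiation quat :: division_ring
begin

definition inverse_quat :: "quat \<Rightarrow> quat" where
  "inverse x = inverse (x \<bullet> x) *\<^sub>R Quat (qre x) (- qi x) (- qj x) (- qk x)"

definition divide_quat :: "quat \<Rightarrow> quat \<Rightarrow> quat" where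
  "x div y = x * inverse y" for x y :: quat

instance
proof
  fix x y :: quat
  show "inverse x * x = 1" if "x \<noteq> 0"
  proof -
    have "inverse x * x = inverse (x \<bullet> x) *\<^sub>R ((x \<bullet> x) *\<^sub>R 1)"
      by (simp add: quat_eq_iff inverse_quat_def scaleR_quat_def times_quat_def one_quat_def
          inner_quat_def algebra_simps)
    then show ?thesis
      using that by simp
  qed
  show "x * inverse x = 1" if "x \<noteq> 0"
  proof -
    have "x * inverse x = inverse (x \<bullet> x) *\<^sub>R ((x \<bullet> x) *\<^sub>R 1)"
      by (simp add: quat_eq_iff inverse_quat_def scaleR_quat_def times_quat_def one_quat_def
          inner_quat_def algebra_simps)
    then show ?thesis
      using that by simp
  qed
  show "inverse (0::quat) = 0"
    by (simp add: quat_eq_iff inverse_quat_def scaleR_quat_def zero_quat_def inner_quat_def)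
  show "x div y = x * inverse y"
    by (simp add: divide_quat_def)
qed

end

instance quat :: real_normed_div_algebra
proof
  fix x y :: quat and r :: real
  show "r *\<^sub>R x * y = r *\<^sub>R (x * y)"
    by (simp add: quat_eq_iff scaleR_quat_def times_quat_def algebra_simps)
  show "x * r *\<^sub>R y = r *\<^sub>R (x * y)"
    by (simp add: quat_eq_iff scaleR_quat_def times_quat_def algebra_simps)
  have "(x * y) \<bullet> (x * y) = (x \<bullet> x) * (y \<bullet> y)"
    by (simp add: inner_quat_def times_quat_def algebra_simps)
  then show "norm (x * y) = norm x * norm y"
    by (simp add: norm_eq_sqrt_inner real_sqrt_mult)
qed

instantiation quat :: euclidean_space
begin

definition Basis_quat :: "quat set" where
  "Basis = {Quat 1 0 0 0, Quat 0 1 0 0, Quat 0 0 1 0, Quat 0 0 0 1}"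

instance
proof
  fix x :: quat
  show "(\<forall>u\<in>Basis. x \<bullet> u = 0) \<longleftrightarrow> x = 0"
    by (cases x) (simp add: Basis_quat_def inner_quat_def zero_quat_def)
qed (auto simp: Basis_quat_def inner_quat_def)

end

lemma DIM_quat: "DIM(quat) = 4"
  by (simp add: Basis_quat_def)

instantiation quat :: rch_algebra
begin

definition hconj_quat :: "quat \<Rightarrow> quat" where
  "hconj_quat x = Quat (qre x) (- qi x) (- qj x) (- qk x)"

instance
proof
  fix x :: quat
  have "(norm x)\<^sup>2 = x \<bullet> x"
    by (rule power2_norm_eq_inner)
  then show "hconj x * x = (norm x)\<^sup>2 *\<^sub>R 1"
    by (simp add: hconj_quat_def quat_eq_iff quat_ring_defs scaleR_quat_def
        inner_quat_def)
qed (simp_all add: hconj_quat_def quat_eq_iff quat_ring_defs scaleR_quat_def)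

end

section \<open>Hermitian matrices\<close>

definition cadj :: "'f::rch_algebra^'m^'n \<Rightarrow> 'f^'n^'m" where
  "cadj x = (\<chi> i j. hconj (x $ j $ i))"

definition herm :: "('f::rch_algebra^'q^'q) set" where
  "herm = {x. cadj x = x}"

text \<open>
  The library's inner product on \<open>'f^'q^'q\<close> is the scalar product
  \<open>Re tr (x\<^sup>* y)\<close>, where \<open>Re z = 1 \<bullet> z\<close>.
\<close>

lemma inner_scalar_eq:
  fixes x y :: "'f::rch_algebra"
  shows "x \<bullet> y = 1 \<bullet> (hconj x * y)"
proof -
  have sum: "hconj x * y + hconj y * x = of_real (2 * (x \<bullet> y))" for x y :: 'f
  proof -
    have "hconj (x + y) * (x + y) = of_real ((norm (x + y))\<^sup>2)"
      by (simp only: hconj_mult_self of_real_def)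
    moreover have "hconj (x + y) * (x + y) =
        hconj x * x + hconj y * y + (hconj x * y + hconj y * x)"
      by (simp add: hconj_add algebra_simps)
    moreover have "(norm (x + y))\<^sup>2 = (norm x)\<^sup>2 + (norm y)\<^sup>2 + 2 * (x \<bullet> y)"
      by (simp add: power2_norm_eq_inner inner_add_left inner_add_right inner_commute)
    ultimately show ?thesis
      by (simp add: hconj_mult_self of_real_def algebra_simps)
  qed
  have one: "hconj (1::'f) = 1"
    using hconj_mult_self[of "1::'f"] by simp
  have "of_real (2 * (1 \<bullet> (hconj x * y))) = hconj x * y + hconj y * x"
    using sum[of 1 "hconj x * y"] by (simp add: one hconj_mult hconj_hconj)
  also have "\<dots> = of_real (2 * (x \<bullet> y))"
    by (rule sum)
  finally have "2 * (1 \<bullet> (hconj x * y)) = 2 * (x \<bullet> y)"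
    by (simp only: of_real_eq_iff)
  then show ?thesis
    by simp
qed

lemma inner_matrix_eq:
  fixes x y :: "'f::rch_algebra^'q^'q"
  shows "x \<bullet> y = 1 \<bullet> trace (cadj x ** y)"
proof -
  have "x \<bullet> y = (\<Sum>i\<in>UNIV. \<Sum>j\<in>UNIV. 1 \<bullet> (hconj (x $ i $ j) * y $ i $ j))"
    by (simp add: inner_vec_def inner_scalar_eq[symmetric])
  also have "\<dots> = (\<Sum>j\<in>UNIV. \<Sum>i\<in>UNIV. 1 \<bullet> (hconj (x $ i $ j) * y $ i $ j))"
    by (rule sum.swap)
  finally show ?thesis
    by (simp add: trace_def cadj_def matrix_matrix_mult_def inner_sum_right)
qed

text \<open>
  In the next two definitions \<open>x \<bullet> (a *v x)\<close> is the real part of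
  \<open>x\<^sup>* a x\<close>, which is all of \<open>x\<^sup>* a x\<close> when \<open>a\<close> is Hermitian.
\<close>

definition psd :: "('f::rch_algebra^'q^'q) set" where
  "psd = {a \<in> herm. \<forall>x. 0 \<le> x \<bullet> (a *v x)}"

definition posdef :: "('f::rch_algebra^'q^'q) set" where
  "posdef = {a \<in> herm. \<forall>x. x \<noteq> 0 \<longrightarrow> 0 < x \<bullet> (a *v x)}"

definition psd_sqrt :: "'f::rch_algebra^'q^'q \<Rightarrow> 'f^'q^'q" where
  "psd_sqrt a = (THE b. b \<in> psd \<and> b ** b = a)"

text \<open>
  The product of the real eigenvalues of a Hermitian matrix, with multiplicity. The eigenspace
  is a right \<open>'f\<close>-vector space; its dimension over \<open>'f\<close> is its real dimension \<open>dim\<close>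
  divided by \<open>DIM('f)\<close>.
\<close>

definition herm_det :: "'f::rch_algebra^'q^'q \<Rightarrow> real" where
  "herm_det a =
     (\<Prod>l\<in>{l. \<exists>x. x \<noteq> 0 \<and> a *v x = l *\<^sub>R x}. l ^ (dim {x. a *v x = l *\<^sub>R x} div DIM('f)))"

section \<open>Bessel convolution\<close>

definition bessel_rho :: "'f::rch_algebra itself \<Rightarrow> 'q::finite itself \<Rightarrow> real" where
  "bessel_rho _ _ = real DIM('f) * (real CARD('q) - 1 / 2) + 1"

definition mat_disc :: "('f::rch_algebra^'q^'q) set" where
  "mat_disc = {v. mat 1 - cadj v ** v \<in> posdef}"

definition bessel_kappa :: "('f::rch_algebra^'q^'q) itself \<Rightarrow> real \<Rightarrow> real" where
  "bessel_kappa _ \<mu> =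
     (LINT v:(mat_disc :: ('f^'q^'q) set)|lborel.
        herm_det (mat 1 - cadj v ** v) powr (\<mu> - bessel_rho TYPE('f) TYPE('q)))"

definition psd_borel :: "('f::rch_algebra^'q^'q) measure" where
  "psd_borel = restrict_space borel psd"

definition bessel_conv_point ::
    "real \<Rightarrow> 'f::rch_algebra^'q^'q \<Rightarrow> 'f^'q^'q \<Rightarrow> ('f^'q^'q) measure" where
  "bessel_conv_point \<mu> r s =
     distr
       (density (restrict_space lborel mat_disc)
          (\<lambda>v. ennreal (herm_det (mat 1 - v ** cadj v) powr (\<mu> - bessel_rho TYPE('f) TYPE('q))
                 / bessel_kappa TYPE('f^'q^'q) \<mu>)))
       psd_borel
       (\<lambda>v. psd_sqrt (r ** r + s ** s + s ** v ** r + r ** cadj v ** s))"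

definition bessel_conv ::
    "real \<Rightarrow> ('f::rch_algebra^'q^'q) measure \<Rightarrow> ('f^'q^'q) measure \<Rightarrow> ('f^'q^'q) measure" where
  "bessel_conv \<mu> \<nu>1 \<nu>2 = bind \<nu>1 (\<lambda>r. bind \<nu>2 (\<lambda>s. bessel_conv_point \<mu> r s))"

section \<open>Markov chains and Bessel random walks\<close>

definition natural_filtration ::
    "'w measure \<Rightarrow> 'x measure \<Rightarrow> (nat \<Rightarrow> 'w \<Rightarrow> 'x) \<Rightarrow> nat \<Rightarrow> 'w measure" where
  "natural_filtration M N X n =
     sigma (space M) (\<Union>i\<le>n. {X i -` A \<inter> space M | A. A \<in> sets N})"

definition markov_chain ::
    "'w measure \<Rightarrow> 'x measure \<Rightarrow> ('x \<Rightarrow> 'x measure) \<Rightarrow> (nat \<Rightarrow> 'w \<Rightarrow> 'x) \<Rightarrow> bool" where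
  "markov_chain M N K X \<longleftrightarrow>
     prob_space M \<and>
     (\<forall>n. X n \<in> measurable M N) \<and>
     (\<forall>n. \<forall>A\<in>sets N. AE \<omega> in M.
        real_cond_exp M (natural_filtration M N X n)
          (indicator (X (Suc n) -` A \<inter> space M)) \<omega> = measure (K (X n \<omega>)) A)"

definition bessel_random_walk ::
    "'w measure \<Rightarrow> real \<Rightarrow> ('f::rch_algebra^'q^'q) measure \<Rightarrow> (nat \<Rightarrow> 'w \<Rightarrow> 'f^'q^'q) \<Rightarrow> bool" where
  "bessel_random_walk M \<mu> \<nu> S \<longleftrightarrow>
     markov_chain M psd_borel (\<lambda>x. bessel_conv \<mu> (return psd_borel x) \<nu>) S \<and>
     (AE \<omega> in M. S 0 \<omega> = 0)"

section \<open>Covariance, normal laws and weak convergence\<close>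

definition herm_borel :: "('f::rch_algebra^'q^'q) measure" where
  "herm_borel = restrict_space borel herm"

definition square_image :: "('f::rch_algebra^'q^'q) measure \<Rightarrow> ('f^'q^'q) measure" where
  "square_image \<nu> = distr \<nu> herm_borel (\<lambda>x. x ** x)"

text \<open>The covariance matrix, in coordinate-free form as a bilinear form.\<close>

definition covariance :: "'a::euclidean_space measure \<Rightarrow> 'a \<Rightarrow> 'a \<Rightarrow> real" where
  "covariance M a b =
     (LINT y|M. (a \<bullet> (y - (LINT z|M. z))) * (b \<bullet> (y - (LINT z|M. z))))"

definition normal_real :: "real \<Rightarrow> real \<Rightarrow> real measure" where
  "normal_real m v =
     (if v = 0 then return borel m else density lborel (\<lambda>x. ennreal (normal_density m (sqrt v) x)))"

text \<open>
  \<open>N\<close> is the (possibly degenerate) normal distribution on the linear subspace \<open>V\<close> with mean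
  \<open>m\<close> and covariance form \<open>C\<close>: all its one-dimensional projections are normal. Such an \<open>N\<close> is
  unique.
\<close>

definition is_normal_law ::
    "'a::euclidean_space set \<Rightarrow> 'a \<Rightarrow> ('a \<Rightarrow> 'a \<Rightarrow> real) \<Rightarrow> 'a measure \<Rightarrow> bool" where
  "is_normal_law V m C N \<longleftrightarrow>
     prob_space N \<and> sets N = sets (restrict_space borel V) \<and>
     (\<forall>a\<in>V. distr N borel (\<lambda>x. a \<bullet> x) = normal_real (a \<bullet> m) (C a a))"

definition weak_conv_on ::
    "'a::topological_space set \<Rightarrow> (nat \<Rightarrow> 'a measure) \<Rightarrow> 'a measure \<Rightarrow> bool" where
  "weak_conv_on T P Q \<longleftrightarrow>
     (\<forall>f::'a \<Rightarrow> real. continuous_on T f \<longrightarrow> bounded (f ` T) \<longrightarrow>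
        (\<lambda>n. LINT x|P n. f x) \<longlonglongrightarrow> (LINT x|Q. f x))"

end

theory Submission
  imports Defs
begin

text \<open>
  Let \<open>S\<^sub>n\<close> be the walk and \<open>X\<^sub>n = S\<^sub>n\<^sup>2\<close>. By the definition of the Bessel convolution, one step from
  \<open>x\<close> with increment \<open>s\<close> (distributed by \<open>\<nu>\<close>) and disc variable \<open>v\<close> leads to
  \<open>x\<^sup>2 + s\<^sup>2 + s v x + x v\<^sup>* s\<close> for the square. Without the mixed term, \<open>X\<^sub>n\<close> would be a sum of \<open>n\<close>
  independent copies of \<open>s\<^sup>2\<close>, and the claim would be the classical central limit theorem in the
  Euclidean space of Hermitian matrices. So the point is that the mixed terms disappear in the
  limit when \<open>n\<^sup>2 / \<mu>\<^sub>n\<close> tends to 0.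

  This is read off from characteristic functions, so that only the laws of the \<open>S\<^sub>n\<close> enter and the
  variables \<open>s\<close> and \<open>v\<close> need not exist on the space of the walk. One step multiplies
  \<open>E exp (i a \<bullet> X\<^sub>n)\<close> by the characteristic function of \<open>s\<^sup>2\<close> up to an error
  \<open>C |a| E|S\<^sub>n| E|s| E|v|\<close> (\<open>square_char_step\<close>). Two moment bounds control it.
  The mixed term is odd in \<open>v\<close> and the law of \<open>v\<close> is symmetric, so
  \<open>E|S\<^sub>n|\<^sup>2 = n E|s|\<^sup>2\<close> (\<open>second_moment_bessel_walk\<close>). The law of \<open>v\<close> concentrates at 0, with
  \<open>E|v|\<^sup>2 = O(1 / (\<mu> - \<rho>))\<close> (\<open>disc_law_second_moment\<close>): the weight at \<open>v / 2\<close> exceeds the weight at \<open>v\<close>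
  by a factor of at least \<open>exp (3/4 (\<mu> - \<rho>) |v|\<^sup>2)\<close>, whereas the substitution of \<open>v / 2\<close> for \<open>v\<close> multiplies
  the total weight by the constant \<open>2\<^sup>m\<close>, where \<open>m\<close> is the real dimension.
  After \<open>n\<close> steps and with \<open>a / sqrt n\<close> for \<open>a\<close> the accumulated error is of order
  \<open>n / sqrt (\<mu>\<^sub>n - \<rho>)\<close>, which tends to 0.

  Two further ingredients turn this into the theorem. The definitions require some spectral theory
  over the reals, the complex numbers and the quaternions at once: a Hermitian matrix has an
  orthonormal basis of eigenvectors over the scalars (\<open>spectral_frame_exists\<close>), which yields the
  square root and its measurability, and identifies the Hermitian determinant with a
  product of eigenvalues. And pointwise convergence of characteristic functions in a Euclidean
  space implies weak convergence (\<open>bounded_continuous_converges\<close>); this is deduced from the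
  one-dimensional continuity theorem by approximation with trigonometric polynomials. The limit
  law, which may be degenerate, is constructed in \<open>gaussian_exists\<close>.
\<close>

section \<open>Conjugation, adjoints and the real trace form\<close>

lemma hconj_0 [simp]: "hconj (0::'f::rch_algebra) = 0"
  using hconj_scaleR[of 0 "0::'f"] by simp

lemma hconj_one [simp]: "hconj (1::'f::rch_algebra) = 1"
  using hconj_mult_self[of "1::'f"] by simp

lemma linear_hconj: "linear (hconj :: 'f::rch_algebra \<Rightarrow> 'f)"
  by (rule linearI) (simp_all add: hconj_add hconj_scaleR)

lemma hconj_sum: "hconj (sum f A) = (\<Sum>i\<in>A. hconj (f i :: 'f::rch_algebra))"
  by (rule linear_sum[OF linear_hconj])

lemma one_inner_one [simp]: "(1::'f::rch_algebra) \<bullet> 1 = 1"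
  by (simp add: power2_norm_eq_inner[symmetric])

lemma norm_hconj [simp]: "norm (hconj x) = norm (x :: 'f::rch_algebra)"
proof (cases "x = 0")
  case False
  have "norm (hconj x * x) = (norm x)\<^sup>2"
    by (simp add: hconj_mult_self)
  then show ?thesis
    using False by (simp add: norm_mult power2_eq_square)
qed simp

lemma inner_hconj: "hconj x \<bullet> hconj y = x \<bullet> (y :: 'f::rch_algebra)"
proof -
  have "(norm (hconj x + hconj y))\<^sup>2 = (norm (x + y))\<^sup>2"
    by (simp add: hconj_add[symmetric])
  then have "(norm x)\<^sup>2 + (norm y)\<^sup>2 + 2 * (hconj x \<bullet> hconj y) = (norm x)\<^sup>2 + (norm y)\<^sup>2 + 2 * (x \<bullet> y)"
    by (simp add: power2_norm_eq_inner[symmetric] dot_norm algebra_simps)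
  then show ?thesis by simp
qed

lemma inner_mult_left: "(c * x) \<bullet> y = x \<bullet> (hconj c * (y :: 'f::rch_algebra))"
  by (subst (1 2) inner_scalar_eq) (simp add: hconj_mult mult.assoc)

text \<open>
  Over the quaternions products do not commute, but their real parts do. Hence the real
  part of the matrix trace is still cyclic.
\<close>

lemma one_inner_mult_commute: "1 \<bullet> (x * y) = 1 \<bullet> (y * (x :: 'f::rch_algebra))"
proof -
  have "1 \<bullet> (x * y) = hconj x \<bullet> y"
    by (simp add: inner_scalar_eq[of "hconj x" y] hconj_hconj)
  also have "\<dots> = x \<bullet> hconj y"
    using inner_hconj[of "hconj x" y] by (simp add: hconj_hconj)
  also have "\<dots> = 1 \<bullet> (y * x)"
    by (subst inner_commute) (simp add: inner_scalar_eq[of "hconj y" x] hconj_hconj)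
  finally show ?thesis .
qed

lemma cadj_add: "cadj (a + b) = cadj a + cadj b"
  by (simp add: cadj_def vec_eq_iff hconj_add)

lemma cadj_scaleR: "cadj (r *\<^sub>R a) = r *\<^sub>R cadj a"
  by (simp add: cadj_def vec_eq_iff hconj_scaleR)

lemma linear_cadj: "linear cadj"
  by (rule linearI) (simp_all add: cadj_add cadj_scaleR)

lemma cadj_diff: "cadj (a - b) = cadj a - cadj b"
  by (rule linear_diff[OF linear_cadj])

lemma cadj_uminus: "cadj (- b) = - cadj b"
  by (rule linear_neg[OF linear_cadj])

lemma cadj_zero [simp]: "cadj 0 = 0"
  by (rule linear_0[OF linear_cadj])

lemma cadj_cadj [simp]: "cadj (cadj a) = a"
  by (simp add: cadj_def vec_eq_iff hconj_hconj)

lemma cadj_mult: "cadj (a ** b) = cadj b ** cadj a"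
  by (simp add: cadj_def vec_eq_iff matrix_matrix_mult_def hconj_sum hconj_mult)

lemma cadj_mat_one [simp]: "cadj (mat 1) = (mat 1 :: 'f::rch_algebra^'n^'n)"
  by (auto simp add: cadj_def mat_def vec_eq_iff)

lemma inner_cadj: "cadj a \<bullet> cadj b = a \<bullet> b"
  unfolding inner_vec_def cadj_def
  by (simp add: inner_hconj) (rule sum.swap)

lemma norm_cadj [simp]: "norm (cadj a) = norm a"
  by (simp add: norm_eq_sqrt_inner inner_cadj)

lemma inner_mat_vec: 
  fixes a :: "'f::rch_algebra^'m^'n"
  shows "(a *v x) \<bullet> y = x \<bullet> (cadj a *v y)"
proof -
  have "(a *v x) \<bullet> y = (\<Sum>i\<in>UNIV. \<Sum>j\<in>UNIV. (a$i$j * x$j) \<bullet> (y$i))"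
    by (simp add: inner_vec_def matrix_vector_mult_def inner_sum_left)
  also have "\<dots> = (\<Sum>j\<in>UNIV. \<Sum>i\<in>UNIV. (a$i$j * x$j) \<bullet> (y$i))"
    by (rule sum.swap)
  also have "\<dots> = x \<bullet> (cadj a *v y)"
    by (simp add: inner_vec_def matrix_vector_mult_def inner_sum_right cadj_def inner_mult_left)
  finally show ?thesis .
qed

lemma inner_mat_mult_left:
  fixes a b c :: "'f::rch_algebra^'q^'q"
  shows "(a ** b) \<bullet> c = b \<bullet> (cadj a ** c)"
  by (simp add: inner_matrix_eq cadj_mult matrix_mul_assoc)

lemma inner_mat_mult_right:
  fixes a b c :: "'f::rch_algebra^'q^'q"
  shows "(a ** b) \<bullet> c = a \<bullet> (c ** cadj b)"
proof -
  have "(a ** b) \<bullet> c = cadj (a ** b) \<bullet> cadj c" by (simp only: inner_cadj)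
  also have "\<dots> = cadj a \<bullet> (b ** cadj c)"
    by (simp add: cadj_mult inner_mat_mult_left)
  also have "\<dots> = a \<bullet> cadj (b ** cadj c)"
    using inner_cadj[of a "cadj (b ** cadj c)"] by simp
  finally show ?thesis by (simp add: cadj_mult)
qed

text \<open>
  The inner product with the identity matrix is the real part of the trace, so this is the
  cyclicity of the trace.
\<close>

lemma mat_one_inner_commute:
  fixes a b :: "'f::rch_algebra^'q^'q"
  shows "mat 1 \<bullet> (a ** b) = mat 1 \<bullet> (b ** a)"
proof -
  have "mat 1 \<bullet> (a ** b) = (a ** b) \<bullet> mat 1"
    by (rule inner_commute)
  also have "\<dots> = b \<bullet> cadj a"
    by (simp add: inner_mat_mult_left)
  also have "\<dots> = (b ** a) \<bullet> mat 1"
    by (simp add: inner_mat_mult_right)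
  finally show ?thesis by (simp add: inner_commute)
qed

lemma mat_one_inner_cadj_mult:
  fixes a :: "'f::rch_algebra^'q^'q"
  shows "mat 1 \<bullet> (cadj a ** a) = (norm a)\<^sup>2"
  using inner_mat_mult_left[of "cadj a" a "mat 1"]
  by (simp add: power2_norm_eq_inner inner_commute)

lemma bilinear_mat_mult: "bilinear ((**) :: 'f::real_algebra_1^'m^'n \<Rightarrow> 'f^'p^'m \<Rightarrow> 'f^'p^'n)"
  unfolding bilinear_def
  by (auto intro!: linearI simp: matrix_matrix_mult_def vec_eq_iff algebra_simps sum.distrib scaleR_sum_right)

lemma bilinear_mat_vec: "bilinear ((*v) :: 'f::real_algebra_1^'m^'n \<Rightarrow> 'f^'m \<Rightarrow> 'f^'n)"
  unfolding bilinear_def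
  by (auto intro!: linearI simp: matrix_vector_mult_def vec_eq_iff algebra_simps sum.distrib scaleR_sum_right)

lemmas bounded_bilinear_mat_mult = bilinear_conv_bounded_bilinear[THEN iffD1, OF bilinear_mat_mult]
lemmas bounded_bilinear_mat_vec = bilinear_conv_bounded_bilinear[THEN iffD1, OF bilinear_mat_vec]

lemma continuous_on_mat_mult [continuous_intros]:
  fixes f :: "'a::topological_space \<Rightarrow> 'f::rch_algebra^'m^'n"
  shows "continuous_on S f \<Longrightarrow> continuous_on S g \<Longrightarrow> continuous_on S (\<lambda>x. f x ** (g x :: 'f^'p^'m))"
  by (rule bounded_bilinear.continuous_on[OF bounded_bilinear_mat_mult])

lemma continuous_on_mat_vec [continuous_intros]:
  fixes f :: "'a::topological_space \<Rightarrow> 'f::rch_algebra^'m^'n"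
  shows "continuous_on S f \<Longrightarrow> continuous_on S g \<Longrightarrow> continuous_on S (\<lambda>x. f x *v (g x))"
  by (rule bounded_bilinear.continuous_on[OF bounded_bilinear_mat_vec])

lemma continuous_on_cadj [continuous_intros]:
  fixes f :: "'a::topological_space \<Rightarrow> 'f::rch_algebra^'m^'n"
  shows "continuous_on S f \<Longrightarrow> continuous_on S (\<lambda>x. cadj (f x))"
  by (rule bounded_linear.continuous_on[OF linear_conv_bounded_linear[THEN iffD1, OF linear_cadj]])

section \<open>Vectors over the scalars\<close>

text \<open>
  Matrices act from the left, so column vectors form a right vector space over the scalars.
  This is its scalar-valued inner product, conjugate-linear in the first argument, and \<open>rmul\<close> is its
  scalar multiplication.
\<close>

definition hip :: "'f::rch_algebra^'n \<Rightarrow> 'f^'n \<Rightarrow> 'f" where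
  "hip x y = (\<Sum>i\<in>UNIV. hconj (x$i) * y$i)"

definition rmul :: "'f::rch_algebra^'n \<Rightarrow> 'f \<Rightarrow> 'f^'n" where
  "rmul x c = (\<chi> i. x$i * c)"

text \<open>
  The rank-one matrix \<open>x y\<^sup>*\<close>.
\<close>

definition outer :: "'f::rch_algebra^'n \<Rightarrow> 'f^'m \<Rightarrow> 'f^'m^'n" where
  "outer x y = (\<chi> i j. x$i * hconj (y$j))"

lemma inner_hip: "x \<bullet> y = 1 \<bullet> hip x y"
  by (simp add: inner_vec_def hip_def inner_sum_right inner_scalar_eq[symmetric])

lemma hip_add_right: "hip x (y + z) = hip x y + hip x z"
  by (simp add: hip_def sum.distrib algebra_simps)

lemma hip_scaleR_right: "hip x (r *\<^sub>R y) = r *\<^sub>R hip x y"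
  by (simp add: hip_def scaleR_sum_right)

lemma linear_hip: "linear (hip x)"
  by (rule linearI) (simp_all add: hip_add_right hip_scaleR_right)

lemma hip_rmul_right: "hip x (rmul y c) = hip x y * c"
  by (simp add: hip_def rmul_def sum_distrib_right mult.assoc)

lemma hconj_hip: "hconj (hip x y) = hip y x"
  by (simp add: hip_def hconj_sum hconj_mult hconj_hconj)

lemma hip_rmul_left: "hip (rmul x c) y = hconj c * hip x y"
  using arg_cong[OF hip_rmul_right[of y x c], of hconj] by (simp add: hconj_mult hconj_hip)

lemma hip_self: "hip x x = (norm x)\<^sup>2 *\<^sub>R 1"
  by (simp add: hip_def hconj_mult_self scaleR_sum_left[symmetric] norm_vec_def L2_set_def sum_nonneg)

lemma hip_mat_vec: "hip x (a *v y) = hip (cadj a *v x) y"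
proof -
  have "hip x (a *v y) = (\<Sum>i\<in>UNIV. \<Sum>j\<in>UNIV. hconj (x$i) * a$i$j * y$j)"
    by (simp add: hip_def matrix_vector_mult_def sum_distrib_left mult.assoc)
  also have "\<dots> = (\<Sum>j\<in>UNIV. \<Sum>i\<in>UNIV. hconj (x$i) * a$i$j * y$j)"
    by (rule sum.swap)
  also have "\<dots> = hip (cadj a *v x) y"
    by (simp add: hip_def matrix_vector_mult_def hconj_sum cadj_def hconj_mult hconj_hconj sum_distrib_right)
  finally show ?thesis .
qed

lemma rmul_add_right: "rmul x (c + d) = rmul x c + rmul x d"
  by (simp add: rmul_def vec_eq_iff algebra_simps)

lemma rmul_scaleR_right: "rmul x (r *\<^sub>R c) = r *\<^sub>R rmul x c"
  by (simp add: rmul_def vec_eq_iff)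

lemma rmul_scaleR_left: "rmul (r *\<^sub>R x) c = r *\<^sub>R rmul x c"
  by (simp add: rmul_def vec_eq_iff)

lemma linear_rmul: "linear (rmul x)"
  by (rule linearI) (simp_all add: rmul_add_right rmul_scaleR_right)

lemma mat_vec_rmul: "a *v rmul x c = rmul (a *v x) c"
  by (simp add: rmul_def vec_eq_iff matrix_vector_mult_def sum_distrib_right mult.assoc)

lemma rmul_one [simp]: "rmul x 1 = x"
  by (simp add: rmul_def vec_eq_iff)

lemma rmul_0 [simp]: "rmul x 0 = 0"
  by (simp add: rmul_def vec_eq_iff)

lemma outer_mat_vec: "outer u w *v x = rmul u (hip w x)"
  by (simp add: outer_def rmul_def hip_def matrix_vector_mult_def vec_eq_iff sum_distrib_left mult.assoc)

lemma cadj_outer: "cadj (outer u w) = outer w u"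
  by (simp add: cadj_def outer_def hconj_mult hconj_hconj vec_eq_iff)

lemma mat_one_inner_outer:
  fixes u :: "'f::rch_algebra^'n"
  shows "mat 1 \<bullet> outer u w = u \<bullet> w"
proof -
  have "1 \<bullet> (x * hconj y) = x \<bullet> y" for x y :: 'f
    using inner_scalar_eq[of y x] by (simp add: one_inner_mult_commute[of x] inner_commute)
  then show ?thesis
    by (simp add: inner_matrix_eq trace_def outer_def inner_vec_def inner_sum_right)
qed

lemma sum_mat_vec:
  fixes f :: "'i \<Rightarrow> 'f::rch_algebra^'m^'n"
  shows "sum f A *v x = (\<Sum>i\<in>A. f i *v x)"
  using bilinear_mat_vec unfolding bilinear_def by (intro linear_sum[of "\<lambda>a. a *v x"]) blast

lemma scaleR_mat_vec:
  fixes a :: "'f::rch_algebra^'m^'n"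
  shows "(r *\<^sub>R a) *v x = r *\<^sub>R (a *v x)"
  by (rule bilinear_lmul[OF bilinear_mat_vec])

lemma hermD: "a \<in> herm \<Longrightarrow> cadj a = a"
  by (simp add: herm_def)

lemma psd_herm: "a \<in> psd \<Longrightarrow> a \<in> herm"
  by (simp add: psd_def)

section \<open>Spectral decomposition of Hermitian matrices\<close>

text \<open>
  Let \<open>x\<close> maximise \<open>x \<bullet> T x\<close> on the unit sphere of \<open>W\<close>, with maximum \<open>l\<close>. Moving from \<open>x\<close> by \<open>t\<close> in the
  direction \<open>y = T x - l x\<close> changes \<open>x \<bullet> T x - l |x|\<^sup>2\<close> by \<open>2 t |y|\<^sup>2\<close> to first order, which would
  contradict maximality unless \<open>y = 0\<close>.
\<close>

lemma self_adjoint_eigenvector: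
  fixes T :: "'a::euclidean_space \<Rightarrow> 'a"
  assumes T: "linear T" and sa: "\<And>x y. T x \<bullet> y = x \<bullet> T y"
    and W: "subspace W" "T ` W \<subseteq> W" "W \<noteq> {0}"
  shows "\<exists>x\<in>W. \<exists>l. norm x = 1 \<and> T x = l *\<^sub>R x"
proof -
  have "closed W" using W(1) by (rule closed_subspace)
  define K where "K = W \<inter> sphere 0 1"
  have "compact K" unfolding K_def by (intro closed_Int_compact \<open>closed W\<close>) simp
  obtain y where y: "y \<in> W" "y \<noteq> 0" using W(3) subspace_0[OF W(1)] by blast
  then have "(1 / norm y) *\<^sub>R y \<in> K"
    using subspace_scale[OF W(1)] by (auto simp: K_def)
  then have "K \<noteq> {}" by auto
  have "continuous_on K (\<lambda>x. x \<bullet> T x)"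
    by (intro continuous_intros linear_continuous_on_compose[OF _ T])
  with \<open>compact K\<close> \<open>K \<noteq> {}\<close> obtain x where x: "x \<in> K" "\<And>z. z \<in> K \<Longrightarrow> z \<bullet> T z \<le> x \<bullet> T x"
    using continuous_attains_sup by metis
  define l where "l = x \<bullet> T x"
  have xW: "x \<in> W" and nx: "norm x = 1" using x(1) by (auto simp: K_def)
  have q: "z \<bullet> T z \<le> l * (norm z)\<^sup>2" if "z \<in> W" for z
  proof (cases "z = 0")
    case False
    have "(1 / norm z) *\<^sub>R z \<in> K"
      using subspace_scale[OF W(1)] that False by (auto simp: K_def)
    from x(2)[OF this] have "(z \<bullet> T z) / (norm z)\<^sup>2 \<le> l"
      by (simp add: l_def linear_cmul[OF T] power2_eq_square)
    then show ?thesis using False by (simp add: divide_le_eq)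
  qed (simp add: linear_0[OF T])
  define y where "y = T x - l *\<^sub>R x"
  have yW: "y \<in> W" unfolding y_def
    using W xW by (intro subspace_diff subspace_scale) auto
  have xy: "x \<bullet> y = 0" using nx
    by (simp add: y_def inner_diff_right l_def norm_eq_1)
  have Txy: "T x \<bullet> y = y \<bullet> y"
    using xy by (simp add: y_def inner_diff_left algebra_simps)
  have key: "2 * t * (y \<bullet> y) \<le> t\<^sup>2 * (l * (y \<bullet> y) - y \<bullet> T y)" for t
  proof -
    have "(x + t *\<^sub>R y) \<bullet> T (x + t *\<^sub>R y) \<le> l * (norm (x + t *\<^sub>R y))\<^sup>2"
      by (rule q) (intro subspace_add subspace_scale W xW yW)
    moreover have "(x + t *\<^sub>R y) \<bullet> T (x + t *\<^sub>R y) = l + 2 * t * (y \<bullet> y) + t\<^sup>2 * (y \<bullet> T y)"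
      using Txy sa[of x y] sa[of y x]
      by (simp add: linear_add[OF T] linear_cmul[OF T] inner_add_left inner_add_right l_def
          power2_eq_square algebra_simps inner_commute)
    moreover have "(norm (x + t *\<^sub>R y))\<^sup>2 = 1 + t\<^sup>2 * (y \<bullet> y)"
      using xy nx unfolding power2_norm_eq_inner
      by (simp add: inner_add_left inner_add_right inner_commute norm_eq_1 power2_eq_square)
    ultimately show ?thesis by (simp add: algebra_simps)
  qed
  have "y = 0"
  proof (rule ccontr)
    assume "y \<noteq> 0"
    then have pos: "y \<bullet> y > 0" by simp
    \<comment> \<open>By \<open>key\<close> and this bound the gain \<open>2 t |y|\<^sup>2\<close> is at most \<open>t\<^sup>2 c\<close>, which fails for \<open>t = |y|\<^sup>2 / c\<close>.\<close>
    define c where "c = \<bar>l * (y \<bullet> y) - y \<bullet> T y\<bar> + 1"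
    have c: "c > 0" "l * (y \<bullet> y) - y \<bullet> T y < c" by (auto simp: c_def)
    have "2 * (y \<bullet> y / c) * (y \<bullet> y) \<le> (y \<bullet> y / c)\<^sup>2 * (l * (y \<bullet> y) - y \<bullet> T y)" by (rule key)
    also have "\<dots> \<le> (y \<bullet> y / c)\<^sup>2 * c"
      using c by (intro mult_left_mono) auto
    also have "\<dots> = (y \<bullet> y / c) * (y \<bullet> y)" using c by (simp add: power2_eq_square)
    finally have "(y \<bullet> y) * (y \<bullet> y) \<le> 0" using c by (simp add: field_simps)
    then show False using pos by (simp add: mult_le_0_iff)
  qed
  then have "T x = l *\<^sub>R x" by (simp add: y_def)
  with xW nx show ?thesis by blast
qed

text \<open>
  An orthonormal basis over the scalars, consisting of eigenvectors of \<open>a\<close> with real eigenvalues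
  \<open>lam\<close>. The expansion of every vector expresses completeness. Using a set of vectors and not a
  family indexed by \<open>'n\<close> spares the choice of an enumeration.
\<close>

definition spectral_frame :: "'f::rch_algebra^'n^'n \<Rightarrow> ('f^'n) set \<Rightarrow> ('f^'n \<Rightarrow> real) \<Rightarrow> bool" where
  "spectral_frame a B lam \<longleftrightarrow> finite B \<and> (\<forall>u\<in>B. \<forall>w\<in>B. hip u w = (if u = w then 1 else 0)) \<and>
     (\<forall>x. x = (\<Sum>u\<in>B. rmul u (hip u x))) \<and> (\<forall>u\<in>B. a *v u = lam u *\<^sub>R u)"

lemma hip_orthonormal_pairwise:
  assumes "\<forall>u\<in>B. \<forall>w\<in>B. hip u w = (if u = w then 1 else 0)"
  shows "pairwise orthogonal B" "\<And>u. u \<in> B \<Longrightarrow> norm u = 1"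
proof -
  show "pairwise orthogonal B"
    using assms by (auto simp: pairwise_def orthogonal_def inner_hip)
  show "norm u = 1" if "u \<in> B" for u
    using assms that by (simp add: norm_eq_sqrt_inner inner_hip)
qed

text \<open>
  Take an orthonormal set of eigenvectors of maximal cardinality. Its orthogonal complement is
  invariant under \<open>a\<close>, so it would contain another eigenvector if it were nonzero. Real linear
  independence of orthonormal sets bounds the cardinality.
\<close>

lemma spectral_frame_exists:
  fixes a :: "'f::rch_algebra^'n^'n"
  assumes a: "a \<in> herm"
  shows "\<exists>B lam. spectral_frame a B lam"
proof -
  define good where "good B \<longleftrightarrow> (\<forall>u\<in>B. \<forall>w\<in>B. hip u w = (if u = w then 1 else 0)) \<and>
    (\<forall>u\<in>B. \<exists>l. a *v u = l *\<^sub>R u)" for B :: "('f^'n) set"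
  have card: "finite B \<and> card B \<le> DIM('f^'n)" if "good B" for B
  proof -
    have o: "\<forall>u\<in>B. \<forall>w\<in>B. hip u w = (if u = w then 1 else 0)" using that by (simp add: good_def)
    have "0 \<notin> B" using hip_orthonormal_pairwise(2)[OF o, of 0] by auto
    then have "independent B"
      using pairwise_orthogonal_independent[OF hip_orthonormal_pairwise(1)[OF o]] by simp
    then show ?thesis by (rule independent_bound)
  qed
  have "good {}" by (simp add: good_def)
  have "\<forall>C. good C \<longrightarrow> card C < Suc DIM('f^'n)"
    using card by (auto simp: less_Suc_eq_le)
  with \<open>good {}\<close> obtain B where B: "good B" and Bmax: "\<And>C. good C \<Longrightarrow> card C \<le> card B"
    using ex_has_greatest_nat[of good "{}" card "Suc DIM('f^'n)"] by blast
  have fB: "finite B" using card[OF B] by simp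
  have on: "\<forall>u\<in>B. \<forall>w\<in>B. hip u w = (if u = w then 1 else 0)" using B by (simp add: good_def)
  obtain lam where lam: "\<And>u. u \<in> B \<Longrightarrow> a *v u = lam u *\<^sub>R u"
    using B unfolding good_def by metis
  define W where "W = {x. \<forall>u\<in>B. hip u x = 0}"
  have W: "subspace W"
    unfolding W_def by (auto simp: subspace_def linear_0[OF linear_hip] hip_add_right hip_scaleR_right)
  have W0: "W = {0}"
  proof (rule ccontr)
    assume ne: "W \<noteq> {0}"
    have inv: "(\<lambda>x. a *v x) ` W \<subseteq> W"
    proof clarsimp
      fix x assume x: "x \<in> W"
      have "hip u (a *v x) = 0" if "u \<in> B" for u
      proof -
        have "hip u (a *v x) = hip (lam u *\<^sub>R u) x"
          using that by (simp add: hip_mat_vec hermD[OF a] lam)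
        also have "\<dots> = hconj (hip x (lam u *\<^sub>R u))" by (simp add: hconj_hip)
        also have "\<dots> = lam u *\<^sub>R hip u x" by (simp add: hip_scaleR_right hconj_scaleR hconj_hip)
        finally show ?thesis using x that by (simp add: W_def)
      qed
      then show "a *v x \<in> W" by (simp add: W_def)
    qed
    obtain x l where x: "x \<in> W" "norm x = 1" "a *v x = l *\<^sub>R x"
      using self_adjoint_eigenvector[of "\<lambda>x. a *v x" W] W inv ne inner_mat_vec[of a] hermD[OF a]
      by auto
    have "x \<notin> B"
    proof
      assume "x \<in> B"
      then have "hip x x = 0" using x(1) by (simp add: W_def)
      then show False using x(2) by (simp add: hip_self)
    qed
    have z: "hip u x = 0" "hip x u = 0" if "u \<in> B" for u
    proof -
      show "hip u x = 0" using x(1) that by (simp add: W_def)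
      then have "hconj (hip u x) = hconj 0" by simp
      then show "hip x u = 0" by (simp add: hconj_hip)
    qed
    have "good (insert x B)"
      unfolding good_def
      using on z x \<open>x \<notin> B\<close> lam by (auto simp: hip_self)
    from Bmax[OF this] show False using fB \<open>x \<notin> B\<close> by simp
  qed
  have "x = (\<Sum>u\<in>B. rmul u (hip u x))" for x
  proof -
    have "x - (\<Sum>u\<in>B. rmul u (hip u x)) \<in> W"
      unfolding W_def
    proof (clarsimp)
      fix w assume w: "w \<in> B"
      have "hip w (\<Sum>u\<in>B. rmul u (hip u x)) = (\<Sum>u\<in>B. if u = w then hip w x else 0)"
        using on w by (auto simp: linear_sum[OF linear_hip] hip_rmul_right intro!: sum.cong)
      also have "\<dots> = hip w x" using fB w by simp
      finally show "hip w (x - (\<Sum>u\<in>B. rmul u (hip u x))) = 0"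
        by (simp add: linear_diff[OF linear_hip])
    qed
    then show ?thesis using W0 by simp
  qed
  then have "spectral_frame a B lam"
    unfolding spectral_frame_def using fB on lam by simp
  then show ?thesis by blast
qed

lemma mat_vec_scaleR: "a *v (r *\<^sub>R x) = r *\<^sub>R (a *v (x :: 'f::rch_algebra^'n))"
  by (rule linear_cmul[OF matrix_vector_mul_linear])

lemma frame_finite: "spectral_frame a B lam \<Longrightarrow> finite B"
  and frame_hip: "spectral_frame a B lam \<Longrightarrow> u \<in> B \<Longrightarrow> w \<in> B \<Longrightarrow> hip u w = (if u = w then 1 else 0)"
  and frame_expand: "spectral_frame a B lam \<Longrightarrow> x = (\<Sum>u\<in>B. rmul u (hip u x))"
  and frame_eigen: "spectral_frame a B lam \<Longrightarrow> u \<in> B \<Longrightarrow> a *v u = lam u *\<^sub>R u"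
  unfolding spectral_frame_def by blast+

lemma frame_norm: "spectral_frame a B lam \<Longrightarrow> u \<in> B \<Longrightarrow> norm u = 1"
  using frame_hip[of a B lam u u] by (simp add: norm_eq_sqrt_inner inner_hip)

lemma frame_inner_self: "spectral_frame a B lam \<Longrightarrow> u \<in> B \<Longrightarrow> u \<bullet> u = 1"
  using frame_norm[of a B lam u] by (simp add: norm_eq_1)

lemma frame_matrix_eqI:
  assumes fr: "spectral_frame a B lam" and eq: "\<And>u. u \<in> B \<Longrightarrow> b *v u = c *v u"
  shows "b = c"
  unfolding matrix_eq
proof
  fix x
  have "b *v x = b *v (\<Sum>u\<in>B. rmul u (hip u x))"
    using frame_expand[OF fr, of x] by simp
  also have "\<dots> = (\<Sum>u\<in>B. rmul (b *v u) (hip u x))"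
    by (simp add: linear_sum[OF matrix_vector_mul_linear] mat_vec_rmul)
  also have "\<dots> = (\<Sum>u\<in>B. rmul (c *v u) (hip u x))"
    using eq by simp
  also have "\<dots> = c *v (\<Sum>u\<in>B. rmul u (hip u x))"
    by (simp add: linear_sum[OF matrix_vector_mul_linear] mat_vec_rmul)
  also have "\<dots> = c *v x"
    using frame_expand[OF fr, of x] by simp
  finally show "b *v x = c *v x" .
qed

text \<open>
  The functional calculus: when \<open>B\<close> is a frame of \<open>a\<close>, this is \<open>a\<close> with \<open>f\<close> in place of the eigenvalues.
\<close>

definition frame_mat :: "('f::rch_algebra^'n) set \<Rightarrow> ('f^'n \<Rightarrow> real) \<Rightarrow> 'f^'n^'n" where
  "frame_mat B f = (\<Sum>u\<in>B. f u *\<^sub>R outer u u)"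

lemma frame_mat_vec:
  assumes fr: "spectral_frame a B lam" and u: "u \<in> B"
  shows "frame_mat B f *v u = f u *\<^sub>R u"
proof -
  have "frame_mat B f *v u = (\<Sum>w\<in>B. f w *\<^sub>R rmul w (hip w u))"
    by (simp add: frame_mat_def sum_mat_vec scaleR_mat_vec outer_mat_vec)
  also have "\<dots> = (\<Sum>w\<in>B. if w = u then f u *\<^sub>R u else 0)"
    using frame_hip[OF fr _ u] by (intro sum.cong) auto
  finally show ?thesis using frame_finite[OF fr] u by simp
qed

lemma frame_mat_eq:
  assumes "spectral_frame a B lam"
  shows "a = frame_mat B lam"
  by (rule frame_matrix_eqI[OF assms]) (simp add: frame_mat_vec[OF assms] frame_eigen[OF assms])

lemma frame_mat_herm: "frame_mat B f \<in> herm"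
  by (simp add: herm_def frame_mat_def linear_sum[OF linear_cadj] cadj_scaleR cadj_outer)

lemma inner_frame_mat:
  "x \<bullet> (frame_mat B f *v x) = (\<Sum>u\<in>B. f u * (norm (hip u x))\<^sup>2)"
proof -
  have "x \<bullet> rmul u (hip u x) = (norm (hip u x))\<^sup>2" for u
    by (simp add: inner_commute[of x] inner_hip[of "rmul u (hip u x)"] hip_rmul_left hconj_mult_self)
  then show ?thesis
    by (simp add: frame_mat_def sum_mat_vec scaleR_mat_vec outer_mat_vec inner_sum_right)
qed

lemma frame_mat_psd: "(\<And>u. u \<in> B \<Longrightarrow> 0 \<le> f u) \<Longrightarrow> frame_mat B f \<in> psd"
  by (simp add: psd_def frame_mat_herm inner_frame_mat sum_nonneg)

lemma frame_inner_eigen: "spectral_frame a B lam \<Longrightarrow> u \<in> B \<Longrightarrow> u \<bullet> (a *v u) = lam u"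
  using frame_eigen[of a B lam u] frame_inner_self[of a B lam u] by simp

lemma frame_psd_nonneg: "spectral_frame a B lam \<Longrightarrow> a \<in> psd \<Longrightarrow> u \<in> B \<Longrightarrow> 0 \<le> lam u"
  using frame_inner_eigen[of a B lam u, symmetric] by (simp add: psd_def)

lemma frame_posdef_pos: "spectral_frame a B lam \<Longrightarrow> a \<in> posdef \<Longrightarrow> u \<in> B \<Longrightarrow> 0 < lam u"
  using frame_inner_eigen[of a B lam u, symmetric] frame_norm[of a B lam u]
  by (cases "u = 0") (simp_all add: posdef_def)

lemma frame_trace:
  assumes "spectral_frame a B lam"
  shows "mat 1 \<bullet> a = sum lam B"
  by (subst frame_mat_eq[OF assms])
     (simp add: frame_mat_def inner_sum_right mat_one_inner_outer frame_inner_self[OF assms])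

section \<open>The positive semidefinite square root\<close>

lemma psd_sqrt_exists:
  assumes "a \<in> psd" shows "\<exists>b\<in>psd. b ** b = a"
proof -
  obtain B lam where fr: "spectral_frame a B lam"
    using spectral_frame_exists psd_herm assms by blast
  let ?b = "frame_mat B (\<lambda>u. sqrt (lam u))"
  have nn: "\<And>u. u \<in> B \<Longrightarrow> 0 \<le> lam u" using frame_psd_nonneg[OF fr assms] .
  have "?b ** ?b = a"
    by (rule frame_matrix_eqI[OF fr])
      (simp add: matrix_vector_mul_assoc[symmetric] frame_mat_vec[OF fr] mat_vec_scaleR
        frame_eigen[OF fr] nn)
  moreover have "?b \<in> psd" by (rule frame_mat_psd) (simp add: nn)
  ultimately show ?thesis by blast
qed

lemma psd_inner_nonneg: "a \<in> psd \<Longrightarrow> 0 \<le> x \<bullet> (a *v x)"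
  by (simp add: psd_def)

text \<open>
  Uniqueness of the square root. On an eigenvector \<open>x\<close> of \<open>b\<close> with eigenvalue \<open>l > 0\<close> the hypothesis
  gives \<open>(c + l) (c - l) x = 0\<close>, and \<open>c + l\<close> is injective. If \<open>l = 0\<close>, then \<open>c (c x) = 0\<close>, whence
  \<open>|c x|\<^sup>2 = 0\<close>.
\<close>

lemma psd_square_inj:
  assumes b: "b \<in> psd" and c: "c \<in> psd" and eq: "b ** b = c ** c"
  shows "b = c"
proof -
  obtain B lam where fr: "spectral_frame b B lam"
    using spectral_frame_exists psd_herm b by blast
  show ?thesis
  proof (rule frame_matrix_eqI[OF fr])
    fix x assume x: "x \<in> B"
    let ?l = "lam x"
    have l: "0 \<le> ?l" using frame_psd_nonneg[OF fr b x] .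
    have bx: "b *v x = ?l *\<^sub>R x" using frame_eigen[OF fr x] .
    have ccx: "c *v (c *v x) = ?l\<^sup>2 *\<^sub>R x"
      using arg_cong[OF eq, of "\<lambda>m. m *v x"]
      by (simp add: bx matrix_vector_mul_assoc[symmetric] mat_vec_scaleR power2_eq_square)
    have "c *v x = ?l *\<^sub>R x"
    proof (cases "?l = 0")
      case True
      have "(c *v x) \<bullet> (c *v x) = x \<bullet> (c *v (c *v x))"
        using inner_mat_vec[of c x "c *v x"] hermD[OF psd_herm[OF c]] by simp
      also have "\<dots> = 0" using ccx True by simp
      finally show ?thesis using True by simp
    next
      case False
      \<comment> \<open>The residual would be an eigenvector of \<open>c\<close> with the negative eigenvalue \<open>- l\<close>.\<close>
      define z where "z = c *v x - ?l *\<^sub>R x"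
      have "c *v z = - (?l *\<^sub>R z)"
        by (simp add: z_def matrix_vector_mult_diff_distrib mat_vec_scaleR ccx
            power2_eq_square algebra_simps)
      then have "0 \<le> - ?l * (z \<bullet> z)"
        using psd_inner_nonneg[OF c, of z] by simp
      then have "z \<bullet> z \<le> 0" using False l by (simp add: mult_le_0_iff)
      then have "z = 0" by (metis inner_eq_zero_iff inner_ge_zero order_antisym)
      then show ?thesis by (simp add: z_def)
    qed
    then show "b *v x = c *v x" using bx by simp
  qed
qed

lemma psd_sqrt_props:
  assumes "a \<in> psd" shows "psd_sqrt a \<in> psd" "psd_sqrt a ** psd_sqrt a = a"
proof -
  have "\<exists>!b. b \<in> psd \<and> b ** b = a"
    using psd_sqrt_exists[OF assms] psd_square_inj by blast
  from theI'[OF this] show "psd_sqrt a \<in> psd" "psd_sqrt a ** psd_sqrt a = a"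
    unfolding psd_sqrt_def by auto
qed

lemma psd_sqrt_square: "b \<in> psd \<Longrightarrow> psd_sqrt (b ** b) = b"
  unfolding psd_sqrt_def by (rule the_equality) (auto intro: psd_square_inj)

lemma herm_mult_self_inner: "b \<in> herm \<Longrightarrow> mat 1 \<bullet> (b ** b) = (norm b)\<^sup>2"
  using mat_one_inner_cadj_mult[of b] by (simp add: hermD)

lemma square_in_psd:
  assumes "b \<in> herm" shows "b ** b \<in> psd"
proof -
  have "x \<bullet> ((b ** b) *v x) = (b *v x) \<bullet> (b *v x)" for x
    using inner_mat_vec[of b x "b *v x"] hermD[OF assms] by (simp add: matrix_vector_mul_assoc)
  then show ?thesis using hermD[OF assms] by (simp add: psd_def herm_def cadj_mult)
qed

lemma subspace_herm: "subspace herm"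
  by (simp add: subspace_def herm_def cadj_add cadj_scaleR)

lemma closed_herm: "closed herm"
  by (rule closed_subspace[OF subspace_herm])

lemma closed_psd: "closed (psd :: ('f::rch_algebra^'q^'q) set)"
proof -
  have "closed {a. 0 \<le> x \<bullet> (a *v x)}" for x :: "'f^'q"
    by (intro closed_Collect_le continuous_intros)
  then have "closed (herm \<inter> (\<Inter>x. {a. 0 \<le> x \<bullet> (a *v (x :: 'f^'q))}))"
    by (intro closed_Int closed_herm closed_INT) auto
  also have "herm \<inter> (\<Inter>x. {a. 0 \<le> x \<bullet> (a *v (x :: 'f^'q))}) = psd"
    by (auto simp: psd_def)
  finally show ?thesis .
qed

text \<open>
  The preimage of a closed set \<open>C\<close> is the image of \<open>C \<inter> psd\<close> under squaring, and is therefore a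
  countable union of compact sets.
\<close>

lemma measurable_psd_sqrt: "psd_sqrt \<in> measurable psd_borel psd_borel"
proof -
  have "psd_sqrt -` C \<inter> psd \<in> sets borel" if C: "closed C" for C :: "('a^'b^'b) set"
  proof -
    let ?K = "\<lambda>n::nat. (\<lambda>b. b ** b) ` (C \<inter> psd \<inter> cball 0 (real n))"
    have "compact (?K n)" for n
      by (intro compact_continuous_image closed_Int_compact closed_Int C closed_psd continuous_intros) auto
    then have "(\<Union>n. ?K n) \<in> sets borel"
      by (intro sets.countable_UN) (auto intro: borel_closed compact_imp_closed)
    also have "(\<Union>n. ?K n) = psd_sqrt -` C \<inter> psd"
    proof (intro equalityI subsetI)
      fix a assume "a \<in> (\<Union>n. ?K n)"
      then show "a \<in> psd_sqrt -` C \<inter> psd"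
        by (auto simp: psd_sqrt_square square_in_psd psd_herm)
    next
      fix a assume a: "a \<in> psd_sqrt -` C \<inter> psd"
      obtain n where "norm (psd_sqrt a) \<le> real n" using real_arch_simple by blast
      then have "a \<in> ?K n" using a psd_sqrt_props[of a] 
        by (intro image_eqI[of _ _ "psd_sqrt a"]) auto
      then show "a \<in> (\<Union>n. ?K n)" by blast
    qed
    finally show ?thesis .
  qed
  then have "psd_sqrt -` C \<inter> space psd_borel \<in> sets psd_borel" if "closed C" for C :: "('a^'b^'b) set"
    using that by (auto simp: psd_borel_def space_restrict_space sets_restrict_space)
  then have "psd_sqrt \<in> measurable psd_borel (borel :: ('a^'b^'b) measure)"
    unfolding borel_eq_closed by (intro measurable_measure_of) (auto simp: space_restrict_space)
  then show ?thesis
    unfolding psd_borel_def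
    by (intro measurable_restrict_space2) (auto simp: space_restrict_space psd_sqrt_props)
qed

section \<open>The Hermitian determinant\<close>

lemma inner_rmul_rmul: "rmul u c \<bullet> rmul w d = 1 \<bullet> (hconj c * (hip u w * d))"
  by (simp add: inner_hip hip_rmul_right hip_rmul_left mult.assoc)

text \<open>
  The vectors \<open>u e\<close>, where \<open>u\<close> ranges over the frame vectors with eigenvalue \<open>l\<close> and \<open>e\<close> over the real
  basis of the scalars, form a real orthonormal basis of the eigenspace. In particular the division
  by \<open>DIM('f)\<close> in the definition of the Hermitian determinant is exact.
\<close>

lemma frame_eigenspace_dim:
  fixes a :: "'f::rch_algebra^'n^'n"
  assumes fr: "spectral_frame a B lam"
  shows "dim {x. a *v x = l *\<^sub>R x} = card {u\<in>B. lam u = l} * DIM('f)"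
proof -
  let ?E = "{x. a *v x = l *\<^sub>R x}" and ?Bl = "{u\<in>B. lam u = l}"
  let ?f = "\<lambda>(u, e). rmul u e :: 'f^'n"
  let ?C = "?f ` (?Bl \<times> Basis)"
  have ip: "rmul u e \<bullet> rmul w e' = (if u = w \<and> e = e' then 1 else 0)"
    if "u \<in> B" "w \<in> B" "e \<in> Basis" "e' \<in> Basis" for u w e e'
    using that by (auto simp: inner_rmul_rmul frame_hip[OF fr] inner_scalar_eq[symmetric] inner_Basis)
  have inj: "inj_on ?f (?Bl \<times> Basis)"
  proof (rule inj_onI, clarify)
    fix u e w e' assume "u \<in> B" "w \<in> B" "e \<in> Basis" "e' \<in> Basis" "rmul u e = rmul w e'"
    then show "u = w \<and> e = e'"
      using ip[of u w e e'] ip[of u u e e] by (metis zero_neq_one)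
  qed
  have po: "pairwise orthogonal ?C"
    unfolding pairwise_def orthogonal_def using ip by (auto simp: split: if_splits)
  have "0 \<notin> ?C" using ip by (auto, metis inner_zero_left zero_neq_one)
  then have ind: "independent ?C" using pairwise_orthogonal_independent[OF po] by simp
  have sub: "?C \<subseteq> ?E"
    by (auto simp: mat_vec_rmul frame_eigen[OF fr] rmul_scaleR_left)
  have span: "?E \<subseteq> span ?C"
  proof
    fix x assume x: "x \<in> ?E"
    have z: "hip u x = 0" if u: "u \<in> B" "lam u \<noteq> l" for u
    proof -
      have "cadj a = a" using frame_mat_eq[OF fr] frame_mat_herm hermD by metis
      then have "hip u (a *v x) = hip (a *v u) x" by (simp add: hip_mat_vec)
      also have "\<dots> = lam u *\<^sub>R hip u x"
        using u frame_eigen[OF fr u(1)] hconj_hip[of x "a *v u"]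
        by (simp add: hip_scaleR_right hconj_scaleR hconj_hip)
      finally have "l *\<^sub>R hip u x = lam u *\<^sub>R hip u x"
        using x by (simp add: hip_scaleR_right)
      then show ?thesis using u(2) by simp
    qed
    have "x = (\<Sum>u\<in>B. rmul u (hip u x))" by (rule frame_expand[OF fr])
    also have "\<dots> = (\<Sum>u\<in>?Bl. rmul u (hip u x))"
      by (rule sum.mono_neutral_right) (auto simp: frame_finite[OF fr] z)
    also have "\<dots> \<in> span ?C"
    proof (rule span_sum)
      fix u assume u: "u \<in> ?Bl"
      have "rmul u (hip u x) = rmul u (\<Sum>e\<in>Basis. (hip u x \<bullet> e) *\<^sub>R e)"
        by (simp add: euclidean_representation)
      also have "\<dots> = (\<Sum>e\<in>Basis. (hip u x \<bullet> e) *\<^sub>R rmul u e)"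
        by (simp add: linear_sum[OF linear_rmul] rmul_scaleR_right)
      also have "\<dots> \<in> span ?C"
        using u by (intro span_sum span_scale span_base) auto
      finally show "rmul u (hip u x) \<in> span ?C" .
    qed
    finally show "x \<in> span ?C" .
  qed
  have "dim ?E = card ?C"
    using basis_card_eq_dim[OF sub span ind] by simp
  also have "\<dots> = card ?Bl * DIM('f)"
    by (simp add: card_image[OF inj] card_cartesian_product)
  finally show ?thesis .
qed

lemma frame_herm_det:
  fixes a :: "'f::rch_algebra^'n^'n"
  assumes fr: "spectral_frame a B lam"
  shows "herm_det a = prod lam B"
proof -
  have ev: "{l. \<exists>x. x \<noteq> 0 \<and> a *v x = l *\<^sub>R x} = lam ` B"
  proof (intro equalityI subsetI)
    fix l assume "l \<in> {l. \<exists>x. x \<noteq> 0 \<and> a *v x = l *\<^sub>R x}"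
    then obtain x where x: "x \<noteq> 0" "a *v x = l *\<^sub>R x" by auto
    show "l \<in> lam ` B"
    proof (rule ccontr)
      assume "l \<notin> lam ` B"
      then have "{u\<in>B. lam u = l} = {}" by auto
      then have "dim {x. a *v x = l *\<^sub>R x} = 0" by (simp only: frame_eigenspace_dim[OF fr]) simp
      then have "{x. a *v x = l *\<^sub>R x} \<subseteq> {0}" by (simp only: dim_eq_0)
      then show False using x by blast
    qed
  next
    fix l assume "l \<in> lam ` B"
    then obtain u where "u \<in> B" "l = lam u" by auto
    then show "l \<in> {l. \<exists>x. x \<noteq> 0 \<and> a *v x = l *\<^sub>R x}"
      using frame_eigen[OF fr, of u] frame_norm[OF fr, of u] by (auto intro!: exI[of _ u])
  qed
  have "herm_det a = (\<Prod>l\<in>lam ` B. l ^ card {u\<in>B. lam u = l})"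
    by (simp add: herm_det_def ev frame_eigenspace_dim[OF fr])
  also have "\<dots> = (\<Prod>l\<in>lam ` B. \<Prod>u\<in>{u\<in>B. lam u = l}. lam u)"
    by (intro prod.cong) simp_all
  also have "\<dots> = prod lam B"
    by (rule prod.image_gen[symmetric, OF frame_finite[OF fr]])
  finally show ?thesis .
qed

primrec mat_power :: "'f::rch_algebra^'n^'n \<Rightarrow> nat \<Rightarrow> 'f^'n^'n" where
  "mat_power a 0 = mat 1"
| "mat_power a (Suc k) = a ** mat_power a k"

lemma frame_mat_power:
  assumes fr: "spectral_frame a B lam"
  shows "spectral_frame (mat_power a k) B (\<lambda>u. lam u ^ k)"
proof -
  have "mat_power a k *v u = lam u ^ k *\<^sub>R u" if "u \<in> B" for u
    by (induction k)
      (simp_all add: matrix_vector_mul_assoc[symmetric] mat_vec_scaleR frame_eigen[OF fr that])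
  then show ?thesis using fr by (simp add: spectral_frame_def)
qed

lemma frame_mat_one_diff:
  assumes fr: "spectral_frame a B lam"
  shows "spectral_frame (mat 1 - a) B (\<lambda>u. 1 - lam u)"
  using fr by (simp add: spectral_frame_def matrix_vector_mult_diff_rdistrib scaleR_diff_left)

lemma mat_power_swap:
  fixes a b :: "'f::rch_algebra^'n^'n"
  shows "mat_power (a ** b) k ** a = a ** mat_power (b ** a) k"
proof (induction k)
  case (Suc k)
  have "mat_power (a ** b) (Suc k) ** a = (a ** b) ** (mat_power (a ** b) k ** a)"
    by (simp add: matrix_mul_assoc)
  also have "\<dots> = a ** mat_power (b ** a) (Suc k)"
    by (simp add: Suc.IH) (simp add: matrix_mul_assoc)
  finally show ?case .
qed simp

lemma mat_one_inner_mat_power_swap: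
  fixes a b :: "'f::rch_algebra^'n^'n"
  shows "mat 1 \<bullet> mat_power (a ** b) (Suc k) = mat 1 \<bullet> mat_power (b ** a) (Suc k)"
proof -
  have "mat 1 \<bullet> mat_power (a ** b) (Suc k) = mat 1 \<bullet> (a ** (b ** mat_power (a ** b) k))"
    by (simp add: matrix_mul_assoc)
  also have "\<dots> = mat 1 \<bullet> ((b ** mat_power (a ** b) k) ** a)" by (rule mat_one_inner_commute)
  also have "\<dots> = mat 1 \<bullet> (b ** (a ** mat_power (b ** a) k))"
    by (simp only: mat_power_swap matrix_mul_assoc[symmetric])
  finally show ?thesis by (simp add: matrix_mul_assoc)
qed

text \<open>
  The series \<open>\<Sum>\<^sub>k tr (y\<^sup>k) / k\<close> for \<open>- log det (1 - y)\<close>; the term for \<open>k = 0\<close> is a division by zero and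
  hence vanishes. It shows that the determinant is measurable, and, by the cyclicity of the trace,
  that it does not distinguish \<open>v v\<^sup>*\<close> from \<open>v\<^sup>* v\<close>.
\<close>

definition log_det_series :: "'f::rch_algebra^'n^'n \<Rightarrow> real" where
  "log_det_series y = (\<Sum>k. (mat 1 \<bullet> mat_power y k) / real k)"

text \<open>
  The eigenvalues of \<open>y\<close> lie in \<open>[0, 1)\<close>, where the logarithm series converges.
\<close>

lemma herm_det_one_minus:
  fixes y :: "'f::rch_algebra^'n^'n"
  assumes y: "y \<in> psd" and pd: "mat 1 - y \<in> posdef"
  shows "herm_det (mat 1 - y) = exp (- log_det_series y)"
proof -
  obtain B lam where fr: "spectral_frame y B lam"
    using spectral_frame_exists psd_herm y by blast
  have nn: "0 \<le> lam u" if "u \<in> B" for u using frame_psd_nonneg[OF fr y that] .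
  have lt: "lam u < 1" if "u \<in> B" for u
    using frame_posdef_pos[OF frame_mat_one_diff[OF fr] pd that] by simp
  have "(\<lambda>k. \<Sum>u\<in>B. - (lam u ^ k / real k)) sums (\<Sum>u\<in>B. ln (1 - lam u))"
  proof (rule sums_sum)
    fix u assume u: "u \<in> B"
    show "(\<lambda>k. - (lam u ^ k / real k)) sums ln (1 - lam u)"
      using ln_series'[of "- lam u"] nn[OF u] lt[OF u] by simp
  qed
  then have "(\<lambda>k. \<Sum>u\<in>B. lam u ^ k / real k) sums - (\<Sum>u\<in>B. ln (1 - lam u))"
    using sums_minus by (fastforce simp: sum_negf)
  then have "log_det_series y = - (\<Sum>u\<in>B. ln (1 - lam u))"
    unfolding log_det_series_def frame_trace[OF frame_mat_power[OF fr]]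
    by (simp add: sum_divide_distrib sums_iff)
  then have "exp (- log_det_series y) = (\<Prod>u\<in>B. exp (ln (1 - lam u)))"
    by (simp add: exp_sum frame_finite[OF fr])
  also have "\<dots> = (\<Prod>u\<in>B. 1 - lam u)"
    using lt by (intro prod.cong) auto
  also have "\<dots> = herm_det (mat 1 - y)"
    by (rule frame_herm_det[OF frame_mat_one_diff[OF fr], symmetric])
  finally show ?thesis ..
qed

lemma borel_measurable_log_det_series [measurable]:
  "log_det_series \<in> borel_measurable (borel :: ('f::rch_algebra^'n^'n) measure)"
proof -
  have "continuous_on UNIV (\<lambda>y :: 'f^'n^'n. mat_power y k)" for k
    by (induction k) (auto intro!: continuous_intros)
  then have [measurable]: "(\<lambda>y :: 'f^'n^'n. mat 1 \<bullet> mat_power y k) \<in> borel_measurable borel" for k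
    by (intro borel_measurable_continuous_onI continuous_intros)
  show ?thesis unfolding log_det_series_def by measurable
qed

text \<open>
  The estimate behind the concentration of the disc law. It holds for each eigenvalue \<open>l\<close> because
  \<open>1 - 3/4 l \<le> exp (- 3/4 l)\<close> and \<open>(1 - l/4) (1 - 3/4 l) \<ge> 1 - l\<close>.
\<close>

lemma herm_det_one_minus_quarter:
  fixes y :: "'f::rch_algebra^'n^'n"
  assumes y: "y \<in> psd" and pd: "mat 1 - y \<in> posdef"
  shows "herm_det (mat 1 - (1/4) *\<^sub>R y) \<ge> herm_det (mat 1 - y) * exp (3/4 * (mat 1 \<bullet> y))"
    "0 < herm_det (mat 1 - y)" "herm_det (mat 1 - y) \<le> 1"
proof -
  obtain B lam where fr: "spectral_frame y B lam"
    using spectral_frame_exists psd_herm y by blast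
  have nn: "0 \<le> lam u" if "u \<in> B" for u using frame_psd_nonneg[OF fr y that] .
  have lt: "lam u < 1" if "u \<in> B" for u
    using frame_posdef_pos[OF frame_mat_one_diff[OF fr] pd that] by simp
  have fr4: "spectral_frame ((1/4) *\<^sub>R y) B (\<lambda>u. lam u / 4)"
    using fr by (simp add: spectral_frame_def scaleR_mat_vec)
  note det = frame_herm_det[OF frame_mat_one_diff[OF fr]]
  show "0 < herm_det (mat 1 - y)" "herm_det (mat 1 - y) \<le> 1"
    unfolding det using nn lt by (auto intro!: prod_pos prod_le_1 simp: less_imp_le)
  have step: "(1 - l) * exp (3/4 * l) \<le> 1 - l / 4" if l: "0 \<le> l" "l < 1" for l :: real
  proof -
    have "1 - 3/4 * l \<le> exp (- (3/4 * l))"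
      using exp_ge_add_one_self[of "- (3/4 * l)"] by simp
    then have "(1 - 3/4 * l) * exp (3/4 * l) \<le> 1"
      using mult_right_mono[of "1 - 3/4 * l" "exp (- (3/4 * l))" "exp (3/4 * l)"]
      by (simp add: exp_minus)
    then have "(1 - l / 4) * ((1 - 3/4 * l) * exp (3/4 * l)) \<le> 1 - l / 4"
      using l by (intro mult_left_le) auto
    moreover have "(1 - l) * exp (3/4 * l) \<le> ((1 - l / 4) * (1 - 3/4 * l)) * exp (3/4 * l)"
      by (rule mult_right_mono) (simp_all add: algebra_simps)
    ultimately show ?thesis unfolding mult.assoc by (rule order_trans[rotated])
  qed
  have "herm_det (mat 1 - y) * exp (3/4 * (mat 1 \<bullet> y)) = (\<Prod>u\<in>B. (1 - lam u) * exp (3/4 * lam u))"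
    by (simp add: det frame_trace[OF fr] prod.distrib sum_distrib_left exp_sum frame_finite[OF fr])
  also have "\<dots> \<le> (\<Prod>u\<in>B. 1 - lam u / 4)"
    using step nn lt by (intro prod_mono) (auto simp: less_imp_le)
  also have "\<dots> = herm_det (mat 1 - (1/4) *\<^sub>R y)"
    by (rule frame_herm_det[OF frame_mat_one_diff[OF fr4], symmetric])
  finally show "herm_det (mat 1 - (1/4) *\<^sub>R y) \<ge> herm_det (mat 1 - y) * exp (3/4 * (mat 1 \<bullet> y))" .
qed

section \<open>The matrix disc and its weight\<close>

lemma inner_square_mat_vec:
  fixes v :: "'f::rch_algebra^'n^'m"
  shows "x \<bullet> ((cadj v ** v) *v x) = (norm (v *v x))\<^sup>2"
  using inner_mat_vec[of v x "v *v x"] by (simp add: matrix_vector_mul_assoc power2_norm_eq_inner)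

text \<open>
  The disc is the open unit ball of the operator norm.
\<close>

lemma mat_disc_iff: "v \<in> mat_disc \<longleftrightarrow> (\<forall>x. x \<noteq> 0 \<longrightarrow> norm (v *v x) < norm x)"
proof -
  have "x \<bullet> ((mat 1 - cadj v ** v) *v x) = (norm x)\<^sup>2 - (norm (v *v x))\<^sup>2" for x
    by (simp add: matrix_vector_mult_diff_rdistrib inner_diff_right inner_square_mat_vec power2_norm_eq_inner)
  moreover have "mat 1 - cadj v ** v \<in> herm"
    by (simp add: herm_def cadj_diff cadj_mult)
  ultimately show ?thesis
    by (simp add: mat_disc_def posdef_def) (meson norm_ge_zero power_strict_mono power2_less_imp_less zero_less_numeral)
qed

lemma mat_disc_norm_le: "v \<in> mat_disc \<Longrightarrow> norm (v *v x) \<le> norm x"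
  by (cases "x = 0") (auto simp: mat_disc_iff less_imp_le)

lemma cadj_mat_disc:
  assumes v: "v \<in> mat_disc" shows "cadj v \<in> mat_disc"
  unfolding mat_disc_iff
proof (intro allI impI)
  fix y assume y: "y \<noteq> (0 :: 'a^'b)"
  show "norm (cadj v *v y) < norm y"
  proof (cases "cadj v *v y = 0")
    case False
    let ?z = "cadj v *v y"
    have "norm ?z * norm ?z = y \<bullet> (v *v ?z)"
      using inner_mat_vec[of "cadj v" y ?z] by (simp add: power2_norm_eq_inner[symmetric] power2_eq_square)
    also have "\<dots> \<le> norm y * norm (v *v ?z)"
      by (rule norm_cauchy_schwarz)
    also have "\<dots> < norm y * norm ?z"
      using v False y by (intro mult_strict_left_mono) (auto simp: mat_disc_iff)
    finally show ?thesis using False by simp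
  qed (use y in simp)
qed

lemma mult_cadj_psd: "v ** cadj v \<in> psd"
  using inner_square_mat_vec[of _ "cadj v"] by (simp add: psd_def herm_def cadj_mult)

lemma mat_disc_posdef: "v \<in> mat_disc \<Longrightarrow> mat 1 - v ** cadj v \<in> posdef"
  using cadj_mat_disc[of v] by (simp add: mat_disc_def)

lemma mat_disc_scaleR: "v \<in> mat_disc \<Longrightarrow> \<bar>c\<bar> \<le> 1 \<Longrightarrow> c *\<^sub>R v \<in> mat_disc"
  by (auto simp: mat_disc_iff scaleR_mat_vec) (meson mult_left_le_one_le norm_ge_zero abs_ge_zero order_le_less_trans)

lemma mat_disc_uminus: "- v \<in> mat_disc \<longleftrightarrow> v \<in> mat_disc"
  using mat_disc_scaleR[of v "-1"] mat_disc_scaleR[of "- v" "-1"] by auto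

text \<open>
  By compactness of the unit sphere a matrix in the disc attains its operator norm, which is thus
  at most \<open>1 - 1 / k\<close> for some \<open>k\<close>. So the disc is a countable union of closed sets.
\<close>

lemma mat_disc_borel [measurable]: "(mat_disc :: ('f::rch_algebra^'q^'q) set) \<in> sets borel"
proof -
  let ?C = "\<lambda>k::nat. {v :: 'f^'q^'q. \<forall>x. norm (v *v x) \<le> (1 - 1 / real (Suc k)) * norm x}"
  have "closed {v :: 'f^'q^'q. norm (v *v x) \<le> (1 - 1 / real (Suc k)) * norm x}" for x k
    by (intro closed_Collect_le continuous_intros)
  then have "closed (?C k)" for k
    unfolding Collect_all_eq by (intro closed_INT) auto
  then have "(\<Union>k. ?C k) \<in> sets borel" by (intro sets.countable_UN) (auto intro: borel_closed)
  also have "(\<Union>k. ?C k) = mat_disc"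
  proof (intro equalityI subsetI)
    fix v assume "v \<in> (\<Union>k. ?C k)"
    then obtain k where k: "\<And>x. norm (v *v x) \<le> (1 - 1 / real (Suc k)) * norm x" by blast
    show "v \<in> mat_disc" unfolding mat_disc_iff
    proof (intro allI impI)
      fix x :: "'f^'q" assume "x \<noteq> 0"
      have "(1 - 1 / real (Suc k)) * norm x < 1 * norm x"
        using \<open>x \<noteq> 0\<close> by (intro mult_strict_right_mono) auto
      then show "norm (v *v x) < norm x" using k[of x] by simp
    qed
  next
    fix v :: "'f^'q^'q" assume v: "v \<in> mat_disc"
    have "continuous_on (sphere 0 1) (\<lambda>x. norm (v *v x))" by (intro continuous_intros)
    moreover have "sphere (0 :: 'f^'q) 1 \<noteq> {}" by simp
    ultimately obtain x0 where x0: "norm x0 = 1" "\<And>y. norm y = 1 \<Longrightarrow> norm (v *v y) \<le> norm (v *v x0)"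
      using continuous_attains_sup[OF compact_sphere, of "0 :: 'f^'q" 1 "\<lambda>x. norm (v *v x)"]
      by (metis dist_0_norm mem_sphere)
    define m where "m = norm (v *v x0)"
    have "x0 \<noteq> 0" using x0(1) by auto
    then have "m < 1" using v x0(1) by (auto simp: mat_disc_iff m_def)
    then obtain k where k: "1 / real (Suc k) < 1 - m"
      using reals_Archimedean[of "1 - m"] by (auto simp: inverse_eq_divide)
    have "norm (v *v x) \<le> (1 - 1 / real (Suc k)) * norm x" for x
    proof (cases "x = 0")
      case False
      have "norm (v *v ((1 / norm x) *\<^sub>R x)) \<le> m"
        unfolding m_def using False by (intro x0(2)) simp
      then have "norm (v *v x) / norm x \<le> m" by (simp add: mat_vec_scaleR)
      then have "norm (v *v x) / norm x \<le> 1 - 1 / real (Suc k)" using k by simp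
      then show ?thesis using False by (simp add: pos_divide_le_eq)
    qed simp
    then show "v \<in> (\<Union>k. ?C k)" by blast
  qed
  finally show ?thesis .
qed

lemma mat_disc_bounded: "bounded (mat_disc :: ('f::rch_algebra^'q^'q) set)"
proof (rule boundedI)
  fix v :: "'f^'q^'q" assume v: "v \<in> mat_disc"
  have "norm (v$i$j) \<le> 1" for i j
  proof -
    have "(v *v axis j 1) $ i = v$i$j"
      by (simp add: matrix_vector_mult_def axis_def if_distrib cong: if_cong)
    then have "norm (v$i$j) \<le> norm (v *v axis j 1)"
      using Finite_Cartesian_Product.norm_nth_le[of "v *v axis j 1" i] by (simp only:)
    also have "\<dots> \<le> norm (axis j (1::'f))" by (rule mat_disc_norm_le[OF v])
    finally show ?thesis by (simp add: norm_eq_sqrt_inner inner_axis_axis)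
  qed
  then have row: "norm (v$i) \<le> real CARD('q)" for i
    using order_trans[OF L2_set_le_sum sum_mono[of UNIV "\<lambda>j. norm (v$i$j)" "\<lambda>_. 1"]]
    by (simp add: norm_vec_def)
  show "norm v \<le> real CARD('q) * real CARD('q)"
    using order_trans[OF L2_set_le_sum sum_mono[of UNIV "\<lambda>i. norm (v$i)" "\<lambda>_. real CARD('q)"]] row
    by (simp add: norm_vec_def[of v])
qed

lemma ball_subset_mat_disc: "\<exists>e>0. ball 0 e \<subseteq> (mat_disc :: ('f::rch_algebra^'q^'q) set)"
proof -
  obtain K where K: "K > 0" "\<And>a x. norm ((a :: 'f^'q^'q) *v x) \<le> norm a * norm x * K"
    using bounded_bilinear.pos_bounded[OF bounded_bilinear_mat_vec] by metis
  have "v \<in> mat_disc" if v: "norm (v :: 'f^'q^'q) < 1 / K" for v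
    unfolding mat_disc_iff
  proof (intro allI impI)
    fix x :: "'f^'q" assume "x \<noteq> 0"
    have "norm (v *v x) \<le> (norm v * K) * norm x" using K(2)[of v x] by (simp add: algebra_simps)
    also have "\<dots> < 1 * norm x"
      using v K(1) \<open>x \<noteq> 0\<close> by (intro mult_strict_right_mono) (auto simp: field_simps)
    finally show "norm (v *v x) < norm x" by simp
  qed
  then show ?thesis using K(1) by (intro exI[of _ "1 / K"]) (auto simp: mem_ball_0 subset_eq)
qed

text \<open>
  The unnormalised density of the disc law with \<open>p = \<mu> - \<rho>\<close>, extended by 0 to all matrices. The
  exponential form makes its measurability evident.
\<close>

definition disc_weight :: "real \<Rightarrow> 'f::rch_algebra^'q^'q \<Rightarrow> real" where
  "disc_weight p v = indicator mat_disc v * exp (- p * log_det_series (v ** cadj v))"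

text \<open>
  Both forms of the weight, the one of the kernel and the one of the normalising constant, have the
  same series.
\<close>

lemma disc_weight_eq:
  assumes "v \<in> mat_disc"
  shows "herm_det (mat 1 - v ** cadj v) powr p = disc_weight p v"
    "herm_det (mat 1 - cadj v ** v) powr p = disc_weight p v"
proof -
  have L: "log_det_series (cadj v ** v) = log_det_series (v ** cadj v)"
    unfolding log_det_series_def
  proof (rule suminf_cong)
    fix k show "(mat 1 \<bullet> mat_power (cadj v ** v) k) / real k = (mat 1 \<bullet> mat_power (v ** cadj v) k) / real k"
      by (cases k) (simp_all only: mat_one_inner_mat_power_swap of_nat_0 div_by_0)
  qed
  show "herm_det (mat 1 - v ** cadj v) powr p = disc_weight p v"
    using herm_det_one_minus[OF mult_cadj_psd mat_disc_posdef[OF assms]] assms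
    by (simp add: disc_weight_def powr_def)
  show "herm_det (mat 1 - cadj v ** v) powr p = disc_weight p v"
    using herm_det_one_minus[of "cadj v ** v"] mult_cadj_psd[of "cadj v"] assms
    by (simp add: disc_weight_def powr_def mat_disc_def L)
qed

lemma borel_measurable_disc_weight [measurable]:
  "disc_weight p \<in> borel_measurable (borel :: ('f::rch_algebra^'q^'q) measure)"
proof -
  have [measurable]: "(\<lambda>v :: 'f^'q^'q. v ** cadj v) \<in> measurable borel borel"
    by (intro borel_measurable_continuous_onI continuous_intros)
  show ?thesis unfolding disc_weight_def by measurable
qed

lemma disc_weight_nonneg: "0 \<le> disc_weight p v"
  by (simp add: disc_weight_def)

lemma disc_weight_bounds:
  assumes "v \<in> mat_disc" "0 \<le> p"
  shows "0 < disc_weight p v" "disc_weight p v \<le> 1"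
    "disc_weight p v * (1 + 3/4 * p * (norm v)\<^sup>2) \<le> disc_weight p ((1/2) *\<^sub>R v)"
proof -
  let ?y = "v ** cadj v"
  note hd = herm_det_one_minus_quarter[OF mult_cadj_psd mat_disc_posdef[OF assms(1)]]
  show "0 < disc_weight p v" "disc_weight p v \<le> 1"
    using hd(2,3) assms by (simp_all add: disc_weight_eq[symmetric] powr_le1)
  have half: "(1/2) *\<^sub>R v \<in> mat_disc" by (rule mat_disc_scaleR[OF assms(1)]) simp
  have y4: "((1/2) *\<^sub>R v) ** cadj ((1/2) *\<^sub>R v) = (1/4) *\<^sub>R ?y"
    by (simp add: cadj_scaleR bilinear_lmul[OF bilinear_mat_mult] bilinear_rmul[OF bilinear_mat_mult])
  have tr: "mat 1 \<bullet> ?y = (norm v)\<^sup>2"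
    using mat_one_inner_cadj_mult[of "cadj v"] by simp
  have "disc_weight p v * (1 + 3/4 * p * (norm v)\<^sup>2) \<le> disc_weight p v * exp (p * (3/4 * (norm v)\<^sup>2))"
    using exp_ge_add_one_self[of "p * (3/4 * (norm v)\<^sup>2)"]
    by (intro mult_left_mono disc_weight_nonneg) (simp add: algebra_simps)
  also have "\<dots> = (herm_det (mat 1 - ?y) * exp (3/4 * (norm v)\<^sup>2)) powr p"
    using assms(1) hd(2) by (simp add: disc_weight_eq[symmetric] powr_mult) (simp add: powr_def)
  also have "\<dots> \<le> herm_det (mat 1 - (1/4) *\<^sub>R ?y) powr p"
    using hd(1,2) tr assms(2) by (intro powr_mono2) auto
  also have "\<dots> = disc_weight p ((1/2) *\<^sub>R v)"
    using disc_weight_eq(1)[OF half, of p] by (simp add: y4)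
  finally show "disc_weight p v * (1 + 3/4 * p * (norm v)\<^sup>2) \<le> disc_weight p ((1/2) *\<^sub>R v)" .
qed

lemma integrable_disc_weight:
  assumes "0 \<le> p" shows "integrable lborel (disc_weight p :: 'f::rch_algebra^'q^'q \<Rightarrow> real)"
proof (rule Bochner_Integration.integrable_bound)
  show "integrable lborel (indicator (mat_disc :: ('f^'q^'q) set) :: _ \<Rightarrow> real)"
    using emeasure_bounded_finite[OF mat_disc_bounded] by (simp add: integrable_indicator_iff)
  show "AE v in lborel. norm (disc_weight p v) \<le> norm (indicator (mat_disc :: ('f^'q^'q) set) v :: real)"
  proof (rule AE_I2)
    fix v :: "'f^'q^'q"
    show "norm (disc_weight p v) \<le> norm (indicator (mat_disc :: ('f^'q^'q) set) v :: real)"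
      using disc_weight_bounds[of v p] assms by (cases "v \<in> mat_disc") (auto simp: disc_weight_def)
  qed
qed simp

lemma bessel_kappa_eq:
  "bessel_kappa TYPE('f::rch_algebra^'q^'q) \<mu> =
    (LINT v|lborel. disc_weight (\<mu> - bessel_rho TYPE('f) TYPE('q)) (v :: 'f^'q^'q))"
  unfolding bessel_kappa_def set_lebesgue_integral_def
proof (rule Bochner_Integration.integral_cong[OF refl])
  fix v :: "'f^'q^'q"
  show "indicat_real mat_disc v *\<^sub>R herm_det (mat 1 - cadj v ** v) powr (\<mu> - bessel_rho TYPE('f) TYPE('q))
    = disc_weight (\<mu> - bessel_rho TYPE('f) TYPE('q)) v"
    by (cases "v \<in> mat_disc") (simp_all add: disc_weight_eq, simp add: disc_weight_def)
qed

lemma integral_disc_weight_pos: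
  assumes "0 \<le> p" shows "0 < (LINT v|lborel. disc_weight p (v :: 'f::rch_algebra^'q^'q))"
proof -
  have "(LINT v|lborel. disc_weight p (v :: 'f^'q^'q)) \<noteq> 0"
  proof
    assume "(LINT v|lborel. disc_weight p (v :: 'f^'q^'q)) = 0"
    moreover have "integrable lborel (disc_weight p :: 'f^'q^'q \<Rightarrow> real)"
      by (rule integrable_disc_weight[OF assms])
    ultimately have "AE v in lborel. disc_weight p (v :: 'f^'q^'q) = 0"
      using integral_nonneg_eq_0_iff_AE[of lborel "disc_weight p :: 'f^'q^'q \<Rightarrow> real"]
      by (simp add: disc_weight_nonneg)
    then have ae: "AE v in lborel. v \<notin> (mat_disc :: ('f^'q^'q) set)"
      by (rule AE_mp) (use disc_weight_bounds(1) assms in force)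
    obtain e where e: "e > 0" "ball 0 e \<subseteq> (mat_disc :: ('f^'q^'q) set)"
      using ball_subset_mat_disc by blast
    from ae have "AE v in lborel. v \<notin> ball (0 :: 'f^'q^'q) e"
      by (rule AE_mp) (use e(2) in \<open>intro AE_I2, blast\<close>)
    then have "emeasure lborel (ball (0 :: 'f^'q^'q) e) = 0"
      by (subst (asm) AE_iff_measurable[of "ball 0 e"]) auto
    then show False using e(1) content_ball_pos[of e "0 :: 'f^'q^'q"] by (simp add: measure_def)
  qed
  moreover have "0 \<le> (LINT v|lborel. disc_weight p (v :: 'f^'q^'q))"
    by (simp add: disc_weight_nonneg)
  ultimately show ?thesis by simp
qed

text \<open>
  The law of the disc variable in the Bessel convolution of two point measures.
\<close>

definition disc_law :: "real \<Rightarrow> ('f::rch_algebra^'q^'q) measure" where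
  "disc_law \<mu> = density (restrict_space lborel mat_disc)
          (\<lambda>v. ennreal (herm_det (mat 1 - v ** cadj v) powr (\<mu> - bessel_rho TYPE('f) TYPE('q))
                 / bessel_kappa TYPE('f^'q^'q) \<mu>))"

lemma space_disc_law [simp]: "space (disc_law \<mu>) = mat_disc"
  by (simp add: disc_law_def space_restrict_space)

lemma sets_disc_law: "sets (disc_law \<mu>) = sets (restrict_space borel mat_disc)"
  by (simp add: disc_law_def cong: sets_restrict_space_cong)

lemma disc_law_eq:
  fixes \<mu> :: real
  defines "p \<equiv> \<mu> - bessel_rho TYPE('f::rch_algebra) TYPE('q::finite)"
  shows "disc_law \<mu> = density (restrict_space lborel (mat_disc :: ('f^'q^'q) set))
    (\<lambda>v. ennreal (disc_weight p v / bessel_kappa TYPE('f^'q^'q) \<mu>))"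
proof -
  have [measurable]: "disc_weight p \<in> borel_measurable (restrict_space lborel (mat_disc :: ('f^'q^'q) set))"
    by (rule measurable_restrict_space1) measurable
  have eq: "herm_det (mat 1 - v ** cadj v) powr p = disc_weight p v"
    if "v \<in> space (restrict_space lborel (mat_disc :: ('f^'q^'q) set))" for v
    using that by (simp add: space_restrict_space disc_weight_eq)
  have [measurable]: "(\<lambda>v. herm_det (mat 1 - v ** cadj v) powr p) \<in>
      borel_measurable (restrict_space lborel (mat_disc :: ('f^'q^'q) set))"
    by (subst measurable_cong[OF eq]) measurable
  show ?thesis
    unfolding disc_law_def p_def[symmetric] by (intro density_cong AE_I2) (simp_all add: eq)
qed

lemma bessel_kappa_pos:
  "\<mu> > bessel_rho TYPE('f::rch_algebra) TYPE('q::finite) \<Longrightarrow> 0 < bessel_kappa TYPE('f^'q^'q) \<mu>"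
  by (simp add: bessel_kappa_eq integral_disc_weight_pos)

lemma nn_integral_disc_law:
  fixes g :: "'f::rch_algebra^'q^'q \<Rightarrow> ennreal"
  assumes [measurable]: "g \<in> borel_measurable borel"
    and mu: "\<mu> > bessel_rho TYPE('f) TYPE('q)"
  shows "(\<integral>\<^sup>+ v. g v \<partial>disc_law \<mu>) =
    (\<integral>\<^sup>+ v. g v * ennreal (disc_weight (\<mu> - bessel_rho TYPE('f) TYPE('q)) v) \<partial>lborel) / ennreal (bessel_kappa TYPE('f^'q^'q) \<mu>)"
proof -
  define p where "p = \<mu> - bessel_rho TYPE('f) TYPE('q)"
  define k where "k = bessel_kappa TYPE('f^'q^'q) \<mu>"
  have k: "0 < k" using bessel_kappa_pos[OF mu] by (simp add: k_def)
  have [measurable]: "disc_weight p \<in> borel_measurable (restrict_space lborel (mat_disc :: ('f^'q^'q) set))"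
    "g \<in> borel_measurable (restrict_space lborel (mat_disc :: ('f^'q^'q) set))"
    by (rule measurable_restrict_space1, measurable)+
  have "(\<integral>\<^sup>+ v. g v \<partial>disc_law \<mu>) = (\<integral>\<^sup>+ v. ennreal (disc_weight p v / k) * g v \<partial>restrict_space lborel mat_disc)"
    unfolding disc_law_eq p_def[symmetric] k_def[symmetric] by (rule nn_integral_density) measurable
  also have "\<dots> = (\<integral>\<^sup>+ v. ennreal (disc_weight p v / k) * g v * indicator mat_disc v \<partial>lborel)"
    by (rule nn_integral_restrict_space) simp
  also have "\<dots> = (\<integral>\<^sup>+ v. (g v * ennreal (disc_weight p v)) / ennreal k \<partial>lborel)"
  proof (rule nn_integral_cong)
    fix v :: "'f^'q^'q"
    show "ennreal (disc_weight p v / k) * g v * indicator mat_disc v = (g v * ennreal (disc_weight p v)) / ennreal k"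
      by (cases "v \<in> mat_disc")
        (simp_all add: divide_ennreal[OF disc_weight_nonneg k, symmetric] ennreal_times_divide mult.commute,
          simp add: disc_weight_def)
  qed
  also have "\<dots> = (\<integral>\<^sup>+ v. g v * ennreal (disc_weight p v) \<partial>lborel) / ennreal k"
    by (rule nn_integral_divide) measurable
  finally show ?thesis by (simp add: p_def k_def)
qed

lemma prob_space_disc_law:
  assumes mu: "\<mu> > bessel_rho TYPE('f::rch_algebra) TYPE('q::finite)"
  shows "prob_space (disc_law \<mu> :: ('f^'q^'q) measure)"
proof (rule prob_spaceI)
  define p where "p = \<mu> - bessel_rho TYPE('f) TYPE('q)"
  have p: "0 \<le> p" using mu by (simp add: p_def)
  have "emeasure (disc_law \<mu>) (space (disc_law \<mu> :: ('f^'q^'q) measure)) = (\<integral>\<^sup>+ v. 1 \<partial>(disc_law \<mu> :: ('f^'q^'q) measure))"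
    by simp
  also have "\<dots> = (\<integral>\<^sup>+ v. ennreal (disc_weight p (v :: 'f^'q^'q)) \<partial>lborel) / ennreal (bessel_kappa TYPE('f^'q^'q) \<mu>)"
    using nn_integral_disc_law[OF _ mu, of "\<lambda>_. 1"] by (simp add: p_def)
  also have "(\<integral>\<^sup>+ v. ennreal (disc_weight p (v :: 'f^'q^'q)) \<partial>lborel) = ennreal (bessel_kappa TYPE('f^'q^'q) \<mu>)"
    unfolding bessel_kappa_eq p_def[symmetric]
    by (intro nn_integral_eq_integral integrable_disc_weight p) (simp add: disc_weight_nonneg)
  also have "ennreal (bessel_kappa TYPE('f^'q^'q) \<mu>) / ennreal (bessel_kappa TYPE('f^'q^'q) \<mu>) = 1"
    using bessel_kappa_pos[OF mu] by (intro ennreal_divide_self) auto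
  finally show "emeasure (disc_law \<mu>) (space (disc_law \<mu> :: ('f^'q^'q) measure)) = 1" .
qed

lemma nn_integral_lborel_scaleR:
  fixes f :: "'a::euclidean_space \<Rightarrow> ennreal"
  assumes [measurable]: "f \<in> borel_measurable borel" and c: "c \<noteq> 0"
  shows "(\<integral>\<^sup>+ x. f x \<partial>lborel) = ennreal (\<bar>c\<bar> ^ DIM('a)) * (\<integral>\<^sup>+ x. f (c *\<^sub>R x) \<partial>lborel)"
  by (subst lborel_affine[OF c, of 0])
     (simp add: nn_integral_density nn_integral_distr nn_integral_cmult)

lemma disc_law_symmetric:
  fixes g :: "'f::rch_algebra^'q^'q \<Rightarrow> ennreal"
  assumes [measurable]: "g \<in> borel_measurable borel"
    and mu: "\<mu> > bessel_rho TYPE('f) TYPE('q)"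
  shows "(\<integral>\<^sup>+ v. g (- v) \<partial>disc_law \<mu>) = (\<integral>\<^sup>+ v. g v \<partial>disc_law \<mu>)"
proof -
  have even: "disc_weight p (- v) = disc_weight p v" for p and v :: "'f^'q^'q"
    using bilinear_lneg[OF bilinear_mat_mult, of v "- cadj v"] bilinear_rneg[OF bilinear_mat_mult, of v "cadj v"]
    by (simp add: disc_weight_def cadj_uminus mat_disc_uminus indicator_def)
  show ?thesis
    using nn_integral_lborel_scaleR[of "\<lambda>v. g v * ennreal (disc_weight (\<mu> - bessel_rho TYPE('f) TYPE('q)) v)" "-1"]
    by (simp add: nn_integral_disc_law mu even)
qed

text \<open>
  Let \<open>w\<close> be the weight with exponent \<open>p\<close>, and \<open>m\<close> the real dimension. Then
  \<open>w (v / 2) \<ge> (1 + 3/4 p |v|\<^sup>2) w v\<close>, while substitution shows that the integral of \<open>w (v / 2)\<close> is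
  \<open>2\<^sup>m\<close> times that of \<open>w\<close>. The comparison bounds the integral of \<open>|v|\<^sup>2 w v\<close>, relative to the
  total weight, by a constant over \<open>p\<close>.
\<close>

lemma disc_law_second_moment:
  fixes \<mu> :: real
  assumes mu: "\<mu> > bessel_rho TYPE('f::rch_algebra) TYPE('q::finite)"
  shows "(\<integral>\<^sup>+ v. ennreal ((norm v)\<^sup>2) \<partial>(disc_law \<mu> :: ('f^'q^'q) measure))
    \<le> ennreal (4/3 * 2 ^ DIM('f^'q^'q) / (\<mu> - bessel_rho TYPE('f) TYPE('q)))"
proof -
  define p where "p = \<mu> - bessel_rho TYPE('f) TYPE('q)"
  define k where "k = bessel_kappa TYPE('f^'q^'q) \<mu>"
  define J where "J = (\<integral>\<^sup>+ v. ennreal ((norm v)\<^sup>2) * ennreal (disc_weight p (v :: 'f^'q^'q)) \<partial>lborel)"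
  have p: "0 < p" using mu by (simp add: p_def)
  have k: "0 < k" using bessel_kappa_pos[OF mu] by (simp add: k_def)
  have W: "(\<integral>\<^sup>+ v. ennreal (disc_weight p (v :: 'f^'q^'q)) \<partial>lborel) = ennreal k"
    unfolding bessel_kappa_eq p_def[symmetric] k_def
    using p by (intro nn_integral_eq_integral integrable_disc_weight) (simp_all add: disc_weight_nonneg)
  have "ennreal (3/4 * p) * J = (\<integral>\<^sup>+ v. ennreal (3/4 * p) * (ennreal ((norm v)\<^sup>2) * ennreal (disc_weight p (v :: 'f^'q^'q))) \<partial>lborel)"
    unfolding J_def by (rule nn_integral_cmult[symmetric]) measurable
  also have "\<dots> \<le> (\<integral>\<^sup>+ v. ennreal (disc_weight p ((1/2) *\<^sub>R v :: 'f^'q^'q)) \<partial>lborel)"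
  proof (rule nn_integral_mono)
    fix v :: "'f^'q^'q"
    have "3/4 * p * (norm v)\<^sup>2 * disc_weight p v \<le> disc_weight p ((1/2) *\<^sub>R v)"
    proof (cases "v \<in> mat_disc")
      case True
      then show ?thesis
        using disc_weight_bounds(3)[OF True, of p] p disc_weight_nonneg[of p v] by (simp add: algebra_simps)
    next
      case False
      then show ?thesis using disc_weight_nonneg[of p "(1/2) *\<^sub>R v"] by (simp add: disc_weight_def)
    qed
    then show "ennreal (3/4 * p) * (ennreal ((norm v)\<^sup>2) * ennreal (disc_weight p v)) \<le> ennreal (disc_weight p ((1/2) *\<^sub>R v))"
      using p by (simp add: ennreal_mult'[symmetric] disc_weight_nonneg ennreal_leI mult.assoc)
  qed
  also have "\<dots> = ennreal (2 ^ DIM('f^'q^'q)) * (ennreal ((1/2) ^ DIM('f^'q^'q)) * (\<integral>\<^sup>+ v. ennreal (disc_weight p ((1/2) *\<^sub>R v :: 'f^'q^'q)) \<partial>lborel))"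
    by (simp add: mult.assoc[symmetric] ennreal_mult'[symmetric] power_mult_distrib[symmetric] del: DIM_cart)
  also have "\<dots> = ennreal (2 ^ DIM('f^'q^'q)) * ennreal k"
    using nn_integral_lborel_scaleR[of "\<lambda>v :: 'f^'q^'q. ennreal (disc_weight p v)" "1/2"] W by (simp del: DIM_cart)
  finally have "ennreal (3/4 * p) * J \<le> ennreal (2 ^ DIM('f^'q^'q) * k)"
    by (simp add: ennreal_mult'[symmetric] del: DIM_cart)
  then have "ennreal (1 / (3/4 * p)) * (ennreal (3/4 * p) * J) \<le> ennreal (1 / (3/4 * p)) * ennreal (2 ^ DIM('f^'q^'q) * k)"
    by (rule mult_left_mono) simp
  then have "J \<le> ennreal (4/3 * 2 ^ DIM('f^'q^'q) / p * k)"
    using p by (simp add: mult.assoc[symmetric] ennreal_mult'[symmetric] del: DIM_cart)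
  then have "J / ennreal k \<le> ennreal (4/3 * 2 ^ DIM('f^'q^'q) / p * k) / ennreal k"
    by (rule divide_right_mono_ennreal)
  also have "\<dots> = ennreal (4/3 * 2 ^ DIM('f^'q^'q) / p)"
    using k p by (subst divide_ennreal) (auto simp del: DIM_cart)
  also have "J / ennreal k = (\<integral>\<^sup>+ v. ennreal ((norm v)\<^sup>2) \<partial>(disc_law \<mu> :: ('f^'q^'q) measure))"
    unfolding J_def p_def k_def by (rule nn_integral_disc_law[OF _ mu, symmetric]) measurable
  finally show ?thesis by (simp add: p_def del: DIM_cart)
qed

section \<open>The transition kernel\<close>

lemma borel_measurable_mat_mult [measurable (raw)]:
  fixes f g :: "'a \<Rightarrow> 'f::rch_algebra^'q^'q"
  assumes "f \<in> borel_measurable M" "g \<in> borel_measurable M"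
  shows "(\<lambda>x. f x ** g x) \<in> borel_measurable M"
  by (rule borel_measurable_continuous_Pair[OF assms]) (intro continuous_intros)

lemma borel_measurable_cadj [measurable (raw)]:
  fixes f :: "'a \<Rightarrow> 'f::rch_algebra^'q^'q"
  assumes "f \<in> borel_measurable M"
  shows "(\<lambda>x. cadj (f x)) \<in> borel_measurable M"
  by (rule borel_measurable_continuous_on[OF _ assms]) (intro continuous_intros)

text \<open>
  The square of the new position, as it occurs under the root in the convolution.
\<close>

definition conv_square :: "'f::rch_algebra^'q^'q \<Rightarrow> 'f^'q^'q \<Rightarrow> 'f^'q^'q \<Rightarrow> 'f^'q^'q" where
  "conv_square r s v = r ** r + s ** s + s ** v ** r + r ** cadj v ** s"

text \<open>
  For \<open>v\<close> in the disc the mixed terms contribute at least \<open>- 2 |s y| |r y|\<close> to the quadratic form at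
  \<open>y\<close>, and the squares contribute \<open>|r y|\<^sup>2 + |s y|\<^sup>2\<close>.
\<close>

lemma conv_square_psd:
  assumes r: "r \<in> psd" and s: "s \<in> psd" and v: "v \<in> mat_disc"
  shows "conv_square r s v \<in> psd"
proof -
  have cr: "cadj r = r" and cs: "cadj s = s" using r s by (auto simp: psd_def herm_def)
  have "cadj (conv_square r s v) = conv_square r s v"
    by (simp add: conv_square_def cadj_add cadj_mult cr cs matrix_mul_assoc)
  moreover have "0 \<le> y \<bullet> (conv_square r s v *v y)" for y
  proof -
    let ?a = "r *v y" and ?b = "s *v y"
    have 1: "y \<bullet> ((r ** r) *v y) = (norm ?a)\<^sup>2" "y \<bullet> ((s ** s) *v y) = (norm ?b)\<^sup>2"
      using inner_square_mat_vec[of y r] inner_square_mat_vec[of y s] by (simp_all add: cr cs)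
    have 2: "y \<bullet> ((s ** v ** r) *v y) = ?b \<bullet> (v *v ?a)"
      using inner_mat_vec[of s y "v *v ?a"] by (simp add: cs matrix_vector_mul_assoc matrix_mul_assoc)
    have 3: "y \<bullet> ((r ** cadj v ** s) *v y) = ?b \<bullet> (v *v ?a)"
      using inner_mat_vec[of r y "cadj v *v ?b"] inner_mat_vec[of v ?a ?b]
      by (simp add: cr matrix_vector_mul_assoc matrix_mul_assoc inner_commute)
    have "\<bar>?b \<bullet> (v *v ?a)\<bar> \<le> norm ?b * norm (v *v ?a)" by (rule Cauchy_Schwarz_ineq2)
    also have "\<dots> \<le> norm ?b * norm ?a"
      by (intro mult_left_mono mat_disc_norm_le v) simp
    finally have "- 2 * (?b \<bullet> (v *v ?a)) \<le> 2 * (norm ?b * norm ?a)" by linarith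
    also have "\<dots> \<le> (norm ?a)\<^sup>2 + (norm ?b)\<^sup>2"
      using sum_squares_bound[of "norm ?b" "norm ?a"] by (simp add: power2_eq_square)
    finally show ?thesis
      by (simp add: conv_square_def matrix_vector_mult_add_rdistrib inner_add_right 1 2 3)
  qed
  ultimately show ?thesis by (simp add: psd_def herm_def)
qed

lemma bessel_conv_point_eq:
  "bessel_conv_point \<mu> r s = distr (disc_law \<mu>) psd_borel (\<lambda>v. psd_sqrt (conv_square r s v))"
  by (simp add: bessel_conv_point_def disc_law_def conv_square_def)

lemma space_psd_borel [simp]: "space psd_borel = psd"
  by (simp add: psd_borel_def space_restrict_space)

lemma measurable_psd_borel_borel [measurable_dest]:
  "f \<in> measurable M psd_borel \<Longrightarrow> f \<in> borel_measurable M"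
  unfolding psd_borel_def by (simp add: measurable_restrict_space2_iff)

lemma measurable_disc_law_borel [measurable]: "(\<lambda>v. v) \<in> borel_measurable (disc_law \<mu>)"
  by (subst measurable_cong_sets[OF sets_disc_law refl]) (rule measurable_restrict_space1, simp)

text \<open>
  The new position as a function of the old one, the increment and the disc variable, in this
  order. A single map on a product space turns the iterated kernels into image measures.
\<close>

definition walk_step :: "('f::rch_algebra^'q^'q) \<times> ('f^'q^'q) \<times> ('f^'q^'q) \<Rightarrow> 'f^'q^'q" where
  "walk_step z = psd_sqrt (conv_square (fst z) (fst (snd z)) (snd (snd z)))"

lemma walk_step_props:
  assumes "r \<in> psd" "s \<in> psd" "v \<in> mat_disc"
  shows "walk_step (r, s, v) \<in> psd" "walk_step (r, s, v) ** walk_step (r, s, v) = conv_square r s v"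
  using psd_sqrt_props[OF conv_square_psd[OF assms]] by (simp_all add: walk_step_def)

lemma measurable_walk_step:
  "walk_step \<in> measurable (psd_borel \<Otimes>\<^sub>M psd_borel \<Otimes>\<^sub>M disc_law \<mu>) psd_borel"
proof -
  let ?X = "psd_borel \<Otimes>\<^sub>M psd_borel \<Otimes>\<^sub>M disc_law \<mu>"
  have [measurable]: "fst \<in> measurable ?X borel"
    by (rule measurable_psd_borel_borel[OF measurable_fst])
  have [measurable]: "(\<lambda>z. fst (snd z)) \<in> measurable ?X borel"
    by (rule measurable_psd_borel_borel[OF measurable_compose[OF measurable_snd measurable_fst]])
  have [measurable]: "(\<lambda>z. snd (snd z)) \<in> measurable ?X borel"
    by (rule measurable_compose[of "\<lambda>z. snd (snd z)" ?X "disc_law \<mu>", OF _ measurable_disc_law_borel]) measurable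
  have "(\<lambda>z. conv_square (fst z) (fst (snd z)) (snd (snd z))) \<in> measurable ?X borel"
    unfolding conv_square_def by measurable
  then have "(\<lambda>z. conv_square (fst z) (fst (snd z)) (snd (snd z))) \<in> measurable ?X psd_borel"
    by (subst (3) psd_borel_def) (intro measurable_restrict_space2, auto simp: space_pair_measure conv_square_psd)
  then show ?thesis
    unfolding walk_step_def by (rule measurable_compose[OF _ measurable_psd_sqrt])
qed

lemma measurable_psd_borel_ident: "sets L = sets psd_borel \<Longrightarrow> (\<lambda>x. x) \<in> borel_measurable L"
  by (rule measurable_psd_borel_borel) (subst measurable_cong_sets[of L psd_borel psd_borel psd_borel], auto)

lemma measurable_walk_step':
  assumes "sets L = sets psd_borel" "sets \<nu> = sets psd_borel"
  shows "walk_step \<in> measurable (L \<Otimes>\<^sub>M \<nu> \<Otimes>\<^sub>M disc_law \<mu>) psd_borel"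
proof -
  have "sets (L \<Otimes>\<^sub>M \<nu> \<Otimes>\<^sub>M disc_law \<mu>) = sets (psd_borel \<Otimes>\<^sub>M psd_borel \<Otimes>\<^sub>M disc_law \<mu>)"
    by (intro sets_pair_measure_cong assms refl)
  from measurable_cong_sets[OF this refl] show ?thesis
    using measurable_walk_step by blast
qed

text \<open>
  The monadic composition has its intended meaning only for measurable kernels. So the
  measurability in the position and in the increment comes first; the rest is Fubini.
\<close>

lemma bessel_conv_return:
  fixes \<nu> :: "('f::rch_algebra^'q^'q) measure"
  assumes nu: "prob_space \<nu>" "sets \<nu> = sets psd_borel"
    and mu: "\<mu> > bessel_rho TYPE('f) TYPE('q)" and x: "x \<in> psd"
  shows "bessel_conv \<mu> (return psd_borel x) \<nu> = distr (\<nu> \<Otimes>\<^sub>M disc_law \<mu>) psd_borel (\<lambda>y. walk_step (x, y))"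
proof -
  let ?P = "disc_law \<mu> :: ('f^'q^'q) measure"
  interpret nu: prob_space \<nu> by fact
  interpret P: prob_space ?P by (rule prob_space_disc_law[OF mu])
  note [measurable_cong] = nu(2)
  note [measurable] = measurable_walk_step[of \<mu>]
  have spnu: "space \<nu> = psd" using sets_eq_imp_space_eq[OF nu(2)] by simp
  have ne: "space \<nu> \<noteq> {}" by (rule nu.not_empty)
  have Psub: "?P \<in> space (subprob_algebra ?P)"
    by (simp add: space_subprob_algebra P.subprob_space_axioms)
  have kern2: "(\<lambda>(r, s). distr ?P psd_borel (\<lambda>v. walk_step (r, s, v))) \<in> measurable (psd_borel \<Otimes>\<^sub>M \<nu>) (subprob_algebra psd_borel)"
  proof -
    have "(\<lambda>z. distr ?P psd_borel (\<lambda>v. walk_step (fst z, snd z, v))) \<in> measurable (psd_borel \<Otimes>\<^sub>M \<nu>) (subprob_algebra psd_borel)"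
      by (rule measurable_distr2[where M="?P" and g="\<lambda>_. ?P"]; (measurable; simp add: Psub))
    then show ?thesis by (simp add: case_prod_beta')
  qed
  have kern1: "(\<lambda>s. distr ?P psd_borel (\<lambda>v. walk_step (r, s, v))) \<in> measurable \<nu> (subprob_algebra psd_borel)"
    if "r \<in> psd" for r
    by (rule measurable_distr2[where M="?P" and g="\<lambda>_. ?P"]; (measurable; simp add: Psub that))
  have "(\<lambda>r. bind \<nu> (\<lambda>s. distr ?P psd_borel (\<lambda>v. walk_step (r, s, v)))) \<in> measurable psd_borel (subprob_algebra psd_borel)"
    using nu.subprob_space_axioms kern2
    by (intro measurable_bind[where N=\<nu>]) (auto simp: space_subprob_algebra case_prod_beta')
  from bind_return[OF this, of x]
  have "bessel_conv \<mu> (return psd_borel x) \<nu> = bind \<nu> (\<lambda>s. distr ?P psd_borel (\<lambda>v. walk_step (x, s, v)))"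
    using x by (simp add: bessel_conv_def bessel_conv_point_eq walk_step_def)
  also have "\<dots> = distr (\<nu> \<Otimes>\<^sub>M ?P) psd_borel (\<lambda>y. walk_step (x, y))" (is "?L = ?R")
  proof (rule measure_eqI)
    show sets: "sets ?L = sets ?R"
      using ne kern1[OF x] by (simp add: sets_bind[where N=psd_borel] sets_kernel)
    fix A assume "A \<in> sets ?L"
    then have A [measurable]: "A \<in> sets psd_borel" using sets by simp
    have m [measurable]: "(\<lambda>y. walk_step (x, y)) \<in> measurable (\<nu> \<Otimes>\<^sub>M ?P) psd_borel"
      using x by (intro measurable_compose[OF measurable_Pair1' measurable_walk_step'[OF refl nu(2)]]) simp
    have "emeasure ?L A = (\<integral>\<^sup>+ s. emeasure (distr ?P psd_borel (\<lambda>v. walk_step (x, s, v))) A \<partial>\<nu>)"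
      by (rule emeasure_bind[OF ne kern1[OF x] A])
    also have "\<dots> = (\<integral>\<^sup>+ s. emeasure ?P (Pair s -` ((\<lambda>y. walk_step (x, y)) -` A \<inter> space (\<nu> \<Otimes>\<^sub>M ?P))) \<partial>\<nu>)"
    proof (rule nn_integral_cong)
      fix s assume s: "s \<in> space \<nu>"
      have "(\<lambda>v. walk_step (x, s, v)) \<in> measurable ?P psd_borel"
        using x s by measurable
      then show "emeasure (distr ?P psd_borel (\<lambda>v. walk_step (x, s, v))) A =
          emeasure ?P (Pair s -` ((\<lambda>y. walk_step (x, y)) -` A \<inter> space (\<nu> \<Otimes>\<^sub>M ?P)))"
        using s by (subst emeasure_distr) (auto simp: space_pair_measure intro!: arg_cong2[where f=emeasure])
    qed
    also have "\<dots> = emeasure (\<nu> \<Otimes>\<^sub>M ?P) ((\<lambda>y. walk_step (x, y)) -` A \<inter> space (\<nu> \<Otimes>\<^sub>M ?P))"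
      by (rule P.emeasure_pair_measure_alt[symmetric]) measurable
    also have "\<dots> = emeasure ?R A"
      by (rule emeasure_distr[symmetric]) measurable
    finally show "emeasure ?L A = emeasure ?R A" .
  qed
  finally show ?thesis .
qed

lemma bessel_random_walkD:
  assumes "bessel_random_walk M \<mu> \<nu> S"
  shows "prob_space M" "S k \<in> measurable M psd_borel" "AE \<omega> in M. S 0 \<omega> = 0"
    "A \<in> sets psd_borel \<Longrightarrow> AE \<omega> in M. real_cond_exp M (natural_filtration M psd_borel S n)
      (indicator (S (Suc n) -` A \<inter> space M)) \<omega> = measure (bessel_conv \<mu> (return psd_borel (S n \<omega>)) \<nu>) A"
proof -
  note chain = assms[unfolded bessel_random_walk_def markov_chain_def]
  show "prob_space M" by (rule chain[THEN conjunct1, THEN conjunct1])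
  show "S k \<in> measurable M psd_borel" by (rule chain[THEN conjunct1, THEN conjunct2, THEN conjunct1, THEN spec])
  show "AE \<omega> in M. S 0 \<omega> = 0" by (rule chain[THEN conjunct2])
  show "AE \<omega> in M. real_cond_exp M (natural_filtration M psd_borel S n)
      (indicator (S (Suc n) -` A \<inter> space M)) \<omega> = measure (bessel_conv \<mu> (return psd_borel (S n \<omega>)) \<nu>) A"
    if "A \<in> sets psd_borel"
    by (rule chain[THEN conjunct1, THEN conjunct2, THEN conjunct2, THEN spec, THEN bspec, OF that])
qed

text \<open>
  The law of the walk evolves by the kernel: integrate the conditional probabilities of the next
  position.
\<close>

lemma markov_chain_law_step:
  fixes \<nu> :: "('f::rch_algebra^'q^'q) measure"
  assumes nu: "prob_space \<nu>" "sets \<nu> = sets psd_borel"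
    and mu: "\<mu> > bessel_rho TYPE('f) TYPE('q)"
    and rw: "bessel_random_walk M \<mu> \<nu> S"
  shows "distr M psd_borel (S (Suc n)) =
    distr (distr M psd_borel (S n) \<Otimes>\<^sub>M \<nu> \<Otimes>\<^sub>M disc_law \<mu>) psd_borel walk_step"
proof (rule measure_eqI)
  let ?P = "disc_law \<mu> :: ('f^'q^'q) measure"
  let ?Q = "\<nu> \<Otimes>\<^sub>M ?P" and ?L = "distr M psd_borel (S n)"
  let ?K = "\<lambda>x. bessel_conv \<mu> (return psd_borel x) \<nu>"
  interpret M: prob_space M by (rule bessel_random_walkD(1)[OF rw])
  have S [measurable]: "S k \<in> measurable M psd_borel" for k
    by (rule bessel_random_walkD(2)[OF rw])
  have sub: "subalgebra M (natural_filtration M psd_borel S n)"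
  proof -
    let ?G = "\<Union>i\<le>n. {S i -` A \<inter> space M | A. A \<in> sets psd_borel}"
    have "?G \<subseteq> sets M" using measurable_sets[OF S] by auto
    moreover have "sigma_sets (space M) ?G \<subseteq> sets M"
      using calculation by (rule sets.sigma_sets_subset)
    moreover have "?G \<subseteq> Pow (space M)" by auto
    ultimately show ?thesis
      by (simp add: subalgebra_def natural_filtration_def)
  qed
  interpret finite_measure_subalgebra M "natural_filtration M psd_borel S n"
    by unfold_locales (rule sub)
  interpret nu: prob_space \<nu> by fact
  interpret P: prob_space ?P by (rule prob_space_disc_law[OF mu])
  interpret Q: pair_prob_space \<nu> ?P ..
  fix A assume "A \<in> sets (distr M psd_borel (S (Suc n)))"
  then have A [measurable]: "A \<in> sets psd_borel" by simp
  have w [measurable]: "walk_step \<in> measurable (psd_borel \<Otimes>\<^sub>M ?Q) psd_borel"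
    by (rule measurable_walk_step'[OF refl nu(2)])
  \<comment> \<open>The section of \<open>B\<close> at \<open>x\<close> has the transition probability from \<open>x\<close> to \<open>A\<close> as its measure.\<close>
  define B where "B = walk_step -` A \<inter> space (psd_borel \<Otimes>\<^sub>M ?Q)"
  have B [measurable]: "B \<in> sets (psd_borel \<Otimes>\<^sub>M ?Q)" unfolding B_def by measurable
  define h where "h x = measure ?Q (Pair x -` B)" for x
  have h [measurable]: "h \<in> borel_measurable psd_borel"
    unfolding h_def measure_def by (intro borel_measurable_enn2real Q.P.measurable_emeasure_Pair) measurable
  have hK: "measure (?K x) A = h x" if x: "x \<in> psd" for x
  proof -
    have m: "(\<lambda>y. walk_step (x, y)) \<in> measurable ?Q psd_borel"
      using x by (intro measurable_compose[OF measurable_Pair1' w]) simp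
    show ?thesis
      unfolding bessel_conv_return[OF nu mu x] h_def
      using x by (subst measure_distr[OF m A]) (auto simp: B_def space_pair_measure intro!: arg_cong2[where f=measure])
  qed
  have h1: "h x \<le> 1" "0 \<le> h x" for x by (simp_all add: h_def)
  have inth: "integrable M (\<lambda>\<omega>. h (S n \<omega>))"
    by (rule M.integrable_const_bound[where B=1]) (auto simp: h1)
  have ae: "AE \<omega> in M. real_cond_exp M (natural_filtration M psd_borel S n)
      (indicator (S (Suc n) -` A \<inter> space M)) \<omega> = h (S n \<omega>)"
  proof -
    have "AE \<omega> in M. real_cond_exp M (natural_filtration M psd_borel S n)
      (indicator (S (Suc n) -` A \<inter> space M)) \<omega> = measure (?K (S n \<omega>)) A"
      by (rule bessel_random_walkD(4)[OF rw A])
    then show ?thesis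
      using AE_space
    proof eventually_elim
      case (elim \<omega>)
      then have "S n \<omega> \<in> psd" using measurable_space[OF S] by simp
      with elim hK show ?case by simp
    qed
  qed
  let ?E = "S (Suc n) -` A \<inter> space M"
  have E [measurable]: "?E \<in> sets M" by measurable
  have "measure M ?E = (LINT \<omega>|M. indicator ?E \<omega>)" by simp
  also have "\<dots> = (LINT \<omega>|M. real_cond_exp M (natural_filtration M psd_borel S n) (indicator ?E) \<omega>)"
    by (intro real_cond_exp_int(2)[symmetric] integrable_real_indicator E) (simp add: M.emeasure_eq_measure)
  also have "\<dots> = (LINT \<omega>|M. h (S n \<omega>))"
    using ae by (intro integral_cong_AE) auto
  finally have "emeasure M ?E = ennreal (LINT \<omega>|M. h (S n \<omega>))"
    by (simp add: M.emeasure_eq_measure)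
  also have "\<dots> = (\<integral>\<^sup>+ \<omega>. ennreal (h (S n \<omega>)) \<partial>M)"
    by (rule nn_integral_eq_integral[symmetric, OF inth]) (simp add: h1)
  also have "\<dots> = (\<integral>\<^sup>+ x. ennreal (h x) \<partial>?L)"
    by (rule nn_integral_distr[symmetric]) measurable
  also have "\<dots> = (\<integral>\<^sup>+ x. emeasure ?Q (Pair x -` B) \<partial>?L)"
    by (simp add: h_def Q.P.emeasure_eq_measure)
  also have "\<dots> = emeasure (?L \<Otimes>\<^sub>M ?Q) B"
    by (rule Q.P.emeasure_pair_measure_alt[symmetric]) measurable
  also have "\<dots> = emeasure (distr (?L \<Otimes>\<^sub>M ?Q) psd_borel walk_step) A"
    by (subst emeasure_distr) (auto simp: B_def space_pair_measure)
  finally show "emeasure (distr M psd_borel (S (Suc n))) A = emeasure (distr (?L \<Otimes>\<^sub>M ?Q) psd_borel walk_step) A"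
    by (simp add: emeasure_distr)
qed simp

lemma markov_chain_law_0:
  fixes S :: "nat \<Rightarrow> 'w \<Rightarrow> 'f::rch_algebra^'q^'q"
  assumes rw: "bessel_random_walk M \<mu> \<nu> S"
  shows "distr M psd_borel (S 0) = return psd_borel 0"
proof -
  interpret M: prob_space M by (rule bessel_random_walkD(1)[OF rw])
  have [measurable]: "S k \<in> measurable M psd_borel" for k
    by (rule bessel_random_walkD(2)[OF rw])
  have 0: "0 \<in> (psd :: ('f^'q^'q) set)" by (simp add: psd_def herm_def)
  have "distr M psd_borel (S 0) = distr M psd_borel (\<lambda>_. 0)"
    using bessel_random_walkD(3)[OF rw] 0 by (intro distr_cong_AE measurable_const) auto
  then show ?thesis using 0 by (simp add: M.distr_const)
qed

text \<open>
  The squared norm of the new position is the trace of its square. The trace of the mixed term is odd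
  in \<open>v\<close>, so it cancels when the values at \<open>v\<close> and \<open>- v\<close> are added; this argument works with
  nonnegative integrals throughout.
\<close>

lemma walk_second_moment:
  fixes x s :: "'f::rch_algebra^'q^'q"
  assumes mu: "\<mu> > bessel_rho TYPE('f) TYPE('q)" and x: "x \<in> psd" and s: "s \<in> psd"
  shows "(\<integral>\<^sup>+ v. ennreal ((norm (walk_step (x, s, v)))\<^sup>2) \<partial>disc_law \<mu>) = ennreal ((norm x)\<^sup>2 + (norm s)\<^sup>2)"
proof -
  interpret P: prob_space "disc_law \<mu> :: ('f^'q^'q) measure" by (rule prob_space_disc_law[OF mu])
  define c where "c v = mat 1 \<bullet> (s ** v ** x + x ** cadj v ** s)" for v
  define A where "A = (norm x)\<^sup>2 + (norm s)\<^sup>2"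
  have [measurable]: "c \<in> borel_measurable borel" unfolding c_def by measurable
  have cm: "c (- v) = - c v" for v
    by (simp add: c_def cadj_uminus bilinear_lneg[OF bilinear_mat_mult] bilinear_rneg[OF bilinear_mat_mult]
        inner_add_right inner_diff_right)
  have sq: "(norm (walk_step (x, s, v)))\<^sup>2 = A + c v" if "v \<in> mat_disc" for v
    using walk_step_props[OF x s that] herm_mult_self_inner[OF psd_herm[OF walk_step_props(1)[OF x s that]]]
      herm_mult_self_inner[OF psd_herm[OF x]] herm_mult_self_inner[OF psd_herm[OF s]]
    by (simp add: conv_square_def A_def c_def inner_add_right)
  have nn: "0 \<le> A + c v" "0 \<le> A - c v" if "v \<in> mat_disc" for v
    using sq[OF that] sq[of "- v"] that zero_le_power2[of "norm (walk_step (x, s, v))"]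
      zero_le_power2[of "norm (walk_step (x, s, - v))"]
    by (simp_all add: mat_disc_uminus cm del: zero_le_power2)
  let ?I = "\<integral>\<^sup>+ v. ennreal (A + c v) \<partial>disc_law \<mu>"
  have flip: "?I = (\<integral>\<^sup>+ v. ennreal (A - c v) \<partial>disc_law \<mu>)"
    using disc_law_symmetric[OF _ mu, of "\<lambda>v. ennreal (A + c v)"] by (simp add: cm)
  have "?I + ?I = (\<integral>\<^sup>+ v. ennreal (A + c v) + ennreal (A - c v) \<partial>disc_law \<mu>)"
    by (subst (2) flip) (intro nn_integral_add[symmetric]
        measurable_compose[OF measurable_disc_law_borel]; measurable)
  also have "\<dots> = (\<integral>\<^sup>+ v. ennreal (2 * A) \<partial>(disc_law \<mu> :: ('f^'q^'q) measure))"
    using nn by (intro nn_integral_cong) (simp add: ennreal_plus[symmetric] del: ennreal_plus)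
  also have "\<dots> = ennreal (2 * A)" using P.emeasure_space_1 by simp
  also have "\<dots> = ennreal A + ennreal A" by (simp add: A_def ennreal_plus[symmetric] del: ennreal_plus)
  finally have "2 * ?I = 2 * ennreal A" by (simp add: mult_2)
  then have "?I = ennreal A" by (simp add: ennreal_mult_cancel_left)
  moreover have "(\<integral>\<^sup>+ v. ennreal ((norm (walk_step (x, s, v)))\<^sup>2) \<partial>disc_law \<mu>) = ?I"
    by (rule nn_integral_cong) (simp add: sq)
  ultimately show ?thesis by (simp add: A_def)
qed

lemma second_moment_step:
  fixes L \<nu> :: "('f::rch_algebra^'q^'q) measure"
  assumes L: "prob_space L" "sets L = sets psd_borel"
    and nu: "prob_space \<nu>" "sets \<nu> = sets psd_borel"
    and mu: "\<mu> > bessel_rho TYPE('f) TYPE('q)"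
  shows "(\<integral>\<^sup>+ y. ennreal ((norm y)\<^sup>2) \<partial>distr (L \<Otimes>\<^sub>M \<nu> \<Otimes>\<^sub>M disc_law \<mu>) psd_borel walk_step)
    = (\<integral>\<^sup>+ x. ennreal ((norm x)\<^sup>2) \<partial>L) + (\<integral>\<^sup>+ s. ennreal ((norm s)\<^sup>2) \<partial>\<nu>)"
proof -
  let ?P = "disc_law \<mu> :: ('f^'q^'q) measure"
  interpret nu: prob_space \<nu> by fact
  interpret L: prob_space L by fact
  interpret P: prob_space ?P by (rule prob_space_disc_law[OF mu])
  interpret Q: pair_prob_space \<nu> ?P ..
  have spaces: "space L = psd" "space \<nu> = psd"
    using sets_eq_imp_space_eq[OF L(2)] sets_eq_imp_space_eq[OF nu(2)] by simp_all
  note w [measurable] = measurable_walk_step'[OF L(2) nu(2), of \<mu>]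
  have [measurable]: "(\<lambda>x. x) \<in> borel_measurable psd_borel" "(\<lambda>x. x) \<in> borel_measurable L" "(\<lambda>x. x) \<in> borel_measurable \<nu>"
    by (intro measurable_psd_borel_ident refl L nu)+
  have m [measurable]: "(\<lambda>z. ennreal ((norm (walk_step z))\<^sup>2)) \<in> borel_measurable (L \<Otimes>\<^sub>M \<nu> \<Otimes>\<^sub>M ?P)"
    by (rule measurable_compose[OF w]) measurable
  have "(\<integral>\<^sup>+ y. ennreal ((norm y)\<^sup>2) \<partial>distr (L \<Otimes>\<^sub>M \<nu> \<Otimes>\<^sub>M ?P) psd_borel walk_step)
      = (\<integral>\<^sup>+ z. ennreal ((norm (walk_step z))\<^sup>2) \<partial>(L \<Otimes>\<^sub>M \<nu> \<Otimes>\<^sub>M ?P))"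
    by (rule nn_integral_distr) measurable
  also have "\<dots> = (\<integral>\<^sup>+ x. \<integral>\<^sup>+ y. ennreal ((norm (walk_step (x, y)))\<^sup>2) \<partial>(\<nu> \<Otimes>\<^sub>M ?P) \<partial>L)"
    by (rule Q.P.nn_integral_fst[symmetric, OF m])
  also have "\<dots> = (\<integral>\<^sup>+ x. \<integral>\<^sup>+ s. \<integral>\<^sup>+ v. ennreal ((norm (walk_step (x, s, v)))\<^sup>2) \<partial>?P \<partial>\<nu> \<partial>L)"
  proof (rule nn_integral_cong)
    fix x assume "x \<in> space L"
    then have "(\<lambda>y. ennreal ((norm (walk_step (x, y)))\<^sup>2)) \<in> borel_measurable (\<nu> \<Otimes>\<^sub>M ?P)"
      by (rule measurable_compose[OF measurable_Pair1' m])
    from P.nn_integral_fst[OF this]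
    show "(\<integral>\<^sup>+ y. ennreal ((norm (walk_step (x, y)))\<^sup>2) \<partial>(\<nu> \<Otimes>\<^sub>M ?P)) = (\<integral>\<^sup>+ s. \<integral>\<^sup>+ v. ennreal ((norm (walk_step (x, s, v)))\<^sup>2) \<partial>?P \<partial>\<nu>)"
      by simp
  qed
  also have "\<dots> = (\<integral>\<^sup>+ x. \<integral>\<^sup>+ s. ennreal ((norm x)\<^sup>2) + ennreal ((norm s)\<^sup>2) \<partial>\<nu> \<partial>L)"
    by (intro nn_integral_cong) (simp add: spaces walk_second_moment[OF mu])
  also have "\<dots> = (\<integral>\<^sup>+ x. ennreal ((norm x)\<^sup>2) + (\<integral>\<^sup>+ s. ennreal ((norm s)\<^sup>2) \<partial>\<nu>) \<partial>L)"
    by (intro nn_integral_cong) (subst nn_integral_add; simp add: nu.emeasure_space_1)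
  also have "\<dots> = (\<integral>\<^sup>+ x. ennreal ((norm x)\<^sup>2) \<partial>L) + (\<integral>\<^sup>+ s. ennreal ((norm s)\<^sup>2) \<partial>\<nu>)"
    by (subst nn_integral_add; simp add: L.emeasure_space_1)
  finally show ?thesis .
qed

section \<open>Characteristic functions of squared walks\<close>

lemma second_moment_bessel_walk:
  fixes \<nu> :: "('f::rch_algebra^'q^'q) measure"
  assumes nu: "prob_space \<nu>" "sets \<nu> = sets psd_borel"
    and mu: "\<mu> > bessel_rho TYPE('f) TYPE('q)"
    and rw: "bessel_random_walk M \<mu> \<nu> S"
  shows "(\<integral>\<^sup>+ y. ennreal ((norm y)\<^sup>2) \<partial>distr M psd_borel (S n)) = of_nat n * (\<integral>\<^sup>+ s. ennreal ((norm s)\<^sup>2) \<partial>\<nu>)"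
proof (induction n)
  case 0
  have [measurable]: "(\<lambda>x :: 'f^'q^'q. x) \<in> borel_measurable psd_borel"
    by (rule measurable_psd_borel_ident) simp
  have "0 \<in> (psd :: ('f^'q^'q) set)" by (simp add: psd_def herm_def)
  then show ?case
    unfolding markov_chain_law_0[OF rw] by (subst nn_integral_return) auto
next
  case (Suc n)
  interpret M: prob_space M by (rule bessel_random_walkD(1)[OF rw])
  have "prob_space (distr M psd_borel (S n))"
    by (rule M.prob_space_distr[OF bessel_random_walkD(2)[OF rw]])
  from second_moment_step[OF this _ nu mu] Suc show ?case
    unfolding markov_chain_law_step[OF nu mu rw] by (simp add: algebra_simps)
qed

lemma (in prob_space) nn_integral_le_sqrt:
  assumes [measurable]: "f \<in> borel_measurable M"
    and nn: "\<And>x. 0 \<le> f x" and c: "0 \<le> c"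
    and le: "(\<integral>\<^sup>+ x. ennreal ((f x)\<^sup>2) \<partial>M) \<le> ennreal c"
  shows "(\<integral>\<^sup>+ x. ennreal (f x) \<partial>M) \<le> ennreal (sqrt c)"
proof -
  let ?I = "\<integral>\<^sup>+ x. ennreal (f x) \<partial>M"
  have "?I\<^sup>2 \<le> (\<integral>\<^sup>+ x. (ennreal (f x))\<^sup>2 \<partial>M)"
    using Cauchy_Schwarz_nn_integral[of "\<lambda>x. ennreal (f x)" M "\<lambda>_. 1"] by (simp add: emeasure_space_1)
  also have "\<dots> = (\<integral>\<^sup>+ x. ennreal ((f x)\<^sup>2) \<partial>M)" by (simp add: ennreal_power nn)
  finally have *: "?I\<^sup>2 \<le> ennreal c" using le by simp
  show ?thesis
  proof (cases ?I)
    case (real i)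
    then have "i\<^sup>2 \<le> c" using * c by (simp add: ennreal_power)
    then show ?thesis using real by (simp add: ennreal_leI real_le_rsqrt)
  qed (use * in \<open>simp add: power2_eq_square ennreal_top_mult top_unique\<close>)
qed

lemma norm_iexp_diff_le: "norm (iexp x - iexp y) \<le> \<bar>x - y\<bar>"
proof -
  have "iexp x = iexp y * iexp (x - y)"
    by (simp add: exp_add[symmetric] algebra_simps)
  then have "norm (iexp x - iexp y) = norm (iexp y * (iexp (x - y) - 1))"
    by (simp only: right_diff_distrib mult_1_right)
  also have "\<dots> = norm (iexp (x - y) - 1)" by (simp add: norm_mult)
  also have "\<dots> \<le> \<bar>x - y\<bar>" using iexp_approx1[of "x - y" 0] by simp
  finally show ?thesis .
qed

text \<open>
  The characteristic function of the image of \<open>L\<close> under the square mapping.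
\<close>

definition square_char :: "('f::rch_algebra^'q^'q) measure \<Rightarrow> 'f^'q^'q \<Rightarrow> complex" where
  "square_char L a = (CLINT x|L. iexp (a \<bullet> (x ** x)))"

lemma conv_square_deviation:
  fixes x s v :: "'f::rch_algebra^'q^'q"
  assumes K: "\<And>(a :: 'f^'q^'q) (b :: 'f^'q^'q). norm (a ** b) \<le> norm a * norm b * K" "0 < K"
  shows "\<bar>a \<bullet> conv_square x s v - (a \<bullet> (x ** x) + a \<bullet> (s ** s))\<bar> \<le> 2 * K\<^sup>2 * norm a * (norm x * (norm s * norm v))"
proof -
  have 3: "norm (b ** c ** d) \<le> K\<^sup>2 * (norm b * norm c * norm d)" for b c d :: "'f^'q^'q"
  proof -
    have "norm (b ** c ** d) \<le> norm (b ** c) * norm d * K" by (rule K)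
    also have "\<dots> \<le> (norm b * norm c * K) * norm d * K"
      using K by (intro mult_right_mono K) auto
    finally show ?thesis by (simp add: power2_eq_square algebra_simps)
  qed
  have "\<bar>a \<bullet> conv_square x s v - (a \<bullet> (x ** x) + a \<bullet> (s ** s))\<bar> = \<bar>a \<bullet> (s ** v ** x + x ** cadj v ** s)\<bar>"
    by (simp add: conv_square_def inner_add_right)
  also have "\<dots> \<le> norm a * norm (s ** v ** x + x ** cadj v ** s)" by (rule Cauchy_Schwarz_ineq2)
  also have "\<dots> \<le> norm a * (K\<^sup>2 * (norm s * norm v * norm x) + K\<^sup>2 * (norm x * norm v * norm s))"
    using 3[of s v x] 3[of x "cadj v" s]
    by (intro mult_left_mono order_trans[OF norm_triangle_ineq] add_mono) simp_all
  finally show ?thesis by (simp add: algebra_simps)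
qed

text \<open>
  One step almost adds an independent copy of \<open>s\<^sup>2\<close> to the square. The error is the mean size of the
  mixed term, which factorises because position, increment and disc variable are independent.
\<close>

lemma square_char_step:
  fixes L \<nu> :: "('f::rch_algebra^'q^'q) measure"
  assumes L: "prob_space L" "sets L = sets psd_borel"
    and nu: "prob_space \<nu>" "sets \<nu> = sets psd_borel"
    and mu: "\<mu> > bessel_rho TYPE('f) TYPE('q)"
    and K: "\<And>(a :: 'f^'q^'q) (b :: 'f^'q^'q). norm (a ** b) \<le> norm a * norm b * K" "0 < K"
    and mom: "(\<integral>\<^sup>+ x. ennreal (norm x) \<partial>L) \<le> ennreal A" "(\<integral>\<^sup>+ s. ennreal (norm s) \<partial>\<nu>) \<le> ennreal B"
      "(\<integral>\<^sup>+ v. ennreal (norm v) \<partial>(disc_law \<mu> :: ('f^'q^'q) measure)) \<le> ennreal C"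
    and nonneg: "0 \<le> A" "0 \<le> B" "0 \<le> C"
  shows "norm (square_char (distr (L \<Otimes>\<^sub>M \<nu> \<Otimes>\<^sub>M disc_law \<mu>) psd_borel walk_step) a - square_char L a * square_char \<nu> a)
    \<le> 2 * K\<^sup>2 * norm a * (A * (B * C))"
proof -
  let ?P = "disc_law \<mu> :: ('f^'q^'q) measure"
  let ?T = "L \<Otimes>\<^sub>M \<nu> \<Otimes>\<^sub>M ?P"
  interpret nu: prob_space \<nu> by fact
  interpret L: prob_space L by fact
  interpret P: prob_space ?P by (rule prob_space_disc_law[OF mu])
  interpret Q: pair_prob_space \<nu> ?P ..
  interpret T: pair_prob_space L "\<nu> \<Otimes>\<^sub>M ?P" ..
  have spaces: "space L = psd" "space \<nu> = psd"
    using sets_eq_imp_space_eq[OF L(2)] sets_eq_imp_space_eq[OF nu(2)] by simp_all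
  note w = measurable_walk_step'[OF L(2) nu(2), of \<mu>]
  have id [measurable]: "(\<lambda>x. x) \<in> borel_measurable psd_borel" "(\<lambda>x. x) \<in> borel_measurable L" "(\<lambda>x. x) \<in> borel_measurable \<nu>"
    by (intro measurable_psd_borel_ident refl L nu)+
  have f [measurable]: "fst \<in> borel_measurable ?T"
    by (rule measurable_compose[OF measurable_fst id(2)])
  have f' [measurable]: "(\<lambda>y. fst y) \<in> borel_measurable (\<nu> \<Otimes>\<^sub>M ?P)"
    by (rule measurable_compose[OF measurable_fst id(3)])
  have s [measurable]: "(\<lambda>z. fst (snd z)) \<in> borel_measurable ?T"
    by (rule measurable_compose[OF measurable_snd f'])
  have wb [measurable]: "walk_step \<in> borel_measurable ?T"
    by (rule measurable_compose[OF w id(1)])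
  let ?g = "\<lambda>z. a \<bullet> (walk_step z ** walk_step z)"
  let ?h = "\<lambda>z. a \<bullet> (fst z ** fst z) + a \<bullet> (fst (snd z) ** fst (snd z))"
  have gm: "?g \<in> borel_measurable ?T" by measurable
  have hm: "?h \<in> borel_measurable ?T" by measurable
  have ig: "integrable ?T (\<lambda>z. iexp (?g z))"
    by (rule T.P.integrable_const_bound[where B=1]) (auto intro!: measurable_compose[OF gm])
  have ih: "integrable ?T (\<lambda>z. iexp (?h z))"
    by (rule T.P.integrable_const_bound[where B=1]) (auto intro!: measurable_compose[OF hm])
  have 1: "square_char (distr ?T psd_borel walk_step) a = (CLINT z|?T. iexp (?g z))"
    unfolding square_char_def by (rule integral_distr[OF w]) measurable
  have 2: "(CLINT z|?T. iexp (?h z)) = square_char L a * square_char \<nu> a"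
  proof -
    have i1: "integrable (\<nu> \<Otimes>\<^sub>M ?P) (\<lambda>y. iexp (a \<bullet> (fst y ** fst y)))"
      by (rule Q.P.integrable_const_bound[where B=1]) auto
    have "(CLINT y|\<nu> \<Otimes>\<^sub>M ?P. iexp (a \<bullet> (fst y ** fst y))) = (CLINT s|\<nu>. CLINT v|?P. iexp (a \<bullet> (s ** s)))"
      using Q.integral_fst'[OF i1] by simp
    also have "\<dots> = square_char \<nu> a"
      using P.prob_space by (simp add: square_char_def)
    finally have Q: "(CLINT y|\<nu> \<Otimes>\<^sub>M ?P. iexp (a \<bullet> (fst y ** fst y))) = square_char \<nu> a" .
    have "(CLINT z|?T. iexp (?h z)) = (CLINT x|L. CLINT y|\<nu> \<Otimes>\<^sub>M ?P. iexp (a \<bullet> (x ** x)) * iexp (a \<bullet> (fst y ** fst y)))"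
      using T.integral_fst'[OF ih] by (simp add: exp_add distrib_left)
    also have "\<dots> = (CLINT x|L. iexp (a \<bullet> (x ** x)) * square_char \<nu> a)"
      by (simp add: Q)
    also have "\<dots> = square_char L a * square_char \<nu> a"
      by (simp add: square_char_def)
    finally show ?thesis .
  qed
  have vm [measurable]: "(\<lambda>v. v) \<in> borel_measurable ?P" by (rule measurable_disc_law_borel)
  have vm2 [measurable]: "(\<lambda>y. snd y) \<in> borel_measurable (\<nu> \<Otimes>\<^sub>M ?P)"
    by (rule measurable_compose[OF measurable_snd vm])
  have vm3 [measurable]: "(\<lambda>z. snd (snd z)) \<in> borel_measurable ?T"
    by (rule measurable_compose[OF measurable_snd vm2])
  have tm: "(\<lambda>z. ennreal (norm (fst z)) * (ennreal (norm (fst (snd z))) * ennreal (norm (snd (snd z))))) \<in> borel_measurable ?T"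
    by measurable
  have qm: "(\<lambda>y. ennreal (norm (fst y)) * ennreal (norm (snd y))) \<in> borel_measurable (\<nu> \<Otimes>\<^sub>M ?P)"
    by measurable
  let ?c = "2 * K\<^sup>2 * norm a"
  have c: "0 \<le> ?c" by simp
  have "ennreal (norm ((CLINT z|?T. iexp (?g z)) - (CLINT z|?T. iexp (?h z))))
      = ennreal (norm (CLINT z|?T. iexp (?g z) - iexp (?h z)))"
    using ig ih by simp
  also have "\<dots> \<le> (\<integral>\<^sup>+ z. ennreal (norm (iexp (?g z) - iexp (?h z))) \<partial>?T)"
    by (rule integral_norm_bound_ennreal) (intro Bochner_Integration.integrable_diff ig ih)
  also have "\<dots> \<le> (\<integral>\<^sup>+ z. ennreal ?c * (ennreal (norm (fst z)) * (ennreal (norm (fst (snd z))) * ennreal (norm (snd (snd z))))) \<partial>?T)"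
  proof (rule nn_integral_mono)
    fix z assume z: "z \<in> space ?T"
    obtain x s v where zz: "z = (x, s, v)" by (metis prod.exhaust)
    have "norm (iexp (?g z) - iexp (?h z)) \<le> \<bar>?g z - ?h z\<bar>" by (rule norm_iexp_diff_le)
    also have "\<dots> \<le> ?c * (norm x * (norm s * norm v))"
      using conv_square_deviation[OF K, of a x s v] z walk_step_props(2)[of x s v]
      by (simp add: zz space_pair_measure spaces)
    finally show "ennreal (norm (iexp (?g z) - iexp (?h z))) \<le> ennreal ?c * (ennreal (norm (fst z)) * (ennreal (norm (fst (snd z))) * ennreal (norm (snd (snd z)))))"
      using c by (simp add: zz ennreal_mult'[symmetric] ennreal_leI)
  qed
  also have "\<dots> = ennreal ?c * (\<integral>\<^sup>+ z. ennreal (norm (fst z)) * (ennreal (norm (fst (snd z))) * ennreal (norm (snd (snd z)))) \<partial>?T)"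
    by (rule nn_integral_cmult) measurable
  also have "(\<integral>\<^sup>+ z. ennreal (norm (fst z)) * (ennreal (norm (fst (snd z))) * ennreal (norm (snd (snd z)))) \<partial>?T)
      = (\<integral>\<^sup>+ x. (\<integral>\<^sup>+ y. ennreal (norm x) * (ennreal (norm (fst y)) * ennreal (norm (snd y))) \<partial>(\<nu> \<Otimes>\<^sub>M ?P)) \<partial>L)"
    using Q.P.nn_integral_fst[OF tm] by simp
  also have "\<dots> = (\<integral>\<^sup>+ x. ennreal (norm x) * (\<integral>\<^sup>+ y. ennreal (norm (fst y)) * ennreal (norm (snd y)) \<partial>(\<nu> \<Otimes>\<^sub>M ?P)) \<partial>L)"
    by (intro nn_integral_cong nn_integral_cmult) measurable
  also have "(\<integral>\<^sup>+ y. ennreal (norm (fst y)) * ennreal (norm (snd y)) \<partial>(\<nu> \<Otimes>\<^sub>M ?P))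
      = (\<integral>\<^sup>+ s. (\<integral>\<^sup>+ v. ennreal (norm s) * ennreal (norm v) \<partial>?P) \<partial>\<nu>)"
    using P.nn_integral_fst[OF qm] by simp
  also have "\<dots> = (\<integral>\<^sup>+ s. ennreal (norm s) * (\<integral>\<^sup>+ v. ennreal (norm v) \<partial>?P) \<partial>\<nu>)"
    by (intro nn_integral_cong nn_integral_cmult) measurable
  also have "\<dots> = (\<integral>\<^sup>+ s. ennreal (norm s) \<partial>\<nu>) * (\<integral>\<^sup>+ v. ennreal (norm v) \<partial>?P)"
    by (rule nn_integral_multc) measurable
  also have "(\<integral>\<^sup>+ x. ennreal (norm x) * ((\<integral>\<^sup>+ s. ennreal (norm s) \<partial>\<nu>) * (\<integral>\<^sup>+ v. ennreal (norm v) \<partial>?P)) \<partial>L)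
      = (\<integral>\<^sup>+ x. ennreal (norm x) \<partial>L) * ((\<integral>\<^sup>+ s. ennreal (norm s) \<partial>\<nu>) * (\<integral>\<^sup>+ v. ennreal (norm v) \<partial>?P))"
    by (rule nn_integral_multc) measurable
  also have "ennreal ?c * \<dots> \<le> ennreal ?c * (ennreal A * (ennreal B * ennreal C))"
    by (intro mult_mono mom) auto
  also have "\<dots> = ennreal (?c * (A * (B * C)))"
    using c nonneg by (simp add: ennreal_mult')
  finally show ?thesis
    unfolding 1 2 using c nonneg by (subst (asm) ennreal_le_iff) auto
qed

lemma norm_square_char_le_1:
  assumes "prob_space L" shows "norm (square_char L a) \<le> 1"
proof -
  interpret prob_space L by fact
  have "norm (square_char L a) \<le> (LINT x|L. norm (iexp (a \<bullet> (x ** x))))"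
    unfolding square_char_def by (rule integral_norm_bound)
  then show ?thesis using prob_space by simp
qed

text \<open>
  The errors of the single steps add up, since characteristic functions are bounded by 1. Up to time
  \<open>n\<close> each of them is bounded by means of the second moment at time \<open>n\<close>.
\<close>

lemma square_char_bessel_walk:
  fixes \<nu> :: "('f::rch_algebra^'q^'q) measure"
  assumes nu: "prob_space \<nu>" "sets \<nu> = sets psd_borel"
    and mu: "\<mu> > bessel_rho TYPE('f) TYPE('q)"
    and rw: "bessel_random_walk M \<mu> \<nu> S"
    and K: "\<And>(a :: 'f^'q^'q) (b :: 'f^'q^'q). norm (a ** b) \<le> norm a * norm b * K" "0 < K"
    and m2: "(\<integral>\<^sup>+ s. ennreal ((norm s)\<^sup>2) \<partial>\<nu>) \<le> ennreal m2" "0 \<le> m2"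
  shows "norm (square_char (distr M psd_borel (S n)) a - square_char \<nu> a ^ n)
    \<le> real n * (2 * K\<^sup>2 * norm a * (sqrt (real n * m2) * (sqrt m2 *
        sqrt (4/3 * 2 ^ DIM('f^'q^'q) / (\<mu> - bessel_rho TYPE('f) TYPE('q))))))"
proof -
  interpret M: prob_space M by (rule bessel_random_walkD(1)[OF rw])
  interpret nu: prob_space \<nu> by fact
  interpret P: prob_space "disc_law \<mu> :: ('f^'q^'q) measure" by (rule prob_space_disc_law[OF mu])
  define V where "V = 4/3 * 2 ^ DIM('f^'q^'q) / (\<mu> - bessel_rho TYPE('f) TYPE('q))"
  have V: "0 \<le> V" using mu by (simp add: V_def)
  define E where "E = 2 * K\<^sup>2 * norm a * (sqrt (real n * m2) * (sqrt m2 * sqrt V))"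
  have pL: "prob_space (distr M psd_borel (S k))" for k
    by (rule M.prob_space_distr[OF bessel_random_walkD(2)[OF rw]])
  have P1: "(\<integral>\<^sup>+ v. ennreal (norm v) \<partial>(disc_law \<mu> :: ('f^'q^'q) measure)) \<le> ennreal (sqrt V)"
    using disc_law_second_moment[OF mu] measurable_disc_law_borel
    by (intro P.nn_integral_le_sqrt V) (auto simp: V_def)
  have idm: "(\<lambda>x. x) \<in> borel_measurable N" if "sets N = sets psd_borel" for N :: "('f^'q^'q) measure"
    by (rule measurable_psd_borel_ident[OF that])
  have nu1: "(\<integral>\<^sup>+ s. ennreal (norm s) \<partial>\<nu>) \<le> ennreal (sqrt m2)"
    using m2 idm[OF nu(2)] by (intro nu.nn_integral_le_sqrt) auto
  have L1: "(\<integral>\<^sup>+ x. ennreal (norm x) \<partial>distr M psd_borel (S k)) \<le> ennreal (sqrt (real n * m2))" if "k \<le> n" for k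
  proof (rule prob_space.nn_integral_le_sqrt[OF pL])
    have "(\<integral>\<^sup>+ y. ennreal ((norm y)\<^sup>2) \<partial>distr M psd_borel (S k)) = of_nat k * (\<integral>\<^sup>+ s. ennreal ((norm s)\<^sup>2) \<partial>\<nu>)"
      by (rule second_moment_bessel_walk[OF nu mu rw])
    also have "\<dots> \<le> of_nat n * ennreal m2" using that m2 by (intro mult_mono) auto
    also have "\<dots> = ennreal (real n * m2)" using m2 by (simp add: ennreal_mult' ennreal_of_nat_eq_real_of_nat)
    finally show "(\<integral>\<^sup>+ y. ennreal ((norm y)\<^sup>2) \<partial>distr M psd_borel (S k)) \<le> ennreal (real n * m2)" .
    show "norm \<in> borel_measurable (distr M psd_borel (S k))"
      using idm[of "distr M psd_borel (S k)"] by simp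
  qed (use m2 in auto)
  have "k \<le> n \<Longrightarrow> norm (square_char (distr M psd_borel (S k)) a - square_char \<nu> a ^ k) \<le> real k * E" for k
  proof (induction k)
    case 0
    have [measurable]: "(\<lambda>x :: 'f^'q^'q. x) \<in> borel_measurable psd_borel" by (rule idm) simp
    have "0 \<in> (psd :: ('f^'q^'q) set)" by (simp add: psd_def herm_def)
    then show ?case
      unfolding markov_chain_law_0[OF rw] square_char_def by (subst integral_return) auto
  next
    case (Suc k)
    let ?L = "\<lambda>k. square_char (distr M psd_borel (S k)) a" and ?p = "square_char \<nu> a"
    have "norm (?L (Suc k) - ?L k * ?p) \<le> E"
      unfolding markov_chain_law_step[OF nu mu rw] E_def
      using Suc.prems V m2 by (intro square_char_step pL nu mu K nu1 P1 L1) auto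
    moreover have "norm ((?L k - ?p ^ k) * ?p) \<le> real k * E"
      using mult_mono[OF Suc.IH norm_square_char_le_1[OF nu(1), of a]] Suc.prems order_trans[OF norm_ge_zero Suc.IH]
      by (simp add: norm_mult)
    ultimately have "norm (?L (Suc k) - ?L k * ?p) + norm ((?L k - ?p ^ k) * ?p) \<le> E + real k * E"
      by (rule add_mono)
    moreover have "?L (Suc k) - ?p ^ Suc k = (?L (Suc k) - ?L k * ?p) + (?L k - ?p ^ k) * ?p"
      by (simp add: algebra_simps)
    ultimately have "norm (?L (Suc k) - ?p ^ Suc k) \<le> E + real k * E"
      by (metis norm_triangle_le)
    then show ?case by (simp add: algebra_simps)
  qed
  from this[of n] show ?thesis by (simp add: E_def V_def)
qed

section \<open>Convergence of characteristic functions in Euclidean spaces\<close>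

text \<open>
  The phases allow sines as well as cosines. Generating products one cosine at a time is what makes
  the induction for \<open>trig_poly_converges\<close> work.
\<close>

inductive trig_poly :: "('a::real_inner \<Rightarrow> real) \<Rightarrow> bool" where
  const: "trig_poly (\<lambda>x. c)"
| mult_cos: "trig_poly h \<Longrightarrow> trig_poly (\<lambda>x. h x * cos (b \<bullet> x + c))"
| add: "trig_poly h \<Longrightarrow> trig_poly g \<Longrightarrow> trig_poly (\<lambda>x. h x + g x)"

lemma trig_poly_cmult: "trig_poly h \<Longrightarrow> trig_poly (\<lambda>x. k * h x)"
proof (induction rule: trig_poly.induct)
  case (mult_cos h b c)
  then show ?case using trig_poly.mult_cos[of "\<lambda>x. k * h x" b c] by (simp add: mult.assoc)
next
  case (add h g)
  then show ?case using trig_poly.add[of "\<lambda>x. k * h x" "\<lambda>x. k * g x"] by (simp add: distrib_left)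
qed (rule trig_poly.const)

lemma trig_poly_mult: "trig_poly h \<Longrightarrow> trig_poly g \<Longrightarrow> trig_poly (\<lambda>x. h x * g x)"
proof (induction rule: trig_poly.induct)
  case (const c)
  then show ?case by (rule trig_poly_cmult)
next
  case (mult_cos h b c)
  then show ?case using trig_poly.mult_cos[of "\<lambda>x. h x * g x" b c] by (simp add: mult_ac)
next
  case (add h1 h2)
  then show ?case using trig_poly.add[of "\<lambda>x. h1 x * g x" "\<lambda>x. h2 x * g x"] by (simp add: distrib_right)
qed

lemma trig_poly_compose:
  fixes p :: "real \<Rightarrow> real"
  assumes "real_polynomial_function p" "trig_poly h"
  shows "trig_poly (\<lambda>x. p (h x))"
  using assms
proof (induction rule: real_polynomial_function.induct)
  case (linear f)
  have "f y = f 1 * y" for y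
  proof -
    have "f (y *\<^sub>R 1) = y *\<^sub>R f 1" by (rule linear_cmul[OF bounded_linear.linear[OF linear.hyps]])
    then show ?thesis by (simp only: real_scaleR_def mult_1_right mult.commute[of y])
  qed
  then have "(\<lambda>x. f (h x)) = (\<lambda>x. f 1 * h x)" by (intro ext)
  then show ?case using trig_poly_cmult[OF linear.prems, of "f 1"] by (simp only:)
qed (auto intro: trig_poly.const trig_poly.add trig_poly_mult)

lemma trig_poly_bounded_continuous:
  "trig_poly h \<Longrightarrow> continuous_on UNIV h \<and> (\<exists>B. \<forall>x. \<bar>h x\<bar> \<le> B)"
proof (induction rule: trig_poly.induct)
  case (const c)
  show ?case by (auto intro!: continuous_intros)
next
  case (mult_cos h b c)
  then obtain B where B: "\<And>x. \<bar>h x\<bar> \<le> B" by auto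
  have "\<bar>h x * cos (b \<bullet> x + c)\<bar> \<le> B" for x
  proof -
    have "\<bar>h x * cos (b \<bullet> x + c)\<bar> \<le> B * 1"
      unfolding abs_mult using B[of x] by (intro mult_mono) (auto intro: order_trans[OF abs_ge_zero])
    then show ?thesis by simp
  qed
  then show ?case using mult_cos by (auto intro!: continuous_intros)
next
  case (add h g)
  then obtain B C where "\<And>x. \<bar>h x\<bar> \<le> B" "\<And>x. \<bar>g x\<bar> \<le> C" by auto
  then have "\<bar>h x + g x\<bar> \<le> B + C" for x
    by (intro order_trans[OF abs_triangle_ineq] add_mono) auto
  then show ?case using add by (auto intro!: continuous_intros)
qed

text \<open>
  The hypothesis of the continuity theorem for characteristic functions in a Euclidean space; its
  conclusion is \<open>bounded_continuous_converges\<close>.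
\<close>

locale char_convergent =
  fixes P :: "nat \<Rightarrow> 'a::euclidean_space measure" and Q :: "'a measure"
  assumes prob_P: "\<And>n. prob_space (P n)" and sets_P: "\<And>n. sets (P n) = sets borel"
    and prob_Q: "prob_space Q" and sets_Q: "sets Q = sets borel"
    and char_conv: "\<And>a. (\<lambda>n. CLINT x|P n. iexp (a \<bullet> x)) \<longlonglongrightarrow> (CLINT x|Q. iexp (a \<bullet> x))"
begin

lemma integrable_bounded_continuous:
  assumes N: "prob_space N" "sets N = sets borel" and h: "continuous_on UNIV h" "\<And>x. \<bar>h x\<bar> \<le> B"
  shows "integrable N (h :: 'a \<Rightarrow> real)"
proof -
  interpret prob_space N by fact
  have "h \<in> borel_measurable borel" using h(1) by (rule borel_measurable_continuous_onI)
  then have "h \<in> borel_measurable N" using measurable_cong_sets[OF N(2) refl, of borel] by blast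
  then show ?thesis by (rule integrable_const_bound[where B=B, rotated]) (simp add: h(2))
qed

text \<open>
  The additional cosine factor strengthens the claim enough for an induction: when \<open>h\<close> itself acquires a
  cosine factor, the product of the two cosines is a sum of cosines. For constant \<open>h\<close> the integral is the
  real part of a multiple of the characteristic function.
\<close>

lemma trig_poly_converges:
  "trig_poly h \<Longrightarrow> (\<lambda>n. LINT x|P n. h x * cos (b \<bullet> x + c)) \<longlonglongrightarrow> (LINT x|Q. h x * cos (b \<bullet> x + c))"
proof (induction arbitrary: b c rule: trig_poly.induct)
  case (const k)
  have eq: "(LINT x|N. k * cos (b \<bullet> x + c)) = k * Re (iexp c * (CLINT x|N. iexp (b \<bullet> x)))"
    if N: "prob_space N" "sets N = sets borel" for N
  proof -
    interpret prob_space N by fact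
    have [measurable_cong]: "sets N = sets borel" by fact
    have i: "integrable N (\<lambda>x. iexp (b \<bullet> x))"
      by (rule integrable_const_bound[where B=1]) auto
    have "Re (iexp c * (CLINT x|N. iexp (b \<bullet> x))) = Re (CLINT x|N. iexp c * iexp (b \<bullet> x))"
      by simp
    also have "\<dots> = (LINT x|N. Re (iexp c * iexp (b \<bullet> x)))"
      by (rule integral_Re[symmetric]) (intro integrable_mult_right i)
    also have "\<dots> = (LINT x|N. cos (b \<bullet> x + c))"
      by (simp add: exp_add[symmetric] Re_exp add.commute)
    finally show ?thesis by simp
  qed
  show ?case
    unfolding eq[OF prob_P sets_P] eq[OF prob_Q sets_Q]
    by (intro tendsto_intros char_conv)
next
  case (mult_cos h b' c')
  obtain B where cont: "continuous_on UNIV h" and B: "\<And>x. \<bar>h x\<bar> \<le> B"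
    using trig_poly_bounded_continuous[OF mult_cos.hyps] by auto
  have eq: "(LINT x|N. h x * cos (b' \<bullet> x + c') * cos (b \<bullet> x + c)) =
      ((LINT x|N. h x * cos ((b' - b) \<bullet> x + (c' - c))) + (LINT x|N. h x * cos ((b' + b) \<bullet> x + (c' + c)))) / 2"
    if N: "prob_space N" "sets N = sets borel" for N
  proof -
    have i: "integrable N (\<lambda>x. h x * cos (d \<bullet> x + e))" for d e
    proof (rule integrable_bounded_continuous[OF N])
      show "\<bar>h x * cos (d \<bullet> x + e)\<bar> \<le> B" for x
        using mult_mono[OF B[of x] abs_cos_le_one[of "d \<bullet> x + e"]] B[of x] by (simp add: abs_mult)
    qed (intro continuous_intros cont)
    have "h x * cos (b' \<bullet> x + c') * cos (b \<bullet> x + c) =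
        (h x * cos ((b' - b) \<bullet> x + (c' - c)) + h x * cos ((b' + b) \<bullet> x + (c' + c))) / 2" for x
    proof -
      have "(b' - b) \<bullet> x + (c' - c) = (b' \<bullet> x + c') - (b \<bullet> x + c)"
        "(b' + b) \<bullet> x + (c' + c) = (b' \<bullet> x + c') + (b \<bullet> x + c)"
        by (simp_all add: inner_diff_left inner_add_left)
      then show ?thesis by (simp only: mult.assoc cos_times_cos) (simp add: distrib_left)
    qed
    then have "(LINT x|N. h x * cos (b' \<bullet> x + c') * cos (b \<bullet> x + c)) =
        (LINT x|N. (h x * cos ((b' - b) \<bullet> x + (c' - c)) + h x * cos ((b' + b) \<bullet> x + (c' + c))) / 2)"
      by (simp only:)
    also have "\<dots> = ((LINT x|N. h x * cos ((b' - b) \<bullet> x + (c' - c))) + (LINT x|N. h x * cos ((b' + b) \<bullet> x + (c' + c)))) / 2"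
      by (subst integral_divide_zero) (subst Bochner_Integration.integral_add[OF i i], rule refl)
    finally show ?thesis .
  qed
  show ?case
    unfolding eq[OF prob_P sets_P] eq[OF prob_Q sets_Q]
    by (intro tendsto_intros mult_cos.IH) simp
next
  case (add h g)
  obtain B where h: "continuous_on UNIV h" "\<And>x. \<bar>h x\<bar> \<le> B"
    using trig_poly_bounded_continuous[OF add.hyps(1)] by auto
  obtain C where g: "continuous_on UNIV g" "\<And>x. \<bar>g x\<bar> \<le> C"
    using trig_poly_bounded_continuous[OF add.hyps(2)] by auto
  have eq: "(LINT x|N. (h x + g x) * cos (b \<bullet> x + c)) =
      (LINT x|N. h x * cos (b \<bullet> x + c)) + (LINT x|N. g x * cos (b \<bullet> x + c))"
    if N: "prob_space N" "sets N = sets borel" for N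
  proof -
    have i: "integrable N (\<lambda>x. f x * cos (b \<bullet> x + c))"
      if "continuous_on UNIV f" and D: "\<And>x. \<bar>f x\<bar> \<le> D" for f D
    proof (rule integrable_bounded_continuous[OF N])
      show "\<bar>f x * cos (b \<bullet> x + c)\<bar> \<le> D" for x
        using mult_mono[OF D[of x] abs_cos_le_one[of "b \<bullet> x + c"]] D[of x] by (simp add: abs_mult)
    qed (intro continuous_intros that)
    show ?thesis using i[OF h] i[OF g] by (simp add: distrib_right)
  qed
  show ?case
    unfolding eq[OF prob_P sets_P] eq[OF prob_Q sets_Q]
    by (intro tendsto_intros add.IH)
qed

lemma integral_diff_le:
  assumes N: "prob_space N" "sets N = sets borel"
    and f: "continuous_on UNIV f" "\<And>x. \<bar>f x\<bar> \<le> B"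
    and g: "continuous_on UNIV g" "\<And>x. \<bar>g x\<bar> \<le> C"
    and h: "continuous_on UNIV h" "\<And>x. \<bar>h x\<bar> \<le> D"
    and le: "\<And>x. \<bar>f x - g x\<bar> \<le> h (x :: 'a)"
  shows "\<bar>(LINT x|N. f x) - (LINT x|N. g x)\<bar> \<le> (LINT x|N. h x :: real)"
proof -
  note int = integrable_bounded_continuous[OF N f] integrable_bounded_continuous[OF N g]
    integrable_bounded_continuous[OF N h]
  have "\<bar>(LINT x|N. f x) - (LINT x|N. g x)\<bar> = \<bar>LINT x|N. f x - g x\<bar>"
    using int by simp
  also have "\<dots> \<le> (LINT x|N. \<bar>f x - g x\<bar>)"
    using integral_norm_bound[of N "\<lambda>x. f x - g x"] by simp
  also have "\<dots> \<le> (LINT x|N. h x)"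
    using int le by (intro integral_mono) auto
  finally show ?thesis .
qed

text \<open>
  A trigonometric polynomial that approximates a function on a compact set need not be bounded by
  the same constant elsewhere; truncation restores the bound. On the bounded range of \<open>h\<close> the truncation
  is a uniform limit of polynomials, and a polynomial in a trigonometric polynomial is again one.
\<close>

lemma clamp_trig_poly_converges:
  fixes r :: real
  assumes h: "trig_poly h" and r: "0 \<le> r"
  shows "(\<lambda>n. LINT x|P n. max (- r) (min r (h x))) \<longlonglongrightarrow> (LINT x|Q. max (- r) (min r (h x)))"
proof (rule LIMSEQ_I)
  fix e :: real assume e: "0 < e"
  let ?c = "\<lambda>y. max (- r) (min r y)"
  obtain B where cont: "continuous_on UNIV h" and B: "\<And>x. \<bar>h x\<bar> \<le> B"
    using trig_poly_bounded_continuous[OF h] by auto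
  obtain p where p: "real_polynomial_function p" "\<And>y. y \<in> {-B..B} \<Longrightarrow> \<bar>?c y - p y\<bar> < e / 4"
  proof (rule Stone_Weierstrass_real_polynomial_function[of "{-B..B}" ?c "e / 4"])
    show "continuous_on {-B..B} ?c" by (intro continuous_intros)
  qed (use e in auto)
  let ?p = "\<lambda>x. p (h x)"
  have tp: "trig_poly ?p" by (rule trig_poly_compose[OF p(1) h])
  obtain C where pc: "continuous_on UNIV ?p" and C: "\<And>x. \<bar>?p x\<bar> \<le> C"
    using trig_poly_bounded_continuous[OF tp] by auto
  have cc: "continuous_on UNIV (\<lambda>x. ?c (h x))" by (intro continuous_intros cont)
  have cr: "\<bar>?c (h x)\<bar> \<le> r" for x using r by auto
  have ce: "\<bar>?c (h x) - ?p x\<bar> \<le> e / 4" for x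
    using p(2)[of "h x"] B[of x] by (auto simp: abs_le_iff intro: less_imp_le)
  have close: "\<bar>(LINT x|N. ?c (h x)) - (LINT x|N. ?p x)\<bar> \<le> e / 4" if N: "prob_space N" "sets N = sets borel" for N
  proof -
    interpret prob_space N by fact
    have "\<bar>(LINT x|N. ?c (h x)) - (LINT x|N. ?p x)\<bar> \<le> (LINT x|N. e / 4)"
      by (rule integral_diff_le[OF N cc cr pc C _ _ ce, of "e / 4"]) (use e in auto)
    then show ?thesis using prob_space by simp
  qed
  have "(\<lambda>n. LINT x|P n. ?p x) \<longlonglongrightarrow> (LINT x|Q. ?p x)"
    using trig_poly_converges[OF tp, of 0 0] by simp
  from LIMSEQ_D[OF this, of "e / 2"] e obtain n0
    where n0: "\<And>n. n \<ge> n0 \<Longrightarrow> \<bar>(LINT x|P n. ?p x) - (LINT x|Q. ?p x)\<bar> < e / 2" by auto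
  show "\<exists>n0. \<forall>n\<ge>n0. norm ((LINT x|P n. ?c (h x)) - (LINT x|Q. ?c (h x))) < e"
  proof (intro exI allI impI)
    fix n assume "n0 \<le> n"
    then show "norm ((LINT x|P n. ?c (h x)) - (LINT x|Q. ?c (h x))) < e"
      using n0[of n] close[OF prob_P[of n] sets_P[of n]] close[OF prob_Q sets_Q] unfolding real_norm_def by linarith
  qed
qed

lemma projection_converges:
  fixes g :: "real \<Rightarrow> real"
  assumes g: "continuous_on UNIV g" "\<And>t. \<bar>g t\<bar> \<le> B"
  shows "(\<lambda>n. LINT x|P n. g (b \<bullet> x)) \<longlonglongrightarrow> (LINT x|Q. g (b \<bullet> x))"
proof -
  have m: "(\<lambda>x. b \<bullet> x) \<in> borel_measurable N" if "sets N = sets borel" for N :: "'a measure"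
  proof -
    have "(\<lambda>x. b \<bullet> x) \<in> borel_measurable borel" by measurable
    then show ?thesis using measurable_cong_sets[OF that refl, of borel] by blast
  qed
  have rd: "real_distribution (distr N borel (\<lambda>x. b \<bullet> x))" if "prob_space N" "sets N = sets borel" for N :: "'a measure"
    by (rule prob_space.real_distribution_distr[OF that(1) m[OF that(2)]])
  have ch: "char (distr N borel (\<lambda>x. b \<bullet> x)) t = (CLINT x|N. iexp ((t *\<^sub>R b) \<bullet> x))" if "sets N = sets borel" for N :: "'a measure" and t
    unfolding char_def using m[OF that] by (subst integral_distr) auto
  have "weak_conv_m (\<lambda>n. distr (P n) borel (\<lambda>x. b \<bullet> x)) (distr Q borel (\<lambda>x. b \<bullet> x))"
    by (rule levy_continuity) (simp_all only: rd prob_P sets_P prob_Q sets_Q ch char_conv)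
  then have "(\<lambda>n. LINT t|distr (P n) borel (\<lambda>x. b \<bullet> x). g t) \<longlonglongrightarrow> (LINT t|distr Q borel (\<lambda>x. b \<bullet> x). g t)"
    using g by (intro weak_conv_imp_integral_bdd_continuous_conv[where B=B] rd prob_P sets_P prob_Q sets_Q)
      (auto simp: continuous_on_eq_continuous_at)
  then show ?thesis
    using borel_measurable_continuous_onI[OF g(1)] by (simp add: integral_distr m sets_P sets_Q)
qed

text \<open>
  The function \<open>G\<close> adds up continuous cutoffs of the coordinates. Its integrals converge by the
  one-dimensional continuity theorem, and the limit is small when the cutoffs start far out.
\<close>

lemma tightness:
  assumes e: "0 < e"
  shows "\<exists>C G. compact C \<and> continuous_on UNIV G \<and> (\<forall>x. 0 \<le> G x \<and> G x \<le> real DIM('a)) \<and>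
    (\<forall>x. x \<notin> C \<longrightarrow> 1 \<le> G x) \<and> (LINT x|Q. G x) < e \<and> (\<lambda>n. LINT x|P n. G x) \<longlonglongrightarrow> (LINT (x :: 'a)|Q. G x)"
proof -
  define g where "g k t = min 1 (max 0 (\<bar>t\<bar> - real k))" for k :: nat and t :: real
  define G where "G k x = (\<Sum>b\<in>Basis. g k (b \<bullet> x))" for k and x :: 'a
  have g01: "0 \<le> g k t" "g k t \<le> 1" "\<bar>g k t\<bar> \<le> 1" for k t by (auto simp: g_def)
  have gc: "continuous_on UNIV (g k)" for k unfolding g_def by (intro continuous_intros)
  have G0: "0 \<le> G k x" for k x unfolding G_def by (intro sum_nonneg g01)
  have G1: "G k x \<le> real DIM('a)" for k x
    unfolding G_def using sum_mono[of Basis "\<lambda>b. g k (b \<bullet> x)" "\<lambda>_. 1"] g01(2) by simp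
  have gbc: "continuous_on UNIV (\<lambda>x. g k (b \<bullet> x))" for k and b :: 'a
    unfolding g_def by (intro continuous_intros)
  have Gc: "continuous_on UNIV (G k)" for k unfolding G_def by (intro continuous_intros gbc)
  have Gb: "\<bar>G k x\<bar> \<le> real DIM('a)" for k x using G0 G1 by simp
  interpret Q: prob_space Q by (rule prob_Q)
  have "(\<lambda>k. LINT x|Q. G k x) \<longlonglongrightarrow> (LINT x|Q. 0)"
  proof (rule integral_dominated_convergence[where w="\<lambda>_. real DIM('a)"])
    show "(\<lambda>x. 0) \<in> borel_measurable Q" "integrable Q (\<lambda>_. real DIM('a))" by simp_all
    show "G k \<in> borel_measurable Q" for k
      using integrable_bounded_continuous[OF prob_Q sets_Q Gc Gb] by (rule borel_measurable_integrable)
    show "AE x in Q. norm (G k x) \<le> real DIM('a)" for k by (simp add: Gb)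
    show "AE x in Q. (\<lambda>k. G k x) \<longlonglongrightarrow> 0"
    proof (rule AE_I2)
      fix x :: 'a
      obtain K where K: "norm x \<le> real K" using real_arch_simple by blast
      have "G k x = 0" if "K \<le> k" for k
      proof -
        have "g k (b \<bullet> x) = 0" if "b \<in> Basis" for b
          using Basis_le_norm[OF that, of x] K \<open>K \<le> k\<close> by (simp add: g_def inner_commute)
        then show ?thesis by (simp add: G_def)
      qed
      then show "(\<lambda>k. G k x) \<longlonglongrightarrow> 0"
        by (intro tendsto_eventually eventually_sequentiallyI)
    qed
  qed
  then have "(\<lambda>k. LINT x|Q. G k x) \<longlonglongrightarrow> 0" by simp
  from order_tendstoD(2)[OF this e] obtain k where k: "(LINT x|Q. G k x) < e"
    by (auto simp: eventually_sequentially)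
  let ?C = "cbox (- (real k + 1) *\<^sub>R One) ((real k + 1) *\<^sub>R One) :: 'a set"
  have off: "1 \<le> G k x" if x: "x \<notin> ?C" for x
  proof -
    have "\<exists>b\<in>Basis. \<not> \<bar>b \<bullet> x\<bar> \<le> real k + 1"
    proof (rule ccontr)
      assume "\<not> ?thesis"
      then have "\<bar>b \<bullet> x\<bar> \<le> real k + 1" if "b \<in> Basis" for b using that by blast
      moreover have "i \<bullet> One = 1" if "i \<in> Basis" for i :: 'a
        using that by (simp add: inner_sum_right inner_Basis if_distrib cong: if_cong)
      ultimately have "x \<in> ?C" by (force simp: mem_box inner_commute abs_le_iff)
      then show False using x by simp
    qed
    then obtain b where b: "b \<in> Basis" and "\<not> \<bar>b \<bullet> x\<bar> \<le> real k + 1" by blast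
    then have "g k (b \<bullet> x) = 1" by (auto simp: g_def)
    then show ?thesis
      using member_le_sum[OF b, of "\<lambda>b. g k (b \<bullet> x)"] g01 by (simp add: G_def)
  qed
  have "(\<lambda>n. LINT x|P n. G k x) \<longlonglongrightarrow> (LINT x|Q. G k x)"
  proof -
    have eq: "(LINT x|N. G k x) = (\<Sum>b\<in>Basis. LINT x|N. g k (b \<bullet> x))"
      if N: "prob_space N" "sets N = sets borel" for N
      unfolding G_def by (intro Bochner_Integration.integral_sum integrable_bounded_continuous[OF N gbc g01(3)])
    show ?thesis
      unfolding eq[OF prob_P sets_P] eq[OF prob_Q sets_Q]
      by (intro tendsto_sum projection_converges[OF gc g01(3)])
  qed
  then show ?thesis
    using k off G0 G1 Gc by (intro exI[of _ ?C] exI[of _ "G k"]) (auto simp: compact_cbox)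
qed

text \<open>
  The multivariate continuity theorem. On a compact set that carries almost all mass of the limit,
  hence of the late measures, \<open>f\<close> is close to a truncated trigonometric polynomial; elsewhere both
  are bounded by \<open>B\<close>.
\<close>

theorem bounded_continuous_converges:
  fixes f :: "'a \<Rightarrow> real"
  assumes f: "continuous_on UNIV f" and B: "\<And>x. \<bar>f x\<bar> \<le> B"
  shows "(\<lambda>n. LINT x|P n. f x) \<longlonglongrightarrow> (LINT x|Q. f x)"
proof (rule LIMSEQ_I)
  fix e :: real assume e: "0 < e"
  have B0: "0 \<le> B" using B[of undefined] by linarith
  \<comment> \<open>The two approximation errors amount to at most \<open>2 (d + 2 B d)\<close>, the convergence error to \<open>d\<close>.\<close>
  define d where "d = e / (4 + 4 * B)"
  have d: "0 < d" using e B0 by (simp add: d_def)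
  have "(4 + 4 * B) * d = e" using B0 by (simp add: d_def)
  then have de: "3 * d + 4 * B * d < e" using d by (simp add: distrib_right)
  obtain C G where C: "compact C" and Gc: "continuous_on UNIV G"
    and G01: "\<And>x. 0 \<le> G x" "\<And>x. G x \<le> real DIM('a)" and off: "\<And>x. x \<notin> C \<Longrightarrow> 1 \<le> G x"
    and GQ: "(LINT x|Q. G x) < d" and GP: "(\<lambda>n. LINT x|P n. G x) \<longlonglongrightarrow> (LINT x|Q. G x)"
    using tightness[OF d] by blast
  have "\<exists>p. trig_poly p \<and> (\<forall>x\<in>C. \<bar>f x - p x\<bar> < d)"
  proof (rule Stone_Weierstrass_HOL[OF C])
    show "trig_poly (\<lambda>x. c)" for c by (rule trig_poly.const)
    show "continuous_on C p" if "trig_poly p" for p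
      using trig_poly_bounded_continuous[OF that] continuous_on_subset by blast
    show "trig_poly (\<lambda>x. p x + r x)" if "trig_poly p \<and> trig_poly r" for p r
      using that by (blast intro: trig_poly.add)
    show "trig_poly (\<lambda>x. p x * r x)" if "trig_poly p \<and> trig_poly r" for p r
      using that by (blast intro: trig_poly_mult)
    show "\<exists>p. trig_poly p \<and> p x \<noteq> p y" if "x \<in> C \<and> y \<in> C \<and> x \<noteq> y" for x y
    proof -
      \<comment> \<open>A half period between \<open>x\<close> and \<open>y\<close> separates them: the cosine takes the values \<open>- 1\<close> and \<open>1\<close>.\<close>
      define b where "b = (pi / ((x - y) \<bullet> (x - y))) *\<^sub>R (x - y)"
      have "b \<bullet> (x - y) = pi" using that by (simp add: b_def)
      then have "b \<bullet> x + - (b \<bullet> y) = pi" by (simp add: inner_diff_right)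
      then have "1 * cos (b \<bullet> x + - (b \<bullet> y)) \<noteq> 1 * cos (b \<bullet> y + - (b \<bullet> y))" by (simp only:) simp
      moreover have "trig_poly (\<lambda>z. 1 * cos (b \<bullet> z + - (b \<bullet> y)))"
        by (rule trig_poly.mult_cos[OF trig_poly.const])
      ultimately show ?thesis by blast
    qed
    show "continuous_on C f" using f continuous_on_subset by blast
    show "0 < d" by (rule d)
  qed
  then obtain p where p: "trig_poly p" and pf: "\<And>x. x \<in> C \<Longrightarrow> \<bar>f x - p x\<bar> < d" by blast
  have pc: "continuous_on UNIV p" using trig_poly_bounded_continuous[OF p] by blast
  let ?p = "\<lambda>x. max (- B) (min B (p x))"
  have cc: "continuous_on UNIV ?p" by (intro continuous_intros pc)
  have cB: "\<bar>?p x\<bar> \<le> B" for x using B0 by auto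
  have near: "\<bar>f x - ?p x\<bar> \<le> d + 2 * B * G x" for x
  proof (cases "x \<in> C")
    case True
    have "\<bar>f x - ?p x\<bar> \<le> \<bar>f x - p x\<bar>" using B[of x] by (auto simp: max_def min_def)
    also have "\<dots> \<le> d" using pf[OF True] by simp
    also have "\<dots> \<le> d + 2 * B * G x" using B0 G01(1)[of x] by simp
    finally show ?thesis .
  next
    case False
    have "\<bar>f x - ?p x\<bar> \<le> 2 * B * 1" using B[of x] cB[of x] by linarith
    also have "\<dots> \<le> 2 * B * G x" using B0 off[OF False] by (intro mult_left_mono) auto
    finally show ?thesis using d by simp
  qed
  have close: "\<bar>(LINT x|N. f x) - (LINT x|N. ?p x)\<bar> \<le> d + 2 * B * (LINT x|N. G x)"
    if N: "prob_space N" "sets N = sets borel" for N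
  proof -
    interpret prob_space N by fact
    have Gi: "integrable N G"
      by (rule integrable_bounded_continuous[OF N Gc, of "real DIM('a)"]) (use G01 in simp)
    have "\<bar>(LINT x|N. f x) - (LINT x|N. ?p x)\<bar> \<le> (LINT x|N. d + 2 * B * G x)"
    proof (rule integral_diff_le[OF N f B cc cB _ _ near])
      show "continuous_on UNIV (\<lambda>x. d + 2 * B * G x)" by (intro continuous_intros Gc)
      show "\<bar>d + 2 * B * G x\<bar> \<le> d + 2 * B * real DIM('a)" for x
        using d B0 G01[of x] by (simp add: abs_of_nonneg mult_left_mono)
    qed
    also have "\<dots> = d + 2 * B * (LINT x|N. G x)" using Gi prob_space by simp
    finally show ?thesis .
  qed
  have "eventually (\<lambda>n. (LINT x|P n. G x) < d) sequentially"
    by (rule order_tendstoD(2)[OF GP GQ])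
  moreover have "eventually (\<lambda>n. \<bar>(LINT x|P n. ?p x) - (LINT x|Q. ?p x)\<bar> < d) sequentially"
    using tendstoD[OF clamp_trig_poly_converges[OF p B0] d] by (simp add: dist_real_def)
  ultimately have "eventually (\<lambda>n. norm ((LINT x|P n. f x) - (LINT x|Q. f x)) < e) sequentially"
  proof eventually_elim
    case (elim n)
    have "2 * B * (LINT x|P n. G x) \<le> 2 * B * d" "2 * B * (LINT x|Q. G x) \<le> 2 * B * d"
      using elim(1) GQ B0 by (auto intro!: mult_left_mono)
    then show ?case
      using close[OF prob_P[of n] sets_P[of n]] close[OF prob_Q sets_Q] elim(2) de
      unfolding real_norm_def by linarith
  qed
  then show "\<exists>n0. \<forall>n\<ge>n0. norm ((LINT x|P n. f x) - (LINT x|Q. f x)) < e"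
    by (simp add: eventually_sequentially)
qed

end

section \<open>Gaussian laws and powers of characteristic functions\<close>

text \<open>
  Cholesky decomposition, one rank at a time. If \<open>q z z > 0\<close>, then the Schur complement
  \<open>q a b - l a * l b\<close> with \<open>l a = q a z / sqrt (q z z)\<close> is again a positive semidefinite form, and it
  vanishes at \<open>z\<close> and wherever \<open>q\<close> did. A Gaussian law for it, plus an independent
  standard normal multiple of the vector that represents \<open>l\<close>, is a Gaussian law for \<open>q\<close>. If \<open>q\<close> vanishes
  at all basis vectors, then \<open>q = 0\<close> and the law is the point mass at 0.
\<close>

lemma gaussian_exists:
  fixes q :: "'a::euclidean_space \<Rightarrow> 'a \<Rightarrow> real"
  assumes "bilinear q" "\<And>a b. q a b = q b a" "\<And>a. 0 \<le> q a a"
  shows "\<exists>N. prob_space N \<and> sets N = sets borel \<and> (\<forall>a. (CLINT x|N. iexp (a \<bullet> x)) = exp (- (q a a) / 2))"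
  using assms
proof (induction "card {b \<in> Basis. q b b \<noteq> 0}" arbitrary: q rule: less_induct)
  case less
  note bil = less.prems(1) and sym = less.prems(2) and pos = less.prems(3)
  note linr = bil[unfolded bilinear_def, THEN conjunct1, THEN spec]
  show ?case
  proof (cases "\<forall>b\<in>Basis. q b b = 0")
    case True
    have "q a b = 0" if b: "b \<in> Basis" for a b
    proof (rule ccontr)
      assume n: "q a b \<noteq> 0"
      \<comment> \<open>This choice makes the form at \<open>a + t b\<close> equal to \<open>- 1\<close>.\<close>
      define t where "t = - (q a a + 1) / (2 * q a b)"
      have "q (a + t *\<^sub>R b) (a + t *\<^sub>R b) = q a a + 2 * t * q a b + t\<^sup>2 * q b b"
        using sym[of b a]
        by (simp add: bilinear_ladd[OF bil] bilinear_radd[OF bil] bilinear_lmul[OF bil] bilinear_rmul[OF bil]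
            power2_eq_square algebra_simps)
      also have "\<dots> = - 1" using True b n by (simp add: t_def field_simps)
      finally show False using pos[of "a + t *\<^sub>R b"] by simp
    qed
    then have "q a a = 0" for a
      using linear_sum[OF linr, of a "\<lambda>b. (a \<bullet> b) *\<^sub>R b" Basis]
      by (simp add: euclidean_representation bilinear_rmul[OF bil])
    moreover have "prob_space (return borel (0 :: 'a))" by (rule prob_space_return) simp
    moreover have "(CLINT x|return borel (0 :: 'a). iexp (a \<bullet> x)) = 1" for a
      by (subst integral_return) auto
    ultimately show ?thesis by (intro exI[of _ "return borel 0"]) simp
  next
    case False
    then obtain z where z: "z \<in> Basis" "q z z \<noteq> 0" by blast
    then have zp: "0 < q z z" using pos[of z] by simp
    define l where "l a = q a z / sqrt (q z z)" for a
    define w where "w = (\<Sum>b\<in>Basis. l b *\<^sub>R b)"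
    define q' where "q' a b = q a b - l a * l b" for a b
    have ll: "linear l"
      unfolding l_def
      by (rule linearI) (simp_all add: bilinear_ladd[OF bil] bilinear_lmul[OF bil] add_divide_distrib)
    have aw: "a \<bullet> w = l a" for a
      using linear_sum[OF ll, of "\<lambda>b. (a \<bullet> b) *\<^sub>R b" Basis]
      by (simp add: w_def inner_sum_right euclidean_representation linear_cmul[OF ll] mult.commute)
    have sq: "sqrt (q z z) * sqrt (q z z) = q z z" using zp by simp
    have bil': "bilinear q'"
      unfolding bilinear_def q'_def
      by (auto intro!: linearI simp: bilinear_ladd[OF bil] bilinear_radd[OF bil] bilinear_lmul[OF bil]
          bilinear_rmul[OF bil] linear_add[OF ll] linear_cmul[OF ll] algebra_simps)
    have sym': "q' a b = q' b a" for a b using sym[of a b] by (simp add: q'_def mult.commute)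
    have pos': "0 \<le> q' a a" for a
    proof -
      \<comment> \<open>The complement at \<open>a\<close> is \<open>q\<close> at the component of \<open>a\<close> that is \<open>q\<close>-orthogonal to \<open>z\<close>.\<close>
      define t where "t = q a z / q z z"
      have tz: "t * q z z = q a z" using zp by (simp add: t_def)
      have "q (a - t *\<^sub>R z) (a - t *\<^sub>R z) = q a a - t * q a z - t * q a z + t * (t * q z z)"
        using sym[of z a]
        by (simp add: bilinear_lsub[OF bil] bilinear_rsub[OF bil] bilinear_lmul[OF bil] bilinear_rmul[OF bil]
            algebra_simps)
      also have "\<dots> = q a a - t * q a z" by (simp add: tz)
      also have "\<dots> = q' a a" using zp sq by (simp add: q'_def l_def t_def)
      finally show ?thesis using pos[of "a - t *\<^sub>R z"] by simp
    qed
    have qz: "q' z z = 0" using zp sq by (simp add: q'_def l_def)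
    have "{b \<in> Basis. q' b b \<noteq> 0} \<subset> {b \<in> Basis. q b b \<noteq> 0}"
    proof (rule psubsetI)
      have "q' b b = 0" if "q b b = 0" for b
        using pos'[of b] that by (simp add: q'_def) (metis zero_le_square order_antisym mult_eq_0_iff)
      then show "{b \<in> Basis. q' b b \<noteq> 0} \<subseteq> {b \<in> Basis. q b b \<noteq> 0}" by auto
      show "{b \<in> Basis. q' b b \<noteq> 0} \<noteq> {b \<in> Basis. q b b \<noteq> 0}" using z qz by blast
    qed
    then have "card {b \<in> Basis. q' b b \<noteq> 0} < card {b \<in> Basis. q b b \<noteq> 0}"
      by (rule psubset_card_mono[rotated]) simp
    from less.hyps[OF this bil' sym' pos'] obtain N' where
      N': "prob_space N'" "sets N' = sets borel" "\<And>a. (CLINT x|N'. iexp (a \<bullet> x)) = exp (- (q' a a) / 2)"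
      by blast
    let ?n = "std_normal_distribution"
    interpret N': prob_space N' by (rule N'(1))
    interpret n: real_distribution ?n by (rule real_dist_normal_dist)
    interpret pair_prob_space N' ?n ..
    have id: "(\<lambda>x. x) \<in> borel_measurable N'" using measurable_ident_sets[OF N'(2)] by simp
    have [measurable]: "fst \<in> borel_measurable (N' \<Otimes>\<^sub>M ?n)"
      by (rule measurable_compose[OF measurable_fst id])
    have [measurable]: "snd \<in> borel_measurable (N' \<Otimes>\<^sub>M ?n)"
      by (rule measurable_compose[OF measurable_snd]) simp
    let ?f = "\<lambda>x. fst x + snd x *\<^sub>R w"
    let ?N = "distr (N' \<Otimes>\<^sub>M ?n) borel ?f"
    have "(CLINT x|?N. iexp (a \<bullet> x)) = exp (- (q a a) / 2)" for a
    proof -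
      have i: "integrable (N' \<Otimes>\<^sub>M ?n) (\<lambda>x. iexp (a \<bullet> ?f x))"
        by (rule P.integrable_const_bound[where B=1]) auto
      have "(CLINT x|?N. iexp (a \<bullet> x)) = (CLINT x|N' \<Otimes>\<^sub>M ?n. iexp (a \<bullet> ?f x))"
        by (rule integral_distr) measurable
      also have "\<dots> = (CLINT x|N'. CLINT t|?n. iexp (a \<bullet> x) * iexp (l a * t))"
        using integral_fst'[OF i] by (simp add: inner_add_right aw exp_add[symmetric] algebra_simps)
      also have "\<dots> = (CLINT x|N'. iexp (a \<bullet> x) * char ?n (l a))"
        by (simp add: char_def)
      also have "\<dots> = exp (- (q' a a) / 2) * exp (- ((l a)\<^sup>2) / 2)"
        by (simp add: N'(3) char_std_normal_distribution)
      also have "\<dots> = exp (- (q a a) / 2)"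
        by (simp add: exp_of_real[symmetric] exp_add[symmetric] q'_def power2_eq_square diff_divide_distrib)
      finally show ?thesis .
    qed
    moreover have "prob_space ?N" by (rule P.prob_space_distr) measurable
    ultimately show ?thesis by (intro exI[of _ ?N]) simp
  qed
qed

lemma char_normal_real:
  assumes v: "0 \<le> v"
  shows "char (normal_real 0 v) t = exp (- (v * t\<^sup>2) / 2)" "real_distribution (normal_real 0 v)"
proof -
  interpret n: real_distribution std_normal_distribution by (rule real_dist_normal_dist)
  have eq: "normal_real 0 v = distr std_normal_distribution borel (\<lambda>x. sqrt v * x)"
  proof (cases "v = 0")
    case True
    then show ?thesis by (simp add: normal_real_def n.distr_const)
  next
    case False
    have "distributed std_normal_distribution lborel (\<lambda>x. x) std_normal_density"
      unfolding distributed_def by (simp add: distr_id2)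
    from n.normal_density_affine[OF this, of "sqrt v" 0] False v
    have "distributed std_normal_distribution lborel (\<lambda>x. sqrt v * x) (normal_density 0 (sqrt v))" by simp
    then have "distr std_normal_distribution lborel (\<lambda>x. sqrt v * x) = density lborel (normal_density 0 (sqrt v))"
      by (simp add: distributed_def)
    then show ?thesis using False by (simp add: normal_real_def cong: distr_cong)
  qed
  show "real_distribution (normal_real 0 v)"
    unfolding eq by (rule n.real_distribution_distr) simp
  have "char (normal_real 0 v) t = char std_normal_distribution (sqrt v * t)"
    unfolding eq char_def by (subst integral_distr) (simp_all add: mult_ac)
  also have "\<dots> = exp (- (v * t\<^sup>2) / 2)"
    using v by (simp add: char_std_normal_distribution power_mult_distrib)
  finally show "char (normal_real 0 v) t = exp (- (v * t\<^sup>2) / 2)" .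
qed

text \<open>
  The analytic core of the classical central limit theorem, including the degenerate case \<open>v = 0\<close>: the
  second-order expansion of the characteristic function at 0 has an error \<open>o(1 / n)\<close>, by dominated
  convergence.
\<close>

lemma (in prob_space) char_power_tendsto_gaussian:
  fixes X :: "'a \<Rightarrow> real"
  assumes X [measurable]: "X \<in> borel_measurable M" and X2: "integrable M (\<lambda>x. (X x)\<^sup>2)"
    and X0: "expectation X = 0" and v: "expectation (\<lambda>x. (X x)\<^sup>2) = v"
  shows "(\<lambda>n. (CLINT x|M. iexp (X x / sqrt (real n))) ^ n) \<longlonglongrightarrow> exp (- v / 2)"
proof -
  define D where "D = distr M borel X"
  have X1: "integrable M X" by (rule square_integrable_imp_integrable[OF X X2])
  interpret D: real_distribution D unfolding D_def by (rule real_distribution_distr) simp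
  have D: "integrable D (\<lambda>x. x)" "D.expectation (\<lambda>x. x) = 0" "integrable D (\<lambda>x. x\<^sup>2)"
    "D.expectation (\<lambda>x. x\<^sup>2) = v"
    unfolding D_def using X1 X2 X0 v by (simp_all add: integrable_distr_eq integral_distr)
  have v0: "0 \<le> v" unfolding v[symmetric] by (rule integral_nonneg_AE) simp
  let ?\<psi> = "\<lambda>n. char D (1 / sqrt (real n))"
  have \<psi>: "(CLINT x|M. iexp (X x / sqrt (real n))) = ?\<psi> n" for n
    unfolding char_def D_def by (subst integral_distr) simp_all
  let ?R = "\<lambda>n. LINT x|D. min (6 * x\<^sup>2) (\<bar>1 / sqrt (real n)\<bar> * \<bar>x\<bar> ^ 3)"
  have "(\<lambda>n. ?R n) \<longlonglongrightarrow> (LINT x|D. 0)"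
  proof (rule integral_dominated_convergence[where w="\<lambda>x. 6 * x\<^sup>2"])
    have lim: "(\<lambda>n. min (6 * x\<^sup>2) (\<bar>1 / sqrt (real n)\<bar> * \<bar>x\<bar> ^ 3)) \<longlonglongrightarrow> min (6 * x\<^sup>2) (\<bar>0\<bar> * \<bar>x\<bar> ^ 3)" for x :: real
      by (intro tendsto_intros real_tendsto_divide_at_top[OF tendsto_const]
          filterlim_compose[OF sqrt_at_top filterlim_real_sequentially])
    show "AE x in D. (\<lambda>n. min (6 * x\<^sup>2) (\<bar>1 / sqrt (real n)\<bar> * \<bar>x\<bar> ^ 3)) \<longlonglongrightarrow> 0"
      by (intro AE_I2 tendsto_eq_rhs[OF lim]) simp
  qed (use D(3) in auto)
  then have R0: "(\<lambda>n. ?R n / 6) \<longlonglongrightarrow> 0" by (auto intro: tendsto_divide_zero)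
  have main: "eventually (\<lambda>n. norm (?\<psi> n ^ n - (1 + (- v / 2) / real n) ^ n) \<le> ?R n / 6) sequentially"
  proof (rule eventually_sequentiallyI)
    fix n :: nat assume "nat \<lceil>v\<rceil> + 1 \<le> n"
    then have n: "v \<le> real n" "0 < real n" by linarith+
    have "norm (?\<psi> n - complex_of_real (1 - (1 / sqrt (real n))\<^sup>2 * v / 2)) \<le> (1 / sqrt (real n))\<^sup>2 / 6 * ?R n"
      by (rule D.char_approx3) (use D in auto)
    moreover have sqn: "(1 / sqrt (real n))\<^sup>2 = 1 / real n" by (simp add: power_divide)
    moreover have "1 - 1 / real n * v / 2 = 1 + (- v / 2) / real n" by simp
    ultimately have b: "norm (?\<psi> n - complex_of_real (1 + (- v / 2) / real n)) \<le> 1 / real n / 6 * ?R n"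
      by (simp only:)
    have "norm (?\<psi> n ^ n - complex_of_real (1 + (- v / 2) / real n) ^ n) \<le>
        real n * norm (?\<psi> n - complex_of_real (1 + (- v / 2) / real n))"
    proof (rule norm_power_diff)
      have "\<bar>1 + (- v / 2) / real n\<bar> \<le> 1" using n v0 by (simp add: abs_le_iff field_simps)
      then show "norm (complex_of_real (1 + (- v / 2) / real n)) \<le> 1" by (simp only: norm_of_real)
    qed (rule D.cmod_char_le_1)
    also have "\<dots> \<le> real n * (1 / real n / 6 * ?R n)"
      using b by (intro mult_left_mono) auto
    also have "\<dots> = ?R n / 6" using n by simp
    finally show "norm (?\<psi> n ^ n - (1 + (- v / 2) / real n) ^ n) \<le> ?R n / 6" by simp
  qed
  have "(\<lambda>n. complex_of_real ((1 + (- v / 2) / real n) ^ n)) \<longlonglongrightarrow> complex_of_real (exp (- v / 2))"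
    by (intro tendsto_of_real tendsto_exp_limit_sequentially)
  then have lim: "(\<lambda>n. (1 + complex_of_real (- v / 2) / of_nat n) ^ n) \<longlonglongrightarrow> complex_of_real (exp (- v / 2))"
    by simp
  have "(\<lambda>n. ?\<psi> n ^ n - (1 + (- v / 2) / real n) ^ n) \<longlonglongrightarrow> 0"
    by (rule Lim_null_comparison[OF main R0])
  from tendsto_add[OF this lim] show ?thesis unfolding \<psi> by simp
qed

section \<open>Covariance of the squares\<close>

lemma measurable_square:
  assumes "sets \<nu> = sets psd_borel"
  shows "(\<lambda>x. x ** x) \<in> measurable \<nu> herm_borel"
proof -
  have [measurable]: "(\<lambda>x. x) \<in> borel_measurable \<nu>" by (rule measurable_psd_borel_ident[OF assms])
  have "(\<lambda>x. x ** x) \<in> borel_measurable \<nu>" by measurable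
  then show ?thesis
    unfolding herm_borel_def using sets_eq_imp_space_eq[OF assms]
    by (intro measurable_restrict_space2) (auto intro: psd_herm square_in_psd)
qed

lemma integral_square_image:
  fixes g :: "'f::rch_algebra^'q^'q \<Rightarrow> 'b::{banach, second_countable_topology}"
  assumes "sets \<nu> = sets psd_borel" "g \<in> borel_measurable borel"
  shows "(LINT y|square_image \<nu>. g y) = (LINT x|\<nu>. g (x ** x))"
  unfolding square_image_def
proof (rule integral_distr[OF measurable_square[OF assms(1)]])
  show "g \<in> borel_measurable herm_borel"
    unfolding herm_borel_def by (rule measurable_restrict_space1[OF assms(2)])
qed

lemma fourth_moment_integrable:
  fixes \<nu> :: "('f::rch_algebra^'q^'q) measure" and \<sigma>2 :: "'f^'q^'q"
  assumes nu: "prob_space \<nu>" "sets \<nu> = sets psd_borel"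
    and m4: "integrable \<nu> (\<lambda>x. norm x ^ 4)"
  shows "integrable \<nu> (\<lambda>x. (norm x)\<^sup>2)" "integrable \<nu> (\<lambda>x. x ** x)"
    "integrable \<nu> (\<lambda>x. (a \<bullet> (x ** x - \<sigma>2)) * (b \<bullet> (x ** x - \<sigma>2)))"
proof -
  interpret prob_space \<nu> by fact
  have id [measurable]: "(\<lambda>x. x) \<in> borel_measurable \<nu>" by (rule measurable_psd_borel_ident[OF nu(2)])
  have sqm [measurable]: "(\<lambda>x. x ** x) \<in> borel_measurable \<nu>" by measurable
  obtain K where K: "K > 0" "\<And>(x :: 'f^'q^'q) (y :: 'f^'q^'q). norm (x ** y) \<le> norm x * norm y * K"
    using bounded_bilinear.pos_bounded[OF bounded_bilinear_mat_mult] by metis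
  have p: "t\<^sup>2 \<le> 1 + t ^ 4" for t :: real
  proof -
    have "2 * t\<^sup>2 \<le> 1 + t ^ 4"
      using zero_le_power2[of "t\<^sup>2 - 1"] by (simp add: power2_diff power_mult[symmetric])
    then show ?thesis using zero_le_power2[of t] by linarith
  qed
  show s2: "integrable \<nu> (\<lambda>x. (norm x)\<^sup>2)"
    by (rule Bochner_Integration.integrable_bound[of _ "\<lambda>x. 1 + norm x ^ 4"]) (use m4 p in \<open>auto intro!: AE_I2\<close>)
  have nsq: "norm (x ** x) \<le> K * (norm x)\<^sup>2" for x :: "'f^'q^'q"
    using K(2)[of x x] by (simp add: power2_eq_square mult_ac)
  show "integrable \<nu> (\<lambda>x. x ** x)"
    by (rule Bochner_Integration.integrable_bound[of _ "\<lambda>x. K * (norm x)\<^sup>2"])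
      (use s2 K(1) nsq in \<open>auto intro!: AE_I2\<close>)
  show "integrable \<nu> (\<lambda>x. (a \<bullet> (x ** x - \<sigma>2)) * (b \<bullet> (x ** x - \<sigma>2)))"
  proof (rule Bochner_Integration.integrable_bound)
    show "integrable \<nu> (\<lambda>x. norm a * norm b * (2 * K\<^sup>2 * norm x ^ 4 + 2 * (norm \<sigma>2)\<^sup>2))"
      using m4 by simp
    show "(\<lambda>x. (a \<bullet> (x ** x - \<sigma>2)) * (b \<bullet> (x ** x - \<sigma>2))) \<in> borel_measurable \<nu>" by measurable
    show "AE x in \<nu>. norm ((a \<bullet> (x ** x - \<sigma>2)) * (b \<bullet> (x ** x - \<sigma>2)))
        \<le> norm (norm a * norm b * (2 * K\<^sup>2 * norm x ^ 4 + 2 * (norm \<sigma>2)\<^sup>2))"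
    proof (rule AE_I2)
      fix x :: "'f^'q^'q"
      let ?z = "x ** x - \<sigma>2"
      have "norm ?z \<le> K * (norm x)\<^sup>2 + norm \<sigma>2"
        using norm_triangle_ineq4[of "x ** x" \<sigma>2] nsq[of x] by linarith
      then have "(norm ?z)\<^sup>2 \<le> (K * (norm x)\<^sup>2 + norm \<sigma>2)\<^sup>2" by (intro power_mono) auto
      also have "\<dots> \<le> 2 * (K * (norm x)\<^sup>2)\<^sup>2 + 2 * (norm \<sigma>2)\<^sup>2"
        using sum_squares_bound[of "K * (norm x)\<^sup>2" "norm \<sigma>2"] by (simp add: power2_sum)
      finally have z2: "(norm ?z)\<^sup>2 \<le> 2 * K\<^sup>2 * norm x ^ 4 + 2 * (norm \<sigma>2)\<^sup>2"
        by (simp add: power_mult_distrib power_mult[symmetric])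
      have "norm ((a \<bullet> ?z) * (b \<bullet> ?z)) \<le> (norm a * norm ?z) * (norm b * norm ?z)"
        unfolding real_norm_def abs_mult by (intro mult_mono Cauchy_Schwarz_ineq2) auto
      also have "\<dots> = norm a * norm b * (norm ?z)\<^sup>2" by (simp add: power2_eq_square mult_ac)
      also have "\<dots> \<le> norm a * norm b * (2 * K\<^sup>2 * norm x ^ 4 + 2 * (norm \<sigma>2)\<^sup>2)"
        by (intro mult_left_mono z2) auto
      finally show "norm ((a \<bullet> ?z) * (b \<bullet> ?z)) \<le> norm (norm a * norm b * (2 * K\<^sup>2 * norm x ^ 4 + 2 * (norm \<sigma>2)\<^sup>2))"
        by simp
    qed
  qed
qed

lemma covariance_square_image:
  fixes \<nu> :: "('f::rch_algebra^'q^'q) measure"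
  assumes "sets \<nu> = sets psd_borel"
  defines "\<sigma>2 \<equiv> LINT s|\<nu>. s ** s"
  shows "covariance (square_image \<nu>) a b = (LINT x|\<nu>. (a \<bullet> (x ** x - \<sigma>2)) * (b \<bullet> (x ** x - \<sigma>2)))"
proof -
  have "(LINT z|square_image \<nu>. z) = \<sigma>2"
    unfolding \<sigma>2_def by (rule integral_square_image[OF assms(1)]) simp
  then show ?thesis
    unfolding covariance_def by (simp add: integral_square_image[OF assms(1)])
qed

text \<open>
  The orthogonal projection onto the Hermitian matrices. It transports laws and test functions between
  this subspace and the full matrix space, where the continuity theorem applies.
\<close>

definition herm_part :: "'f::rch_algebra^'q^'q \<Rightarrow> 'f^'q^'q" where
  "herm_part x = (1/2) *\<^sub>R (x + cadj x)"

lemma herm_part_herm: "herm_part x \<in> herm"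
  by (simp add: herm_part_def herm_def cadj_add cadj_scaleR add.commute)

lemma herm_part_id: "x \<in> herm \<Longrightarrow> herm_part x = x"
  by (simp add: herm_part_def herm_def scaleR_2[symmetric])

lemma inner_herm_part: 
  assumes "a \<in> herm" shows "a \<bullet> herm_part x = a \<bullet> x"
proof -
  have "a \<bullet> cadj x = a \<bullet> x" using inner_cadj[of a x] hermD[OF assms] by simp
  then show ?thesis by (simp add: herm_part_def inner_add_right)
qed

lemma continuous_on_herm_part: "continuous_on S herm_part"
  unfolding herm_part_def by (intro continuous_intros)

text \<open>
  The covariance form is defined on all matrices, so it has a Gaussian law there. Its projection has
  the same one-dimensional marginals along Hermitian directions.
\<close>

lemma normal_law_exists:
  fixes \<nu> :: "('f::rch_algebra^'q^'q) measure"
  assumes nu: "prob_space \<nu>" "sets \<nu> = sets psd_borel"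
    and m4: "integrable \<nu> (\<lambda>x. norm x ^ 4)"
  defines "C \<equiv> covariance (square_image \<nu>)"
  shows "\<exists>N. prob_space N \<and> sets N = sets borel \<and>
    (\<forall>a. (CLINT x|N. iexp (a \<bullet> x)) = exp (- (C a a) / 2)) \<and>
    is_normal_law herm 0 C (distr N herm_borel herm_part)"
proof -
  define \<sigma>2 where "\<sigma>2 = (LINT s|\<nu>. s ** s)"
  have C: "C a b = (LINT x|\<nu>. (a \<bullet> (x ** x - \<sigma>2)) * (b \<bullet> (x ** x - \<sigma>2)))" for a b
    unfolding C_def \<sigma>2_def by (rule covariance_square_image[OF nu(2)])
  note int = fourth_moment_integrable(3)[OF nu m4, of _ \<sigma>2]
  have bil: "bilinear C"
    unfolding bilinear_def C using int
    by (auto intro!: linearI simp: inner_add_left distrib_left distrib_right mult.assoc mult.left_commute)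
  have sym: "C a b = C b a" for a b by (simp add: C mult.commute)
  have pos: "0 \<le> C a a" for a by (simp add: C)
  obtain N where N: "prob_space N" "sets N = sets borel" "\<And>a. (CLINT x|N. iexp (a \<bullet> x)) = exp (- (C a a) / 2)"
    using gaussian_exists[OF bil sym pos] by blast
  interpret N: prob_space N by fact
  have id: "(\<lambda>x. x) \<in> borel_measurable N" using measurable_ident_sets[OF N(2)] by simp
  have hb: "herm_part \<in> borel_measurable (borel :: ('f^'q^'q) measure)"
    by (rule borel_measurable_continuous_onI[OF continuous_on_herm_part])
  have hN: "herm_part \<in> measurable N herm_borel"
    unfolding herm_borel_def
    by (rule measurable_restrict_space2) (auto intro: herm_part_herm measurable_compose[OF id hb])
  let ?N = "distr N herm_borel herm_part"
  have proj: "distr ?N borel (\<lambda>x. a \<bullet> x) = normal_real (a \<bullet> 0) (C a a)" if a: "a \<in> herm" for a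
  proof (rule Levy_uniqueness)
    have am: "(\<lambda>x. a \<bullet> x) \<in> borel_measurable herm_borel"
      unfolding herm_borel_def by (rule measurable_restrict_space1) measurable
    have aN: "(\<lambda>x. a \<bullet> x) \<in> borel_measurable N"
      by (rule measurable_compose[OF id]) measurable
    have eq: "distr ?N borel (\<lambda>x. a \<bullet> x) = distr N borel (\<lambda>x. a \<bullet> x)"
      by (simp add: distr_distr[OF am hN] comp_def inner_herm_part[OF a])
    show "real_distribution (distr ?N borel (\<lambda>x. a \<bullet> x))"
      unfolding eq by (rule N.real_distribution_distr[OF aN])
    show "real_distribution (normal_real (a \<bullet> 0) (C a a))"
      using char_normal_real(2)[OF pos] by simp
    show "char (distr ?N borel (\<lambda>x. a \<bullet> x)) = char (normal_real (a \<bullet> 0) (C a a))"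
    proof
      fix t
      have "char (distr ?N borel (\<lambda>x. a \<bullet> x)) t = (CLINT x|N. iexp ((t *\<^sub>R a) \<bullet> x))"
        unfolding eq char_def using aN by (subst integral_distr) auto
      also have "\<dots> = exp (- (C (t *\<^sub>R a) (t *\<^sub>R a)) / 2)" by (rule N(3))
      also have "\<dots> = char (normal_real (a \<bullet> 0) (C a a)) t"
        by (simp add: char_normal_real(1)[OF pos] bilinear_lmul[OF bil] bilinear_rmul[OF bil]
            power2_eq_square mult_ac)
      finally show "char (distr ?N borel (\<lambda>x. a \<bullet> x)) t = char (normal_real (a \<bullet> 0) (C a a)) t" .
    qed
  qed
  have "is_normal_law herm 0 C ?N"
    unfolding is_normal_law_def using proj N.prob_space_distr[OF hN] by (simp add: herm_borel_def)
  then show ?thesis using N by blast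
qed

lemma char_shifted_square:
  fixes L :: "('f::rch_algebra^'q^'q) measure"
  shows "(CLINT x|L. iexp (a \<bullet> (x ** x) + c)) = square_char L a * iexp c"
  by (simp add: square_char_def distrib_left exp_add)

text \<open>
  Eventually \<open>\<mu>\<^sub>n > n\<^sup>2 \<ge> 2 \<rho>\<close>, so that subtracting \<open>\<rho>\<close> at most halves \<open>\<mu>\<^sub>n\<close>.
\<close>

lemma bessel_rate:
  fixes \<mu> :: "nat \<Rightarrow> real" and \<rho> :: real
  assumes rho: "0 \<le> \<rho>" and mu: "\<And>n. n \<ge> 1 \<Longrightarrow> \<rho> < \<mu> n"
    and lim: "(\<lambda>n. (real n)\<^sup>2 / \<mu> n) \<longlonglongrightarrow> 0"
  shows "(\<lambda>n. real n / sqrt (\<mu> n - \<rho>)) \<longlonglongrightarrow> 0"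
proof -
  have "(\<lambda>n. sqrt (2 * ((real n)\<^sup>2 / \<mu> n))) \<longlonglongrightarrow> sqrt (2 * 0)"
    by (intro tendsto_intros lim)
  then have lim': "(\<lambda>n. sqrt (2 * ((real n)\<^sup>2 / \<mu> n))) \<longlonglongrightarrow> 0" by simp
  have e1: "eventually (\<lambda>n. (real n)\<^sup>2 / \<mu> n < 1) sequentially"
    by (rule order_tendstoD(2)[OF lim]) simp
  have e2: "eventually (\<lambda>n. n \<ge> nat \<lceil>2 * \<rho>\<rceil> + 1) sequentially" by (rule eventually_ge_at_top)
  have "eventually (\<lambda>n. norm (real n / sqrt (\<mu> n - \<rho>)) \<le> sqrt (2 * ((real n)\<^sup>2 / \<mu> n))) sequentially"
    using e1 e2
  proof eventually_elim
    case (elim n)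
    have n: "2 * \<rho> \<le> real n" "1 \<le> n" using elim(2) by linarith+
    have mn: "\<rho> < \<mu> n" using mu n by simp
    then have mp: "0 < \<mu> n" using rho by simp
    have "real n \<le> (real n)\<^sup>2" using n(2) by (simp add: power2_eq_square)
    moreover have "(real n)\<^sup>2 < \<mu> n" using elim(1) mp by simp
    ultimately have "2 * \<rho> \<le> \<mu> n" using n(1) by linarith
    then have h: "\<mu> n / 2 \<le> \<mu> n - \<rho>" by simp
    have "real n / sqrt (\<mu> n - \<rho>) = sqrt ((real n)\<^sup>2 / (\<mu> n - \<rho>))"
      by (simp add: real_sqrt_divide)
    also have "\<dots> \<le> sqrt ((real n)\<^sup>2 / (\<mu> n / 2))"
      using h mp by (intro real_sqrt_le_mono divide_left_mono) auto
    also have "\<dots> = sqrt (2 * ((real n)\<^sup>2 / \<mu> n))" by (simp add: mult.commute)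
    finally show ?case using mn by simp
  qed
  from Lim_null_comparison[OF this lim'] show ?thesis .
qed

section \<open>The limit theorem\<close>

text \<open>
  By \<open>square_char_bessel_walk\<close> the characteristic function of the normalised square differs from the one
  of a normalised sum of independent copies of \<open>s\<^sup>2 - \<sigma>\<^sup>2\<close> by at most a constant times
  \<open>n / sqrt (\<mu>\<^sub>n - \<rho>)\<close>. For the sum, convergence is \<open>char_power_tendsto_gaussian\<close>.
\<close>

lemma char_normalised_walk:
  fixes \<nu> :: "('f::rch_algebra^'q^'q) measure" and \<sigma>2 a :: "'f^'q^'q"
    and \<mu> :: "nat \<Rightarrow> real" and M :: "nat \<Rightarrow> 'w measure" and S :: "nat \<Rightarrow> nat \<Rightarrow> 'w \<Rightarrow> 'f^'q^'q"
  assumes nu: "prob_space \<nu>" "sets \<nu> = sets psd_borel"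
    and m4: "integrable \<nu> (\<lambda>x. norm x ^ 4)"
    and \<sigma>2: "\<sigma>2 = (LINT s|\<nu>. s ** s)"
    and mu: "\<And>n. n \<ge> 1 \<Longrightarrow> \<mu> n > bessel_rho TYPE('f) TYPE('q)"
    and lim: "(\<lambda>n. (real n)\<^sup>2 / \<mu> n) \<longlonglongrightarrow> 0"
    and rw: "\<And>n. n \<ge> 1 \<Longrightarrow> bessel_random_walk (M n) (\<mu> n) \<nu> (S n)"
  shows "(\<lambda>n. CLINT \<omega>|M n. iexp (a \<bullet> ((1 / sqrt (real n)) *\<^sub>R (S n n \<omega> ** S n n \<omega> - real n *\<^sub>R \<sigma>2))))
    \<longlonglongrightarrow> exp (- (covariance (square_image \<nu>) a a) / 2)"
proof -
  interpret nu: prob_space \<nu> by fact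
  note [measurable] = measurable_psd_borel_ident[OF nu(2)]
  define \<rho> where "\<rho> = bessel_rho TYPE('f) TYPE('q)"
  define L where "L n = distr (M n) psd_borel (S n n)" for n
  define b where "b n = (1 / sqrt (real n)) *\<^sub>R a" for n
  define c where "c n = - (a \<bullet> \<sigma>2) / sqrt (real n)" for n
  define X where "X s = a \<bullet> (s ** s - \<sigma>2)" for s
  obtain K where K: "K > 0" "\<And>(x :: 'f^'q^'q) (y :: 'f^'q^'q). norm (x ** y) \<le> norm x * norm y * K"
    using bounded_bilinear.pos_bounded[OF bounded_bilinear_mat_mult] by metis
  define m2 where "m2 = (LINT x|\<nu>. (norm x)\<^sup>2)"
  have m2: "(\<integral>\<^sup>+ s. ennreal ((norm s)\<^sup>2) \<partial>\<nu>) \<le> ennreal m2" "0 \<le> m2"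
    unfolding m2_def using fourth_moment_integrable(1)[OF nu m4] by (simp_all add: nn_integral_eq_integral)
  define V where "V = 4/3 * (2::real) ^ DIM('f^'q^'q)"
  have V: "0 \<le> V" by (simp add: V_def)
  have iid: "(\<lambda>n. (CLINT s|\<nu>. iexp (X s / sqrt (real n))) ^ n) \<longlonglongrightarrow> exp (- (covariance (square_image \<nu>) a a) / 2)"
  proof (rule nu.char_power_tendsto_gaussian)
    show "X \<in> borel_measurable \<nu>" unfolding X_def by measurable
    show "integrable \<nu> (\<lambda>s. (X s)\<^sup>2)"
      unfolding X_def power2_eq_square by (rule fourth_moment_integrable(3)[OF nu m4])
    show "nu.expectation X = 0"
    proof -
      have "nu.expectation X = a \<bullet> (LINT s|\<nu>. s ** s - \<sigma>2)"
        unfolding X_def using fourth_moment_integrable(2)[OF nu m4] by (subst integral_inner_right) auto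
      also have "(LINT s|\<nu>. s ** s - \<sigma>2) = 0"
        using fourth_moment_integrable(2)[OF nu m4] nu.prob_space by (simp add: \<sigma>2)
      finally show ?thesis by simp
    qed
    show "nu.expectation (\<lambda>s. (X s)\<^sup>2) = covariance (square_image \<nu>) a a"
      by (simp add: covariance_square_image[OF nu(2)] X_def power2_eq_square \<sigma>2)
  qed
  have walk: "(CLINT \<omega>|M n. iexp (a \<bullet> ((1 / sqrt (real n)) *\<^sub>R (S n n \<omega> ** S n n \<omega> - real n *\<^sub>R \<sigma>2))))
      = square_char (L n) (b n) * iexp (real n * c n)" if n: "n \<ge> 1" for n
  proof -
    have [measurable]: "(\<lambda>x :: 'f^'q^'q. x) \<in> borel_measurable psd_borel"
      by (rule measurable_psd_borel_ident) simp
    have "a \<bullet> ((1 / sqrt (real n)) *\<^sub>R (x ** x - real n *\<^sub>R \<sigma>2)) = b n \<bullet> (x ** x) + real n * c n" for x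
      by (simp add: b_def c_def inner_diff_right right_diff_distrib diff_divide_distrib)
    then have "(CLINT \<omega>|M n. iexp (a \<bullet> ((1 / sqrt (real n)) *\<^sub>R (S n n \<omega> ** S n n \<omega> - real n *\<^sub>R \<sigma>2))))
        = (CLINT \<omega>|M n. iexp (b n \<bullet> (S n n \<omega> ** S n n \<omega>) + real n * c n))"
      by (simp only:)
    also have "\<dots> = (CLINT x|L n. iexp (b n \<bullet> (x ** x) + real n * c n))"
      unfolding L_def by (rule integral_distr[symmetric, OF bessel_random_walkD(2)[OF rw[OF n]]]) measurable
    also have "\<dots> = square_char (L n) (b n) * iexp (real n * c n)"
      by (rule char_shifted_square)
    finally show ?thesis .
  qed
  have step: "(CLINT s|\<nu>. iexp (X s / sqrt (real n))) ^ n = square_char \<nu> (b n) ^ n * iexp (real n * c n)" for n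
  proof -
    have "X s / sqrt (real n) = b n \<bullet> (s ** s) + c n" for s
      by (simp add: X_def b_def c_def inner_diff_right diff_divide_distrib)
    then have "(CLINT s|\<nu>. iexp (X s / sqrt (real n))) = square_char \<nu> (b n) * iexp (c n)"
      by (simp only: char_shifted_square)
    then show ?thesis by (simp add: power_mult_distrib exp_of_nat_mult[symmetric] mult_ac)
  qed
  let ?d = "\<lambda>n. square_char (L n) (b n) * iexp (real n * c n) - square_char \<nu> (b n) ^ n * iexp (real n * c n)"
  have rate: "(\<lambda>n. 2 * K\<^sup>2 * norm a * m2 * sqrt V * (real n / sqrt (\<mu> n - \<rho>))) \<longlonglongrightarrow> 0"
  proof -
    have "0 < CARD('q)" by (rule zero_less_card_finite)
    then have "0 \<le> real CARD('q) - 1 / 2" by linarith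
    then have "0 \<le> real DIM('f) * (real CARD('q) - 1 / 2)" by (rule mult_nonneg_nonneg[OF of_nat_0_le_iff])
    then have "0 \<le> \<rho>" by (simp add: \<rho>_def bessel_rho_def)
    then have "(\<lambda>n. real n / sqrt (\<mu> n - \<rho>)) \<longlonglongrightarrow> 0"
      by (rule bessel_rate) (use mu lim in \<open>simp_all add: \<rho>_def\<close>)
    from tendsto_mult_right_zero[OF this] show ?thesis .
  qed
  have "eventually (\<lambda>n. norm (?d n) \<le> 2 * K\<^sup>2 * norm a * m2 * sqrt V * (real n / sqrt (\<mu> n - \<rho>))) sequentially"
  proof (rule eventually_sequentiallyI[of 1])
    fix n :: nat assume n: "1 \<le> n"
    have "norm (?d n) = norm (square_char (L n) (b n) - square_char \<nu> (b n) ^ n)"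
      by (simp add: left_diff_distrib[symmetric] norm_mult)
    also have "\<dots> \<le> real n * (2 * K\<^sup>2 * norm (b n) * (sqrt (real n * m2) * (sqrt m2 * sqrt (V / (\<mu> n - \<rho>)))))"
      unfolding L_def V_def \<rho>_def
      by (rule square_char_bessel_walk[OF nu mu[OF n] rw[OF n] K(2) K(1) m2])
    also have "\<dots> = 2 * K\<^sup>2 * norm a * (sqrt m2 * sqrt m2) * sqrt V * (real n / sqrt (\<mu> n - \<rho>))"
      using n by (simp add: b_def real_sqrt_mult real_sqrt_divide)
    also have "\<dots> = 2 * K\<^sup>2 * norm a * m2 * sqrt V * (real n / sqrt (\<mu> n - \<rho>))"
      using m2(2) by simp
    finally show "norm (?d n) \<le> 2 * K\<^sup>2 * norm a * m2 * sqrt V * (real n / sqrt (\<mu> n - \<rho>))" .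
  qed
  from Lim_null_comparison[OF this rate] have "?d \<longlonglongrightarrow> 0" .
  from tendsto_add[OF this iid[unfolded step]] have
    "(\<lambda>n. square_char (L n) (b n) * iexp (real n * c n)) \<longlonglongrightarrow> exp (- (covariance (square_image \<nu>) a a) / 2)"
    by (simp only: diff_add_cancel add_0_left)
  moreover have "eventually (\<lambda>n. square_char (L n) (b n) * iexp (real n * c n) =
      (CLINT \<omega>|M n. iexp (a \<bullet> ((1 / sqrt (real n)) *\<^sub>R (S n n \<omega> ** S n n \<omega> - real n *\<^sub>R \<sigma>2))))) sequentially"
    using walk by (intro eventually_sequentiallyI[of 1]) simp
  ultimately show ?thesis by (rule Lim_transform_eventually)
qed

theorem theorem3p8:
  fixes \<nu> :: "('f::rch_algebra^'q^'q) measure"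
    and \<sigma>2 :: "'f^'q^'q"
    and \<mu> :: "nat \<Rightarrow> real"
    and M :: "real \<Rightarrow> 'w measure"
    and S :: "real \<Rightarrow> nat \<Rightarrow> 'w \<Rightarrow> 'f^'q^'q"
  assumes "prob_space \<nu>" and "sets \<nu> = sets psd_borel"
    and "integrable \<nu> (\<lambda>x. norm x ^ 4)"
    and "\<sigma>2 = (LINT s|\<nu>. s ** s)"
    and "\<And>n. n \<ge> 1 \<Longrightarrow> \<mu> n > bessel_rho TYPE('f) TYPE('q)"
    and "(\<lambda>n. (real n)\<^sup>2 / \<mu> n) \<longlonglongrightarrow> 0"
    and "\<And>m. m > bessel_rho TYPE('f) TYPE('q) \<Longrightarrow> bessel_random_walk (M m) m \<nu> (S m)"
  shows "\<exists>N. is_normal_law herm 0 (covariance (square_image \<nu>)) N \<and>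
    weak_conv_on herm
      (\<lambda>n. distr (M (\<mu> n)) herm_borel
         (\<lambda>\<omega>. (1 / sqrt (real n)) *\<^sub>R
            (S (\<mu> n) n \<omega> ** S (\<mu> n) n \<omega> - real n *\<^sub>R \<sigma>2)))
      N"
proof -
  note nu = assms(1,2)
  note mu = assms(5)
  have rw: "bessel_random_walk (M (\<mu> n)) (\<mu> n) \<nu> (S (\<mu> n))" if "n \<ge> 1" for n
    by (rule assms(7)[OF mu[OF that]])
  define Y where "Y n \<omega> = (1 / sqrt (real n)) *\<^sub>R (S (\<mu> n) n \<omega> ** S (\<mu> n) n \<omega> - real n *\<^sub>R \<sigma>2)" for n \<omega>
  obtain N0 where N0: "prob_space N0" "sets N0 = sets borel"
      "\<And>a. (CLINT x|N0. iexp (a \<bullet> x)) = exp (- (covariance (square_image \<nu>) a a) / 2)"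
    and normal: "is_normal_law herm 0 (covariance (square_image \<nu>)) (distr N0 herm_borel herm_part)"
    using normal_law_exists[OF nu assms(3)] by blast
  have idm [measurable]: "(\<lambda>x :: 'f^'q^'q. x) \<in> borel_measurable psd_borel"
    by (rule measurable_psd_borel_ident) simp
  have \<sigma>h: "\<sigma>2 \<in> herm"
  proof -
    have "cadj \<sigma>2 = (LINT s|\<nu>. cadj (s ** s))"
      unfolding assms(4)
      by (rule integral_bounded_linear[symmetric, OF linear_conv_bounded_linear[THEN iffD1, OF linear_cadj]
            fourth_moment_integrable(2)[OF nu assms(3)]])
    also have "\<dots> = (LINT s|\<nu>. s ** s)"
      using sets_eq_imp_space_eq[OF nu(2)]
      by (intro Bochner_Integration.integral_cong) (auto intro!: hermD psd_herm square_in_psd)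
    finally show ?thesis by (simp add: herm_def assms(4))
  qed
  have Yb: "Y n \<in> borel_measurable (M (\<mu> n))" if n: "n \<ge> 1" for n
  proof -
    have "(\<lambda>x :: 'f^'q^'q. (1 / sqrt (real n)) *\<^sub>R (x ** x - real n *\<^sub>R \<sigma>2)) \<in> borel_measurable psd_borel"
      by measurable
    then show ?thesis
      unfolding Y_def by (rule measurable_compose[OF bessel_random_walkD(2)[OF rw[OF n]]])
  qed
  have Yherm: "Y n \<omega> \<in> herm" if n: "n \<ge> 1" and w: "\<omega> \<in> space (M (\<mu> n))" for n \<omega>
  proof -
    have "S (\<mu> n) n \<omega> \<in> psd"
      using measurable_space[OF bessel_random_walkD(2)[OF rw[OF n]] w] by simp
    then have "S (\<mu> n) n \<omega> ** S (\<mu> n) n \<omega> \<in> herm" by (intro psd_herm square_in_psd)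
    with \<sigma>h show ?thesis
      unfolding Y_def by (intro subspace_scale[OF subspace_herm] subspace_diff[OF subspace_herm])
  qed
  have Yh: "Y n \<in> measurable (M (\<mu> n)) herm_borel" if n: "n \<ge> 1" for n
    unfolding herm_borel_def using Yb[OF n] Yherm[OF n] by (intro measurable_restrict_space2) auto
  \<comment> \<open>The index is shifted because nothing is known about \<open>\<mu> 0\<close>.\<close>
  define P where "P n = distr (M (\<mu> (Suc n))) borel (Y (Suc n))" for n
  have charY: "(\<lambda>n. CLINT \<omega>|M (\<mu> n). iexp (a \<bullet> Y n \<omega>)) \<longlonglongrightarrow> (CLINT x|N0. iexp (a \<bullet> x))" for a
    unfolding Y_def N0(3)
    by (rule char_normalised_walk[where M="\<lambda>n. M (\<mu> n)" and S="\<lambda>n. S (\<mu> n)"])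
      (use assms rw in auto)
  have prob_P: "prob_space (P n)" for n
    unfolding P_def by (rule prob_space.prob_space_distr[OF bessel_random_walkD(1)[OF rw] Yb]) simp_all
  have charP: "(\<lambda>k. CLINT x|P k. iexp (a \<bullet> x)) \<longlonglongrightarrow> (CLINT x|N0. iexp (a \<bullet> x))" for a
  proof -
    have "(CLINT x|P k. iexp (a \<bullet> x)) = (CLINT \<omega>|M (\<mu> (Suc k)). iexp (a \<bullet> Y (Suc k) \<omega>))" for k
      unfolding P_def by (rule integral_distr[OF Yb]) simp_all
    then show ?thesis
      using charY[of a, THEN filterlim_sequentially_Suc[THEN iffD2]] by (simp only:)
  qed
  interpret char_convergent P N0
    by (rule char_convergent.intro[OF prob_P _ N0(1,2) charP]) (simp add: P_def)
  have "weak_conv_on herm (\<lambda>n. distr (M (\<mu> n)) herm_borel (Y n)) (distr N0 herm_borel herm_part)"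
    unfolding weak_conv_on_def
  proof (intro allI impI)
    fix f :: "'f^'q^'q \<Rightarrow> real" assume fc: "continuous_on herm f" and fb: "bounded (f ` herm)"
    obtain B where B: "\<And>x. x \<in> herm \<Longrightarrow> \<bar>f x\<bar> \<le> B" using fb by (auto simp: bounded_iff)
    let ?g = "\<lambda>x. f (herm_part x)"
    have gc: "continuous_on UNIV ?g"
      by (rule continuous_on_compose2[OF fc continuous_on_herm_part]) (auto simp: herm_part_herm)
    have gB: "\<bar>?g x\<bar> \<le> B" for x by (rule B[OF herm_part_herm])
    have gm: "?g \<in> borel_measurable borel" by (rule borel_measurable_continuous_onI[OF gc])
    have fm: "f \<in> borel_measurable herm_borel"
      unfolding herm_borel_def by (rule borel_measurable_continuous_on_restrict[OF fc])
    have idN: "(\<lambda>x. x) \<in> borel_measurable N0" using measurable_ident_sets[OF N0(2)] by simp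
    have hN: "herm_part \<in> measurable N0 herm_borel"
      unfolding herm_borel_def
      by (rule measurable_restrict_space2) (auto intro: herm_part_herm
          measurable_compose[OF idN borel_measurable_continuous_onI[OF continuous_on_herm_part]])
    have "(LINT x|distr (M (\<mu> (Suc n))) herm_borel (Y (Suc n)). f x) = (LINT x|P n. ?g x)" for n
    proof -
      have "(LINT x|distr (M (\<mu> (Suc n))) herm_borel (Y (Suc n)). f x) = (LINT \<omega>|M (\<mu> (Suc n)). f (Y (Suc n) \<omega>))"
        by (rule integral_distr[OF Yh fm]) simp
      also have "\<dots> = (LINT \<omega>|M (\<mu> (Suc n)). ?g (Y (Suc n) \<omega>))"
        by (intro Bochner_Integration.integral_cong refl) (simp add: herm_part_id Yherm)
      also have "\<dots> = (LINT x|P n. ?g x)"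
        unfolding P_def by (rule integral_distr[symmetric, OF Yb gm]) simp
      finally show ?thesis .
    qed
    moreover have "(LINT x|distr N0 herm_borel herm_part. f x) = (LINT x|N0. ?g x)"
      by (rule integral_distr[OF hN fm])
    ultimately have "(\<lambda>n. LINT x|distr (M (\<mu> (Suc n))) herm_borel (Y (Suc n)). f x) \<longlonglongrightarrow>
        (LINT x|distr N0 herm_borel herm_part. f x)"
      using bounded_continuous_converges[OF gc gB] by (simp only:)
    then show "(\<lambda>n. LINT x|distr (M (\<mu> n)) herm_borel (Y n). f x) \<longlonglongrightarrow> (LINT x|distr N0 herm_borel herm_part. f x)"
      by (rule filterlim_sequentially_Suc[THEN iffD1])
  qed
  with normal show ?thesis unfolding Y_def by blast
qed

end
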